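(* Let $\{(G_t,Y_t)\}_{t\ge 0}$ be a DED process with period $K$, parameter set $\Theta\subseteq\mathbb R^d$, event probabilities $p_t(\theta)=1-\exp(-\lambda_t(\theta))$ with $\lambda_t=\lambda_{t\bmod K}$, and limiting gating frequencies $\gamma(\theta)$. Let $\theta_0\in\operatorname{int}(\Theta)$, and assume: (1) there are constants $0<\lambda_{\min}\le\lambda_{\max}<\infty$ with $\lambda_{\min}\le\lambda_r(\theta)\le\lambda_{\max}$ for all $r=0,\dots,K-1$ and $\theta\in\Theta$; (2) for each $r=0,\dots,K-1$, $\lambda_r:\Theta\to\mathbb R$ extends to a $C^3$ map on an open set containing $\Theta$; (3) if $\theta\in\Theta$ satisfies $\lambda_r(\theta)=\lambda_r(\theta_0)$ for all $r$ with $\gamma_r(\theta_0)>0$, then $\theta=\theta_0$; (4) $\Theta$ is compact; (5) the matrix $\mathcal I_0=\mathcal I(\theta_0;\gamma(\theta_0))$ is positive definite. Let $\tilde\theta_T$ be any $\Theta$-valued preliminary estimator (a function of $X_{0:T-1}$) with $\sqrt T(\tilde\theta_T-\theta_0)=O_{P_{\theta_0,T}}(1)$. Let $\hat\gamma_T=(\hat\gamma_{0,T},\dots,\hat\gamma_{K-1,T})$ with $\hat\gamma_{r,T}=\frac1L\sum_{\ell=0}^{L-1}G_{r+\ell K}$, $L=\lfloor T/K\rfloor$. Define $$\hat\theta_T^{\mathrm{os}}=\tilde\theta_T+\bigl[\mathcal I(\tilde\theta_T;\hat\gamma_T)\bigr]^{-1}\frac{U_T(\tilde\theta_T)}{T},\qquad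 U_T(\theta)=\nabla\ell_T(\theta),$$ on the event that $\mathcal I(\tilde\theta_T;\hat\gamma_T)$ is invertible, and $\hat\theta_T^{\mathrm{os}}=\tilde\theta_T$ otherwise. Then, as $T\to\infty$, $$\sqrt T(\hat\theta_T^{\mathrm{os}}-\theta_0)\Rightarrow\mathcal N(0,\mathcal I_0^{-1})\quad\text{under }P_{\theta_0,T}.$$ Moreover, for every fixed $h\in\mathbb R^d$, $$\sqrt T\Bigl(\hat\theta_T^{\mathrm{os}}-\theta_0-\frac h{\sqrt T}\Bigr)\Rightarrow\mathcal N(0,\mathcal I_0^{-1})\quad\text{under }P_{\theta_0+h/\sqrt T,\,T},$$ so that $(\hat\theta_T^{\mathrm{os}})$ is regular at $\theta_0$ with limit law $\mathcal N(0,\mathcal I_0^{-1})$.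
   Context: $\mathbb N=\{0,1,2,\dots\}$. Fix an integer $K\ge 1$ (period), an integer $D\in\mathbb N$ (dead time), and a parameter set $\Theta\subseteq\mathbb R^d$. For each $\theta\in\Theta$ let $p_t(\theta)\in[0,1]$, $t\in\mathbb N$, with $p_{t+K}(\theta)=p_t(\theta)$, written $p_t(\theta)=1-\exp(-\lambda_t(\theta))$. A DED (dead-time event detection) process is a stochastic process $\{(G_t,Y_t)\}_{t\ge0}$ with $G_t,Y_t\in\{0,1\}$, whose law under parameter $\theta$ is denoted $P_\theta$, such that: (i) (observation) under $P_\theta$ there are independent $Z_t\sim\mathrm{Ber}(p_t(\theta))$, $t\in\mathbb N$, with $Y_t=G_tZ_t$; (ii) (dead time) almost surely, $Y_t=1$ implies $G_s=0$ for all $s\in\{t+1,\dots,t+D\}$; (iii) (causality) for every $t$ there are $U_t\sim\mathrm{Unif}([0,1])$, jointly independent of the event sequence $\{Z_s\}_{s\ge0}$ and the past observations $\{(G_s,Y_s)\}_{s=0}^{t-1}$, and a measurable map $\Phi_t:\{0,1\}^{2t}\times[0,1]\to\{0,1\}$, not depending on $\theta$, such that $G_t=\Phi_t(G_0,Y_0,\dots,G_{t-1},Y_{t-1},U_t)$ a.s. (these uniform variables are unrelated to the score $U_T(\theta)$); (iv) (gating-frequency convergence) for every $\theta\in\Theta$ there is $\gamma(\theta)\in[0,1]^K$ such that for each $r=0,\dots,K-1$, $\frac1L\sum_{\ell=0}^{L-1}G_{r+\ell K}\to\gamma_r(\theta)$ in $P_\theta$-probability as $L\to\infty$. $P_{\theta,T}$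 denotes the law of $X_{0:T-1}=((G_0,Y_0),\dots,(G_{T-1},Y_{T-1}))$ under $\theta$. Up to an additive term not depending on $\theta$, the log-likelihood $\ell_T(\theta)=\log P_{\theta,T}(X_{0:T-1})$ is $$\ell_T(\theta)=\sum_{r=0}^{K-1}\bigl[S_r(T)\log p_r(\theta)+(N_r(T)-S_r(T))\log(1-p_r(\theta))\bigr],$$ with $N_r(T)=\sum_{0\le t<T,\ t\bmod K=r}G_t$ and $S_r(T)=\sum_{0\le t<T,\ t\bmod K=r}Y_t$. Gradients at points of $\Theta$ are those of the $C^3$ extensions. Fisher information: for $r=0,\dots,K-1$, $\mathcal I_r(\theta)=\frac{1-p_r(\theta)}{p_r(\theta)}\nabla\lambda_r(\theta)\nabla\lambda_r(\theta)^\top$; for $\alpha\in[0,1]^K$, $\mathcal I(\theta;\alpha)=\frac1K\sum_{r=0}^{K-1}\alpha_r\mathcal I_r(\theta)$. Regular at $\theta_0$ with limit law $\mathcal L$: for every fixed sufficiently small $h\in\mathbb R^d$, $\sqrt T(\hat\theta_T-\theta_0-h/\sqrt T)\Rightarrow\mathcal L$ under $P_{\theta_0+h/\sqrt T,T}$. *)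

theory Defs
  imports "HOL-Probability.Probability"
begin
definition event_prob :: "(nat \<Rightarrow> 'p \<Rightarrow> real) \<Rightarrow> nat \<Rightarrow> 'p \<Rightarrow> real" where
  "event_prob lam t \<theta> = 1 - exp (- lam t \<theta>)"

text \<open>The data \<open>X\<^sub>0, \<dots>, X\<^sub>T\<^sub>-\<^sub>1\<close> with \<open>X\<^sub>t = (G\<^sub>t, Y\<^sub>t)\<close>, as a list of length \<open>T\<close>;
  \<open>True\<close> stands for 1 and \<open>False\<close> for 0.\<close>

definition observations ::
  "(nat \<Rightarrow> 'a \<Rightarrow> bool) \<Rightarrow> (nat \<Rightarrow> 'a \<Rightarrow> bool) \<Rightarrow> nat \<Rightarrow> 'a \<Rightarrow> (bool \<times> bool) list" where
  "observations G Y T \<omega> = map (\<lambda>t. (G t \<omega>, Y t \<omega>)) [0..<T]"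

definition data_space :: "nat \<Rightarrow> (bool \<times> bool) list measure" where
  "data_space T = count_space {xs. length xs = T}"

text \<open>\<open>P \<theta>\<close> is the probability on the sample space under the parameter \<open>\<theta>\<close>. The event variables
  \<open>Z\<close> and the randomizers \<open>U\<close> may depend on \<open>\<theta>\<close>, the gating maps \<open>\<Phi>\<close> may not. The randomizer
  \<open>U\<close> of time \<open>t\<close> is independent of the pair consisting of the whole event sequence and the past
  observations; nothing is assumed on the joint law of the randomizers of different times.\<close>

locale ded_process =
  fixes K D :: nat
    and \<Theta> :: "'p set"
    and p :: "nat \<Rightarrow> 'p \<Rightarrow> real"
    and P :: "'p \<Rightarrow> 'a measure"
    and G Y :: "nat \<Rightarrow> 'a \<Rightarrow> bool"
    and \<gamma> :: "'p \<Rightarrow> nat \<Rightarrow> real"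
  assumes period_pos: "1 \<le> K"
    and event_prob_range: "\<And>t \<theta>. \<theta> \<in> \<Theta> \<Longrightarrow> p t \<theta> \<in> {0..1}"
    and event_prob_periodic: "\<And>t \<theta>. \<theta> \<in> \<Theta> \<Longrightarrow> p (t + K) \<theta> = p t \<theta>"
    and prob_space_P: "\<And>\<theta>. \<theta> \<in> \<Theta> \<Longrightarrow> prob_space (P \<theta>)"
    and measurable_G: "\<And>t \<theta>. \<theta> \<in> \<Theta> \<Longrightarrow> G t \<in> P \<theta> \<rightarrow>\<^sub>M count_space UNIV"
    and measurable_Y: "\<And>t \<theta>. \<theta> \<in> \<Theta> \<Longrightarrow> Y t \<in> P \<theta> \<rightarrow>\<^sub>M count_space UNIV"
    and observation_causality:
      "\<exists>\<Phi> :: nat \<Rightarrow> (bool \<times> bool) list \<times> real \<Rightarrow> bool.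
        (\<forall>t. \<Phi> t \<in> data_space t \<Otimes>\<^sub>M restrict_space borel {0..1} \<rightarrow>\<^sub>M count_space UNIV) \<and>
        (\<forall>\<theta>\<in>\<Theta>. \<exists>Z :: nat \<Rightarrow> 'a \<Rightarrow> bool.
          prob_space.indep_vars (P \<theta>) (\<lambda>_. count_space UNIV) Z UNIV \<and>
          (\<forall>t. distr (P \<theta>) (count_space UNIV) (Z t) = measure_pmf (bernoulli_pmf (p t \<theta>))) \<and>
          (\<forall>t. AE \<omega> in P \<theta>. Y t \<omega> \<longleftrightarrow> G t \<omega> \<and> Z t \<omega>) \<and>
          (\<forall>t. \<exists>U :: 'a \<Rightarrow> real.
            U \<in> borel_measurable (P \<theta>) \<and>
            distr (P \<theta>) borel U = uniform_measure lborel {0..1} \<and>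
            prob_space.indep_set (P \<theta>)
              (sets (vimage_algebra (space (P \<theta>)) U borel))
              (sets (vimage_algebra (space (P \<theta>)) (\<lambda>\<omega>. (\<lambda>s. Z s \<omega>, observations G Y t \<omega>))
                 (PiM UNIV (\<lambda>_. count_space UNIV) \<Otimes>\<^sub>M data_space t))) \<and>
            (AE \<omega> in P \<theta>. G t \<omega> = \<Phi> t (observations G Y t \<omega>, U \<omega>))))"
    and dead_time:
      "\<And>\<theta>. \<theta> \<in> \<Theta> \<Longrightarrow> AE \<omega> in P \<theta>. \<forall>t. Y t \<omega> \<longrightarrow> (\<forall>s\<in>{t+1..t+D}. \<not> G s \<omega>)"
    and gating_frequency_range: "\<And>\<theta> r. \<theta> \<in> \<Theta> \<Longrightarrow> r < K \<Longrightarrow> \<gamma> \<theta> r \<in> {0..1}"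
    and gating_frequency_converges:
      "\<And>\<theta> r \<epsilon>. \<theta> \<in> \<Theta> \<Longrightarrow> r < K \<Longrightarrow> \<epsilon> > 0 \<Longrightarrow>
        (\<lambda>L. measure (P \<theta>) {\<omega> \<in> space (P \<theta>).
           \<bar>(\<Sum>l<L. of_bool (G (r + l * K) \<omega>)) / real L - \<gamma> \<theta> r\<bar> > \<epsilon>}) \<longlonglongrightarrow> 0"

definition data_law ::
  "('p \<Rightarrow> 'a measure) \<Rightarrow> (nat \<Rightarrow> 'a \<Rightarrow> bool) \<Rightarrow> (nat \<Rightarrow> 'a \<Rightarrow> bool) \<Rightarrow> 'p \<Rightarrow> nat
    \<Rightarrow> (bool \<times> bool) list measure" where
  "data_law P G Y \<theta> T = distr (P \<theta>) (data_space T) (observations G Y T)"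

definition gate_count :: "nat \<Rightarrow> nat \<Rightarrow> (bool \<times> bool) list \<Rightarrow> nat \<Rightarrow> real" where
  "gate_count K T xs r = (\<Sum>t | t < T \<and> t mod K = r. of_bool (fst (xs ! t)))"

definition event_count :: "nat \<Rightarrow> nat \<Rightarrow> (bool \<times> bool) list \<Rightarrow> nat \<Rightarrow> real" where
  "event_count K T xs r = (\<Sum>t | t < T \<and> t mod K = r. of_bool (snd (xs ! t)))"

definition gating_freq :: "nat \<Rightarrow> nat \<Rightarrow> (bool \<times> bool) list \<Rightarrow> nat \<Rightarrow> real" where
  "gating_freq K T xs r =
     (let L = T div K in (\<Sum>l<L. of_bool (fst (xs ! (r + l * K)))) / real L)"

text \<open>The log-likelihood without its additive term that does not depend on \<open>\<theta>\<close> (the conditional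
  probabilities of the gates given the past).\<close>

definition log_lik ::
  "nat \<Rightarrow> (nat \<Rightarrow> 'p \<Rightarrow> real) \<Rightarrow> nat \<Rightarrow> (bool \<times> bool) list \<Rightarrow> 'p \<Rightarrow> real" where
  "log_lik K p T xs \<theta> =
     (\<Sum>r<K. event_count K T xs r * ln (p r \<theta>)
           + (gate_count K T xs r - event_count K T xs r) * ln (1 - p r \<theta>))"

definition grad :: "('v::real_inner \<Rightarrow> real) \<Rightarrow> 'v \<Rightarrow> 'v" where
  "grad f x = (THE v. GDERIV f x :> v)"

text \<open>At boundary points of the parameter set the gradients depend on the chosen smooth extension, so
  \<open>lam\<close> in the score and in the Fisher information is the extended rate.\<close>

definition score ::
  "nat \<Rightarrow> (nat \<Rightarrow> 'v::real_inner \<Rightarrow> real) \<Rightarrow> nat \<Rightarrow> (bool \<times> bool) list \<Rightarrow> 'v \<Rightarrow> 'v" where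
  "score K lam T xs \<theta> = grad (log_lik K (event_prob lam) T xs) \<theta>"

definition outer :: "real^'d \<Rightarrow> real^'d^'d" where
  "outer v = (\<chi> i j. v $ i * v $ j)"

definition fisher_component ::
  "(nat \<Rightarrow> real^'d \<Rightarrow> real) \<Rightarrow> nat \<Rightarrow> real^'d \<Rightarrow> real^'d^'d" where
  "fisher_component lam r \<theta> =
     ((1 - event_prob lam r \<theta>) / event_prob lam r \<theta>) *\<^sub>R outer (grad (lam r) \<theta>)"

definition fisher ::
  "nat \<Rightarrow> (nat \<Rightarrow> real^'d \<Rightarrow> real) \<Rightarrow> real^'d \<Rightarrow> (nat \<Rightarrow> real) \<Rightarrow> real^'d^'d" where
  "fisher K lam \<theta> \<alpha> = (1 / real K) *\<^sub>R (\<Sum>r<K. \<alpha> r *\<^sub>R fisher_component lam r \<theta>)"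

definition pos_def :: "real^'d^'d \<Rightarrow> bool" where
  "pos_def A \<longleftrightarrow> transpose A = A \<and> (\<forall>v. v \<noteq> 0 \<longrightarrow> 0 < v \<bullet> (A *v v))"

definition one_step ::
  "nat \<Rightarrow> (nat \<Rightarrow> real^'d \<Rightarrow> real) \<Rightarrow> (nat \<Rightarrow> (bool \<times> bool) list \<Rightarrow> real^'d)
    \<Rightarrow> nat \<Rightarrow> (bool \<times> bool) list \<Rightarrow> real^'d" where
  "one_step K lam est T xs =
     (let J = fisher K lam (est T xs) (gating_freq K T xs) in
      if invertible J
      then est T xs + matrix_inv J *v (score K lam T xs (est T xs) /\<^sub>R real T)
      else est T xs)"

text \<open>\<open>k\<close>-fold continuous differentiability, meant for open \<open>S\<close>.\<close>

primrec Ck_on :: "nat \<Rightarrow> ('v::real_normed_vector \<Rightarrow> real) \<Rightarrow> 'v set \<Rightarrow> bool" where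
  "Ck_on 0 f S \<longleftrightarrow> continuous_on S f"
| "Ck_on (Suc k) f S \<longleftrightarrow>
     (\<forall>x\<in>S. f differentiable (at x)) \<and> (\<forall>v. Ck_on k (\<lambda>x. frechet_derivative f (at x) v) S)"

text \<open>Weak convergence of Borel probability measures (the library has it on the real line only).\<close>

definition weak_conv_to ::
  "(nat \<Rightarrow> 'v::topological_space measure) \<Rightarrow> 'v measure \<Rightarrow> bool" where
  "weak_conv_to M N \<longleftrightarrow>
     (\<forall>f :: 'v \<Rightarrow> real. continuous_on UNIV f \<and> bounded (range f) \<longrightarrow>
        (\<lambda>n. \<integral>x. f x \<partial>M n) \<longlonglongrightarrow> (\<integral>x. f x \<partial>N))"

definition bounded_in_prob ::
  "(nat \<Rightarrow> 'b measure) \<Rightarrow> (nat \<Rightarrow> 'b \<Rightarrow> 'v::real_normed_vector) \<Rightarrow> bool" where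
  "bounded_in_prob M X \<longleftrightarrow>
     (\<forall>\<epsilon>>0. \<exists>C. \<forall>\<^sub>F T in sequentially. measure (M T) {x \<in> space (M T). norm (X T x) > C} \<le> \<epsilon>)"

text \<open>The normal law with mean \<open>\<mu>\<close> and positive definite covariance matrix \<open>\<Sigma>\<close>.\<close>

definition normal_law :: "real^'d \<Rightarrow> real^'d^'d \<Rightarrow> (real^'d) measure" where
  "normal_law \<mu> \<Sigma> = density lborel (\<lambda>x. ennreal
     (exp (- ((x - \<mu>) \<bullet> (matrix_inv \<Sigma> *v (x - \<mu>))) / 2) / sqrt ((2 * pi) ^ CARD('d) * det \<Sigma>)))"

text \<open>The law of \<open>\<surd>T (est\<^sub>T - \<theta>\<^sub>0 - h / \<surd>T)\<close> when the parameter is \<open>\<theta>\<^sub>0 + h / \<surd>T\<close>; \<open>Q \<theta> T\<close> is the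
  law of the data of length \<open>T\<close> under \<open>\<theta>\<close>. For \<open>\<theta>\<^sub>0\<close> in the interior of the parameter set,
  the local parameter leaves this set for finitely many \<open>T\<close> only.\<close>

definition local_error_law ::
  "('v::euclidean_space \<Rightarrow> nat \<Rightarrow> 'b measure) \<Rightarrow> (nat \<Rightarrow> 'b \<Rightarrow> 'v) \<Rightarrow> 'v \<Rightarrow> 'v \<Rightarrow> nat \<Rightarrow> 'v measure"
  where
  "local_error_law Q est \<theta>\<^sub>0 h T =
     distr (Q (\<theta>\<^sub>0 + h /\<^sub>R sqrt T) T) borel
       (\<lambda>xs. sqrt T *\<^sub>R (est T xs - \<theta>\<^sub>0 - h /\<^sub>R sqrt T))"

definition regular_at ::
  "('v::euclidean_space \<Rightarrow> nat \<Rightarrow> 'b measure) \<Rightarrow> (nat \<Rightarrow> 'b \<Rightarrow> 'v) \<Rightarrow> 'v \<Rightarrow> 'v measure \<Rightarrow> bool" where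
  "regular_at Q est \<theta>\<^sub>0 N \<longleftrightarrow>
     (\<exists>\<delta>>0. \<forall>h. norm h < \<delta> \<longrightarrow> weak_conv_to (local_error_law Q est \<theta>\<^sub>0 h) N)"

end

theory Submission
  imports Defs
begin

text \<open>Everything is done directly under the local parameter \<open>\<theta>\<^sub>0 + h / \<surd>T\<close>; the first claim is the case
  \<open>h = 0\<close>. The probability of a data string is a product of gate probabilities free of \<open>\<theta>\<close> and of Bernoulli
  probabilities of the events at open gates. Hence the second moment of the likelihood ratio with respect to
  \<open>\<theta>\<^sub>0\<close> stays bounded, and both the rate of the preliminary estimator and the limits of the gating
  frequencies carry over from \<open>\<theta>\<^sub>0\<close> to the local parameter.

  The one-step estimator centred at the local parameter and scaled by \<open>\<surd>T\<close> then equals \<open>I\<^sub>0\<^sup>-\<^sup>1\<close> times a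
  linear combination of the centred event counts, up to an error that vanishes in probability; only
  differentiability of the rates at \<open>\<theta>\<^sub>0\<close> and continuity of their gradients there enter.
  The characteristic function of the linear combination, divided by the product of the conditional
  characteristic functions over the open gates, has mean exactly 1. That product depends on the gates only
  and converges in probability to the characteristic function of the normal limit. Levy's continuity
  theorem in several dimensions, which follows from its one-dimensional version by approximation with
  trigonometric polynomials, finishes the proof.\<close>

subsection \<open>The continuity theorem for characteristic functions in several dimensions\<close>

text \<open>The gates react to the whole past, so the centred counts are not sums of independent
  terms, and the gating frequencies are known to settle only under each fixed parameter, not along
  \<open>\<theta>\<^sub>0 + h / sqrt T\<close>. Two features of the model meet these obstacles. At
  an open gate the event probability depends on the phase \<open>t mod K\<close> and on \<theta>
  alone, so a product over open gates of factors with conditional mean 1 has total mean 1, whatever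
  the gate probabilities. And the gate probabilities are common to all \<theta>, so they cancel in
  likelihood ratios. The preliminary estimator may depend on the counts in any way. The score,
  however, sees the data through finitely many counts, so it can be expanded along deterministic
  sequences of data strings on which the scaled estimation error and the residuals are bounded and
  the gating frequencies converge; tightness turns this into a statement in probability, without
  discretisation or sample splitting. The error of the preliminary estimator cancels at this level:
  its effect on the score is undone by the Newton correction.\<close>

inductive trig_poly :: "('v::real_inner \<Rightarrow> real) \<Rightarrow> bool" where
  cos: "trig_poly (\<lambda>x. c * cos (u \<bullet> x + s))"
| add: "trig_poly f \<Longrightarrow> trig_poly g \<Longrightarrow> trig_poly (\<lambda>x. f x + g x)"

lemma trig_poly_const: "trig_poly (\<lambda>x. c)"
  using trig_poly.cos[of c 0 0] by simp

lemma trig_poly_sin: "trig_poly (\<lambda>x. c * sin (u \<bullet> x))"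
proof -
  have "sin (u \<bullet> x) = cos (u \<bullet> x + - (pi / 2))" for x
    by (simp only: cos_add) simp
  then show ?thesis
    using trig_poly.cos[of c u "- (pi / 2)"] by simp
qed

lemma trig_poly_sum: "finite I \<Longrightarrow> (\<And>i. i \<in> I \<Longrightarrow> trig_poly (f i)) \<Longrightarrow> trig_poly (\<lambda>x. \<Sum>i\<in>I. f i x)"
  by (induction I rule: finite_induct) (auto intro: trig_poly_const trig_poly.add)

text \<open>The product-to-sum formula turns a product of two generators into a sum of two
  generators; bilinearity does the rest.\<close>

lemma trig_poly_mult:
  assumes "trig_poly f" "trig_poly g"
  shows "trig_poly (\<lambda>x. f x * g x)"
proof -
  have cos_mult: "trig_poly (\<lambda>x. c * cos (u \<bullet> x + s) * g x)" for c s and u :: 'a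
    using assms(2)
  proof induction
    case (cos c' u' s')
    have "(\<lambda>x. c * cos (u \<bullet> x + s) * (c' * cos (u' \<bullet> x + s')))
        = (\<lambda>x. (c * c' / 2) * cos ((u - u') \<bullet> x + (s - s')) + (c * c' / 2) * cos ((u + u') \<bullet> x + (s + s')))"
    proof
      fix x
      have "(u - u') \<bullet> x + (s - s') = (u \<bullet> x + s) - (u' \<bullet> x + s')"
        and "(u + u') \<bullet> x + (s + s') = (u \<bullet> x + s) + (u' \<bullet> x + s')"
        by (simp_all add: inner_diff_left inner_add_left)
      then show "c * cos (u \<bullet> x + s) * (c' * cos (u' \<bullet> x + s'))
        = (c * c' / 2) * cos ((u - u') \<bullet> x + (s - s')) + (c * c' / 2) * cos ((u + u') \<bullet> x + (s + s'))"
        by (simp only: cos_add[of "u \<bullet> x + s"] cos_diff[of "u \<bullet> x + s"]) (simp add: field_simps)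
    qed
    then show ?case
      by (simp only: trig_poly.intros)
  next
    case (add f g)
    then show ?case
      by (auto simp: distrib_left intro: trig_poly.add)
  qed
  show ?thesis
    using assms(1) by induction (auto simp: distrib_right intro: cos_mult trig_poly.add)
qed

text \<open>The sine chart turns a linear functional into a finite sum of sines, and trigonometric
  polynomials form an algebra, so induction on the polynomial applies.\<close>

lemma trig_poly_of_polynomial:
  fixes q :: "'v::euclidean_space \<Rightarrow> real"
  assumes "real_polynomial_function q"
  shows "trig_poly (\<lambda>x. q (\<Sum>b\<in>Basis. sin (x \<bullet> b / R) *\<^sub>R b))"
  using assms
proof induction
  case (linear f)
  interpret bounded_linear f by fact
  have "f (\<Sum>b\<in>Basis. sin (x \<bullet> b / R) *\<^sub>R b) = (\<Sum>b\<in>Basis. f b * sin ((b /\<^sub>R R) \<bullet> x))" for x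
    by (simp add: sum scaleR inner_commute divide_inverse mult.commute)
  then show ?case
    using trig_poly_sum[OF finite_Basis trig_poly_sin, of f "\<lambda>b. b /\<^sub>R R"] by simp
qed (auto intro: trig_poly_const trig_poly.add trig_poly_mult)

lemma trig_poly_integrable:
  fixes M :: "('v::euclidean_space) measure"
  assumes "trig_poly g" "prob_space M" "sets M = sets borel"
  shows "integrable M g"
proof -
  interpret prob_space M by fact
  have [measurable_cong]: "sets M = sets borel" by fact
  show ?thesis
    using assms(1)
  proof induction
    case (cos c u s)
    show ?case
      by (rule integrable_const_bound[where B = "\<bar>c\<bar>"])
         (auto simp: abs_mult mult_left_le intro!: AE_I2)
  qed auto
qed

lemma iexp_integrable:
  fixes M :: "('v::euclidean_space) measure"
  assumes "prob_space M" "sets M = sets borel"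
  shows "integrable M (\<lambda>x. iexp (u \<bullet> x))"
proof -
  interpret prob_space M by fact
  have [measurable_cong]: "sets M = sets borel" by fact
  show ?thesis
    by (rule integrable_const_bound[where B = 1]) (auto intro!: AE_I2)
qed

lemma trig_poly_integral_tendsto:
  fixes M :: "nat \<Rightarrow> ('v::euclidean_space) measure"
  assumes M: "\<And>n. prob_space (M n)" "\<And>n. sets (M n) = sets borel"
    and N: "prob_space N" "sets N = sets borel"
    and conv: "\<And>u. (\<lambda>n. \<integral>x. iexp (u \<bullet> x) \<partial>M n) \<longlonglongrightarrow> (\<integral>x. iexp (u \<bullet> x) \<partial>N)"
    and g: "trig_poly g"
  shows "(\<lambda>n. \<integral>x. g x \<partial>M n) \<longlonglongrightarrow> (\<integral>x. g x \<partial>N)"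
  using g
proof induction
  case (cos c u s)
  \<comment> \<open>A cosine with phase \<open>s\<close> is the real part of the characteristic
    integrand rotated by \<open>cis s\<close>, so its integral depends continuously on a single
    value of the characteristic function.\<close>
  have eq: "(\<integral>x. c * cos (u \<bullet> x + s) \<partial>Q) = Re (c * cis s * (\<integral>x. iexp (u \<bullet> x) \<partial>Q))"
    if Q: "prob_space Q" "sets Q = sets borel" for Q :: "'v measure"
  proof -
    have "Re (c * cis s * (\<integral>x. iexp (u \<bullet> x) \<partial>Q)) = Re (\<integral>x. c * cis s * iexp (u \<bullet> x) \<partial>Q)"
      by simp
    also have "\<dots> = (\<integral>x. Re (c * cis s * iexp (u \<bullet> x)) \<partial>Q)"
      by (rule integral_Re[symmetric])
         (intro integrable_mult_right impI iexp_integrable Q)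
    also have "\<dots> = (\<integral>x. c * cos (u \<bullet> x + s) \<partial>Q)"
      by (simp add: cis_conv_exp[symmetric] cos_add algebra_simps)
    finally show ?thesis ..
  qed
  show ?case
    unfolding eq[OF M] eq[OF N] by (intro tendsto_intros conv)
next
  case (add f g)
  then show ?case
    by (simp add: trig_poly_integrable M N tendsto_add)
qed

text \<open>One-dimensional Levy continuity gives weak convergence, which controls integrals of
  continuous functions but not tail indicators. The clamped function \<open>?f\<close> is continuous
  and lies between the indicators of the tails beyond \<open>k + 1\<close> and beyond
  \<open>k\<close>; hence the radius \<open>k + 1\<close>.\<close>

lemma char_tight:
  fixes M :: "nat \<Rightarrow> real measure"
  assumes M: "\<And>n. real_distribution (M n)" and N: "real_distribution N"
    and conv: "\<And>t. (\<lambda>n. char (M n) t) \<longlonglongrightarrow> char N t" and "0 < e"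
  shows "\<exists>R>0. (\<forall>\<^sub>F n in sequentially. measure (M n) {x. R < \<bar>x\<bar>} < e) \<and> measure N {x. R < \<bar>x\<bar>} < e"
proof -
  interpret N: real_distribution N by fact
  interpret M: real_distribution "M n" for n by fact
  have weak: "weak_conv_m M N"
    by (rule levy_continuity) fact+
  have "(\<lambda>k. measure N {x. real k < \<bar>x\<bar>}) \<longlonglongrightarrow> measure N (\<Inter>k. {x. real k < \<bar>x\<bar>})"
    by (rule N.finite_Lim_measure_decseq) (auto simp: decseq_def)
  moreover have "(\<Inter>k. {x. real k < \<bar>x\<bar>}) = {}"
  proof -
    have "\<exists>k. \<not> real k < \<bar>x\<bar>" for x
      using reals_Archimedean2[of "\<bar>x\<bar>"] by (metis less_asym)
    then show ?thesis by auto
  qed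
  ultimately have "(\<lambda>k. measure N {x. real k < \<bar>x\<bar>}) \<longlonglongrightarrow> 0"
    by simp
  then have "\<forall>\<^sub>F k in sequentially. measure N {x. real k < \<bar>x\<bar>} < e"
    using \<open>0 < e\<close> by (rule order_tendstoD)
  then obtain k where k: "measure N {x. real k < \<bar>x\<bar>} < e"
    by (auto simp: eventually_sequentially)
  let ?f = "\<lambda>x. min 1 (max 0 (\<bar>x\<bar> - real k))"
  have int: "integrable Q ?f" if "real_distribution Q" for Q
  proof -
    interpret real_distribution Q by fact
    show ?thesis
      by (rule integrable_const_bound[where B = 1]) auto
  qed
  have ind: "integrable Q (indicator {x. c < \<bar>x\<bar>} :: real \<Rightarrow> real)" if "real_distribution Q" for Q c
  proof -
    interpret real_distribution Q by fact
    show ?thesis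
      by (rule integrable_const_bound[where B = 1]) auto
  qed
  have conv_f: "(\<lambda>n. \<integral>x. ?f x \<partial>M n) \<longlonglongrightarrow> (\<integral>x. ?f x \<partial>N)"
    by (rule weak_conv_imp_integral_bdd_continuous_conv[OF M N weak, where B = 1])
       (auto intro!: continuous_intros)
  have "(\<integral>x. ?f x \<partial>N) \<le> (\<integral>x. indicator {x. real k < \<bar>x\<bar>} x \<partial>N)"
    by (intro integral_mono int ind N) (auto simp: indicator_def)
  also have "\<dots> < e"
    using k by simp
  finally have ev: "\<forall>\<^sub>F n in sequentially. (\<integral>x. ?f x \<partial>M n) < e"
    using conv_f by (rule order_tendstoD[rotated])
  have le: "measure (M n) {x. real k + 1 < \<bar>x\<bar>} \<le> (\<integral>x. ?f x \<partial>M n)" for n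
  proof -
    have "(\<integral>x. indicator {x. real k + 1 < \<bar>x\<bar>} x \<partial>M n) \<le> (\<integral>x. ?f x \<partial>M n)"
      by (intro integral_mono int ind M) (auto simp: indicator_def)
    then show ?thesis
      by simp
  qed
  have "measure N {x. real k + 1 < \<bar>x\<bar>} \<le> measure N {x. real k < \<bar>x\<bar>}"
    by (rule N.finite_measure_mono) auto
  moreover have "\<forall>\<^sub>F n in sequentially. measure (M n) {x. real k + 1 < \<bar>x\<bar>} < e"
    using ev by eventually_elim (use le in \<open>auto intro: le_less_trans\<close>)
  ultimately show ?thesis
    using k by (intro exI[of _ "real k + 1"]) auto
qed

lemma char_coordinate:
  fixes M :: "('v::euclidean_space) measure"
  assumes "sets M = sets borel"
  shows "char (distr M borel (\<lambda>x. x \<bullet> b)) t = (\<integral>x. iexp ((t *\<^sub>R b) \<bullet> x) \<partial>M)"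
proof -
  have [measurable_cong]: "sets M = sets borel" by fact
  show ?thesis
    unfolding char_def by (subst integral_distr) (auto simp: inner_commute)
qed

text \<open>Each coordinate has as characteristic function the joint one restricted to a line, so
  each marginal is tight; a union bound over the basis turns this into a box, with the tolerance
  \<open>e\<close> shared equally among the coordinates.\<close>

lemma char_tight_box:
  fixes M :: "nat \<Rightarrow> ('v::euclidean_space) measure"
  assumes M: "\<And>n. prob_space (M n)" "\<And>n. sets (M n) = sets borel"
    and N: "prob_space N" "sets N = sets borel"
    and conv: "\<And>u. (\<lambda>n. \<integral>x. iexp (u \<bullet> x) \<partial>M n) \<longlonglongrightarrow> (\<integral>x. iexp (u \<bullet> x) \<partial>N)"
    and "0 < e"
  shows "\<exists>R>0. (\<forall>\<^sub>F n in sequentially. measure (M n) {x. \<exists>b\<in>Basis. R < \<bar>x \<bullet> b\<bar>} < e)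
           \<and> measure N {x. \<exists>b\<in>Basis. R < \<bar>x \<bullet> b\<bar>} < e"
proof -
  let ?d = "real DIM('v)"
  define e' where "e' = e / ?d"
  have "0 < e'"
    using \<open>0 < e\<close> by (simp add: e'_def)
  have dist: "real_distribution (distr Q borel (\<lambda>x. x \<bullet> b))"
    if "prob_space Q" "sets Q = sets borel" for Q :: "'v measure" and b
  proof -
    interpret prob_space Q by fact
    have [measurable_cong]: "sets Q = sets borel" by fact
    show ?thesis
      by (rule real_distribution_distr) auto
  qed
  have tail: "measure (distr Q borel (\<lambda>x. x \<bullet> b)) {x. R < \<bar>x\<bar>} = measure Q {x. R < \<bar>x \<bullet> b\<bar>}"
    if "sets Q = sets borel" for Q :: "'v measure" and b R
  proof -
    have [measurable_cong]: "sets Q = sets borel" by fact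
    have "space Q = UNIV"
      using sets_eq_imp_space_eq[OF that] by simp
    then show ?thesis
      by (subst measure_distr) (auto intro!: arg_cong[where f = "measure Q"])
  qed
  have "\<forall>b. \<exists>R>0. (\<forall>\<^sub>F n in sequentially. measure (M n) {x. R < \<bar>x \<bullet> b\<bar>} < e')
      \<and> measure N {x. R < \<bar>x \<bullet> b\<bar>} < e'"
  proof
    fix b :: 'v
    show "\<exists>R>0. (\<forall>\<^sub>F n in sequentially. measure (M n) {x. R < \<bar>x \<bullet> b\<bar>} < e')
      \<and> measure N {x. R < \<bar>x \<bullet> b\<bar>} < e'"
      using char_tight[of "\<lambda>n. distr (M n) borel (\<lambda>x. x \<bullet> b)" "distr N borel (\<lambda>x. x \<bullet> b)" e']
      unfolding char_coordinate[OF M(2)] char_coordinate[OF N(2)] tail[OF M(2)] tail[OF N(2)]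
      using dist[OF M] dist[OF N] conv \<open>0 < e'\<close> by blast
  qed
  then obtain R where R: "\<And>b. 0 < R b" "\<And>b. \<forall>\<^sub>F n in sequentially. measure (M n) {x. R b < \<bar>x \<bullet> b\<bar>} < e'"
    "\<And>b. measure N {x. R b < \<bar>x \<bullet> b\<bar>} < e'"
    by metis
  \<comment> \<open>The sum dominates every \<open>R b\<close> because all of them are positive, so
    one radius serves all coordinates.\<close>
  define S where "S = (\<Sum>b\<in>Basis. R b)"
  have RS: "R b \<le> S" if "b \<in> Basis" for b
    unfolding S_def by (rule member_le_sum) (auto simp: that less_imp_le R)
  have "0 < S"
    unfolding S_def by (rule sum_pos) (auto simp: R)
  have union: "measure Q {x. \<exists>b\<in>Basis. S < \<bar>x \<bullet> b\<bar>} < e"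
    if "prob_space Q" "sets Q = sets borel" "\<And>b. b \<in> Basis \<Longrightarrow> measure Q {x. R b < \<bar>x \<bullet> b\<bar>} < e'"
    for Q :: "'v measure"
  proof -
    interpret prob_space Q by fact
    have [measurable_cong]: "sets Q = sets borel" by fact
    have "space Q = UNIV"
      using sets_eq_imp_space_eq[OF that(2)] by simp
    have "measure Q {x. \<exists>b\<in>Basis. S < \<bar>x \<bullet> b\<bar>} \<le> measure Q (\<Union>b\<in>Basis. {x. R b < \<bar>x \<bullet> b\<bar>})"
      using RS \<open>space Q = UNIV\<close> by (intro finite_measure_mono sets.finite_UN) (force, auto)
    also have "\<dots> \<le> (\<Sum>b\<in>Basis. measure Q {x. R b < \<bar>x \<bullet> b\<bar>})"
      using \<open>space Q = UNIV\<close> by (intro finite_measure_subadditive_finite) auto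
    also have "\<dots> < (\<Sum>b\<in>(Basis::'v set). e')"
      using that(3) by (intro sum_strict_mono) auto
    also have "\<dots> = e"
      by (simp add: e'_def)
    finally show ?thesis .
  qed
  have "\<forall>\<^sub>F n in sequentially. \<forall>b\<in>Basis. measure (M n) {x. R b < \<bar>x \<bullet> b\<bar>} < e'"
    using R(2) by (simp add: eventually_ball_finite_distrib)
  then have "\<forall>\<^sub>F n in sequentially. measure (M n) {x. \<exists>b\<in>Basis. S < \<bar>x \<bullet> b\<bar>} < e"
    by eventually_elim (use union[OF M] in auto)
  then show ?thesis
    using \<open>0 < S\<close> union[OF N R(3)] by blast
qed

text \<open>\<open>x \<mapsto> sin (x / R)\<close> maps into a compact cube and is injective on a box, so that Stone--Weierstrass on
  the cube gives an approximation that is uniform on the box and bounded everywhere.\<close>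

lemma trig_poly_approximation:
  fixes f :: "'v::euclidean_space \<Rightarrow> real"
  assumes f: "continuous_on UNIV f" and B: "\<And>x. \<bar>f x\<bar> \<le> B" and "0 < R" "0 < e"
  obtains g where "trig_poly g" "\<And>x. \<bar>g x\<bar> \<le> B + e"
    "\<And>x. (\<And>b. b \<in> Basis \<Longrightarrow> \<bar>x \<bullet> b\<bar> \<le> R) \<Longrightarrow> \<bar>f x - g x\<bar> \<le> e"
proof -
  let ?C = "cbox (- One) One :: 'v set"
  define F where "F = (\<lambda>s::'v. f (\<Sum>b\<in>Basis. (R * arcsin (s \<bullet> b)) *\<^sub>R b))"
  have "continuous_on ?C F"
    unfolding F_def
    by (rule continuous_on_compose2[OF f])
       (auto intro!: continuous_intros simp: mem_box)
  then obtain q where q: "real_polynomial_function q" "\<And>s. s \<in> ?C \<Longrightarrow> \<bar>F s - q s\<bar> < e"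
    using Stone_Weierstrass_real_polynomial_function[of ?C F e] \<open>0 < e\<close> by auto
  let ?s = "\<lambda>x::'v. \<Sum>b\<in>Basis. sin (x \<bullet> b / R) *\<^sub>R b"
  have sC: "?s x \<in> ?C" for x
    by (auto simp: mem_box)
  have "\<bar>q (?s x)\<bar> \<le> B + e" for x
  proof -
    have "\<bar>F (?s x)\<bar> \<le> B"
      by (simp add: F_def B)
    then show ?thesis
      using q(2)[OF sC[of x]] by linarith
  qed
  moreover have "\<bar>f x - q (?s x)\<bar> \<le> e" if "\<And>b. b \<in> Basis \<Longrightarrow> \<bar>x \<bullet> b\<bar> \<le> R" for x
  proof -
    have "R * arcsin (sin (x \<bullet> b / R)) = x \<bullet> b" if b: "b \<in> Basis" for b
    proof -
      have "\<bar>x \<bullet> b / R\<bar> \<le> 1"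
        using \<open>\<And>b. b \<in> Basis \<Longrightarrow> \<bar>x \<bullet> b\<bar> \<le> R\<close>[OF b] \<open>0 < R\<close> by simp
      then have "\<bar>x \<bullet> b / R\<bar> \<le> pi / 2"
        using pi_ge_two by linarith
      then have "arcsin (sin (x \<bullet> b / R)) = x \<bullet> b / R"
        by (intro arcsin_sin) linarith+
      then show ?thesis
        using \<open>0 < R\<close> by simp
    qed
    then have "F (?s x) = f x"
      by (simp add: F_def euclidean_representation cong: sum.cong)
    then show ?thesis
      using q(2)[OF sC[of x]] by simp
  qed
  ultimately show ?thesis
    using that trig_poly_of_polynomial[OF q(1)] by blast
qed

text \<open>The test function is replaced by a trigonometric polynomial that is close to it on a box
  of almost full mass. Outside the box closeness is lost, but the global bound on the polynomial
  keeps the error proportional to the small mass there.\<close>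

theorem levy_continuity_euclidean:
  fixes M :: "nat \<Rightarrow> ('v::euclidean_space) measure"
  assumes M: "\<And>n. prob_space (M n)" "\<And>n. sets (M n) = sets borel"
    and N: "prob_space N" "sets N = sets borel"
    and conv: "\<And>u. (\<lambda>n. \<integral>x. iexp (u \<bullet> x) \<partial>M n) \<longlonglongrightarrow> (\<integral>x. iexp (u \<bullet> x) \<partial>N)"
  shows "weak_conv_to M N"
  unfolding weak_conv_to_def
proof (intro allI impI)
  fix f :: "'v \<Rightarrow> real"
  assume "continuous_on UNIV f \<and> bounded (range f)"
  then obtain B where f: "continuous_on UNIV f" and B: "\<And>x. \<bar>f x\<bar> \<le> B"
    by (auto simp: bounded_iff)
  have "0 \<le> B"
    using B[of 0] by linarith
  have meas_f[measurable]: "f \<in> borel_measurable borel"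
    using f by (rule borel_measurable_continuous_onI)
  show "(\<lambda>n. \<integral>x. f x \<partial>M n) \<longlonglongrightarrow> (\<integral>x. f x \<partial>N)"
  proof (rule tendstoI)
    fix e :: real assume "0 < e"
    \<comment> \<open>Two approximation errors of size \<open>d * (2 + 2 * B)\<close>, under
      \<open>M n\<close> and under \<open>N\<close>, and one error \<open>d\<close> between the
      integrals of \<open>g\<close> add up to \<open>d * (5 + 4 * B)\<close>. The cap at 1 serves to
      absorb a square of \<open>d\<close>.\<close>
    define d where "d = min 1 (e / (5 + 4 * B))"
    have "0 < d" "d \<le> 1"
      using \<open>0 < e\<close> \<open>0 \<le> B\<close> by (auto simp: d_def)
    have "d * (5 + 4 * B) \<le> e / (5 + 4 * B) * (5 + 4 * B)"
      using \<open>0 \<le> B\<close> by (intro mult_right_mono) (auto simp: d_def)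
    then have d5: "d * (5 + 4 * B) \<le> e"
      using \<open>0 \<le> B\<close> by simp
    obtain R where "0 < R"
      and RM: "\<forall>\<^sub>F n in sequentially. measure (M n) {x. \<exists>b\<in>Basis. R < \<bar>x \<bullet> b\<bar>} < d"
      and RN: "measure N {x. \<exists>b\<in>Basis. R < \<bar>x \<bullet> b\<bar>} < d"
      using char_tight_box[OF M N conv \<open>0 < d\<close>] by blast
    obtain g where g: "trig_poly g" "\<And>x. \<bar>g x\<bar> \<le> B + d"
      "\<And>x. (\<And>b. b \<in> Basis \<Longrightarrow> \<bar>x \<bullet> b\<bar> \<le> R) \<Longrightarrow> \<bar>f x - g x\<bar> \<le> d"
      using trig_poly_approximation[OF f B \<open>0 < R\<close> \<open>0 < d\<close>] by blast
    have approx: "\<bar>(\<integral>x. f x \<partial>Q) - (\<integral>x. g x \<partial>Q)\<bar> \<le> d * (2 + 2 * B)"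
      if Q: "prob_space Q" "sets Q = sets borel" and out: "measure Q {x. \<exists>b\<in>Basis. R < \<bar>x \<bullet> b\<bar>} < d"
      for Q :: "'v measure"
    proof -
      interpret prob_space Q by fact
      have [measurable_cong]: "sets Q = sets borel" by fact
      have sp: "space Q = UNIV"
        using sets_eq_imp_space_eq[OF Q(2)] by simp
      let ?O = "{x::'v. \<exists>b\<in>Basis. R < \<bar>x \<bullet> b\<bar>}"
      have O: "?O \<in> sets Q"
        using measurable_sets_borel[of _ borel] unfolding Q(2) by measurable
      have int_f: "integrable Q f"
        by (rule integrable_const_bound[where B = B]) (use B in auto)
      have int_g: "integrable Q g"
        using trig_poly_integrable[OF g(1) Q] .
      have int_O: "integrable Q (indicator ?O :: 'v \<Rightarrow> real)"
        by (rule integrable_const_bound[where B = 1]) (use O in auto)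
      have pt: "\<bar>f x - g x\<bar> \<le> d + (2 * B + d) * indicator ?O x" for x
      proof (cases "x \<in> ?O")
        case True
        then show ?thesis
          using B[of x] g(2)[of x] \<open>0 < d\<close> by (simp add: abs_le_iff)
      next
        case False
        then show ?thesis
          using g(3)[of x] by (auto simp: not_less)
      qed
      have "\<bar>(\<integral>x. f x \<partial>Q) - (\<integral>x. g x \<partial>Q)\<bar> = \<bar>\<integral>x. f x - g x \<partial>Q\<bar>"
        by (simp add: int_f int_g)
      also have "\<dots> \<le> (\<integral>x. \<bar>f x - g x\<bar> \<partial>Q)"
        by (rule integral_abs_bound)
      also have "\<dots> \<le> (\<integral>x. d + (2 * B + d) * indicator ?O x \<partial>Q)"
        by (intro integral_mono pt) (use int_f int_g int_O in auto)
      also have "\<dots> = d + (2 * B + d) * measure Q ?O"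
        using int_O O prob_space prob_space[unfolded sp] by (simp add: sp)
      also have "\<dots> \<le> d + (2 * B + 1) * d"
        using out \<open>0 \<le> B\<close> \<open>0 < d\<close> \<open>d \<le> 1\<close> by (intro add_left_mono mult_mono) auto
      finally show ?thesis
        by (simp add: algebra_simps)
    qed
    have "\<forall>\<^sub>F n in sequentially. dist (\<integral>x. g x \<partial>M n) (\<integral>x. g x \<partial>N) < d"
      using trig_poly_integral_tendsto[OF M N conv g(1)] \<open>0 < d\<close> by (rule tendstoD)
    with RM show "\<forall>\<^sub>F n in sequentially. dist (\<integral>x. f x \<partial>M n) (\<integral>x. f x \<partial>N) < e"
    proof eventually_elim
      case (elim n)
      have "\<bar>(\<integral>x. f x \<partial>M n) - (\<integral>x. f x \<partial>N)\<bar> < d * (5 + 4 * B)"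
        using approx[OF M elim(1)] approx[OF N RN] elim(2)
        by (simp add: dist_real_def algebra_simps)
      then show ?case
        using d5 by (simp add: dist_real_def)
    qed
  qed
qed

subsection \<open>Characteristic function of the normal law\<close>

lemma prod_Basis_vec: "(\<Prod>b\<in>(Basis::(real^'n) set). g b) = (\<Prod>i\<in>UNIV. g (axis i 1))"
proof -
  have "(Basis::(real^'n) set) = range (\<lambda>i. axis i 1)"
    by (auto simp: Basis_vec_def)
  then have "(\<Prod>b\<in>(Basis::(real^'n) set). g b) = prod g (range (\<lambda>i. axis i 1))"
    by (rule arg_cong)
  also have "\<dots> = (\<Prod>i\<in>UNIV. g (axis i 1))"
    by (subst prod.reindex) (auto simp: inj_on_def axis_eq_axis)
  finally show ?thesis .
qed

section \<open>Linear changes of variables for Lebesgue measure\<close>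

lemma nn_integral_lborel_stretch:
  fixes f :: "real^'n \<Rightarrow> ennreal"
  assumes f[measurable]: "f \<in> borel_measurable borel" and c: "\<And>i. c i \<noteq> 0"
  shows "(\<integral>\<^sup>+x. f x \<partial>lborel) = ennreal (\<Prod>i\<in>UNIV. \<bar>c i\<bar>) * (\<integral>\<^sup>+x. f (\<chi> i. c i * x $ i) \<partial>lborel)"
proof -
  define c' where "c' = (\<lambda>b::real^'n. (\<chi> i. c i) \<bullet> b)"
  have c'_axis: "c' (axis i 1) = c i" for i
    by (simp add: c'_def inner_axis)
  have T: "(\<Sum>b\<in>Basis. (c' b * (x \<bullet> b)) *\<^sub>R b) = (\<chi> i. c i * x $ i)" for x
  proof (rule euclidean_eqI)
    fix b :: "real^'n" assume b: "b \<in> Basis"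
    then obtain i where i: "b = axis i 1"
      by (auto simp: Basis_vec_def)
    show "(\<Sum>b\<in>Basis. (c' b * (x \<bullet> b)) *\<^sub>R b) \<bullet> b = (\<chi> i. c i * x $ i) \<bullet> b"
      using b unfolding inner_sum_left_Basis[OF b] by (simp add: i c'_axis inner_axis)
  qed
  have [measurable]: "(\<lambda>x::real^'n. \<chi> i. c i * x $ i) \<in> borel_measurable borel"
    unfolding T[symmetric] by measurable
  have "c' b \<noteq> 0" if "b \<in> Basis" for b
    using that c c'_axis by (auto simp: Basis_vec_def)
  from lborel_affine_euclidean[of c' 0, OF this]
  have "lborel = density (distr lborel borel (\<lambda>x::real^'n. \<chi> i. c i * x $ i)) (\<lambda>_. ennreal (\<Prod>i\<in>UNIV. \<bar>c i\<bar>))"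
    by (simp add: T prod_Basis_vec c'_axis)
  then have "(\<integral>\<^sup>+x. f x \<partial>lborel)
      = (\<integral>\<^sup>+x. f x \<partial>density (distr lborel borel (\<lambda>x::real^'n. \<chi> i. c i * x $ i)) (\<lambda>_. ennreal (\<Prod>i\<in>UNIV. \<bar>c i\<bar>)))"
    by (rule arg_cong)
  also have "\<dots> = ennreal (\<Prod>i\<in>UNIV. \<bar>c i\<bar>) * (\<integral>\<^sup>+x. f (\<chi> i. c i * x $ i) \<partial>lborel)"
    by (simp add: nn_integral_density nn_integral_distr nn_integral_cmult)
  finally show ?thesis .
qed

text \<open>A box is pulled back to the box with permuted corners, whose volume is the same product,
  and Lebesgue measure is determined by boxes. Since \<sigma> is its own inverse, the permuted
  corners are explicit; transpositions of two coordinates are the instance of interest.\<close>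

lemma nn_integral_lborel_involution:
  fixes f :: "real^'n \<Rightarrow> ennreal"
  assumes f[measurable]: "f \<in> borel_measurable borel" and \<sigma>: "\<And>i. \<sigma> (\<sigma> i) = i"
  shows "(\<integral>\<^sup>+x. f x \<partial>lborel) = (\<integral>\<^sup>+x. f (\<chi> i. x $ \<sigma> i) \<partial>lborel)"
proof -
  let ?T = "\<lambda>x::real^'n. \<chi> i. x $ \<sigma> i"
  have "continuous_on UNIV ?T"
    by (intro continuous_intros)
  then have T[measurable]: "?T \<in> borel_measurable borel"
    by (rule borel_measurable_continuous_onI)
  have bij: "bij \<sigma>"
    using \<sigma> by (rule involuntory_imp_bij)
  have "lborel = distr lborel borel ?T"
  proof (rule lborel_eqI)
    fix l u :: "real^'n" assume le: "\<And>b. b \<in> Basis \<Longrightarrow> l \<bullet> b \<le> u \<bullet> b"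
    have le': "l $ i \<le> u $ i" for i
      using le[of "axis i 1"] by (simp add: inner_axis axis_in_Basis_iff)
    have "?T -` box l u = box (?T l) (?T u)"
      by (auto simp: mem_box_cart) (metis \<sigma>)+
    then have "emeasure (distr lborel borel ?T) (box l u) = emeasure lborel (box (?T l) (?T u))"
      by (simp add: emeasure_distr)
    also have "\<dots> = (\<Prod>b\<in>Basis. (?T u - ?T l) \<bullet> b)"
      by (rule emeasure_lborel_box) (auto simp: Basis_vec_def inner_axis le')
    also have "(\<Prod>b\<in>Basis. (?T u - ?T l) \<bullet> b) = (\<Prod>i\<in>UNIV. u $ \<sigma> i - l $ \<sigma> i)"
      by (simp add: prod_Basis_vec inner_axis)
    also have "\<dots> = (\<Prod>i\<in>UNIV. u $ i - l $ i)"
      using bij by (rule prod.reindex_bij_betw)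
    also have "\<dots> = (\<Prod>b\<in>Basis. (u - l) \<bullet> b)"
      by (simp add: prod_Basis_vec inner_axis)
    finally show "emeasure (distr lborel borel ?T) (box l u) = (\<Prod>b\<in>Basis. (u - l) \<bullet> b)" .
  qed simp
  then have "(\<integral>\<^sup>+x. f x \<partial>lborel) = (\<integral>\<^sup>+x. f x \<partial>distr lborel borel ?T)"
    by (rule arg_cong)
  then show ?thesis
    by (simp add: nn_integral_distr)
qed

text \<open>By Fubini the coordinate along \<open>b0\<close> is integrated first. As
  \<open>a\<close> is orthogonal to \<open>b0\<close>, the shear moves that coordinate by an amount
  depending on the other coordinates only, and translation invariance on the line removes
  it.\<close>

lemma nn_integral_lborel_shear:
  fixes f :: "'v::euclidean_space \<Rightarrow> ennreal"
  assumes f[measurable]: "f \<in> borel_measurable borel" and b0: "b0 \<in> Basis" and a: "a \<bullet> b0 = 0"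
  shows "(\<integral>\<^sup>+x. f x \<partial>lborel) = (\<integral>\<^sup>+x. f (x + (a \<bullet> x) *\<^sub>R b0) \<partial>lborel)"
proof -
  interpret product_sigma_finite "\<lambda>_::'v. lborel :: real measure"
    by standard
  let ?I = "Basis - {b0}"
  let ?w = "\<lambda>x. \<Sum>b\<in>?I. x b *\<^sub>R b"
  have fin: "finite ?I" "b0 \<notin> ?I"
    by auto
  have Basis: "insert b0 ?I = Basis"
    using b0 by auto
  have split: "(\<integral>\<^sup>+x. g x \<partial>lborel)
      = (\<integral>\<^sup>+x. (\<integral>\<^sup>+y. g (?w x + y *\<^sub>R b0) \<partial>lborel) \<partial>Pi\<^sub>M ?I (\<lambda>_. lborel))"
    if [measurable]: "g \<in> borel_measurable borel" for g :: "'v \<Rightarrow> ennreal"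
  proof -
    have eq: "(\<Sum>b\<in>Basis. (x(b0 := y)) b *\<^sub>R b) = ?w x + y *\<^sub>R b0" for x :: "'v \<Rightarrow> real" and y
      using sum.insert[OF fin, of "\<lambda>b. (x(b0 := y)) b *\<^sub>R b"] unfolding Basis
      by (simp add: add.commute)
    have "(\<integral>\<^sup>+x. g x \<partial>lborel) = (\<integral>\<^sup>+x. g (\<Sum>b\<in>Basis. x b *\<^sub>R b) \<partial>Pi\<^sub>M Basis (\<lambda>_. lborel))"
      by (subst lborel_eq) (simp add: nn_integral_distr)
    also have "\<dots> = (\<integral>\<^sup>+x. (\<integral>\<^sup>+y. g (\<Sum>b\<in>Basis. (x(b0 := y)) b *\<^sub>R b) \<partial>lborel) \<partial>Pi\<^sub>M ?I (\<lambda>_. lborel))"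
      using product_nn_integral_insert[OF fin, of "\<lambda>x. g (\<Sum>b\<in>Basis. x b *\<^sub>R b)"] unfolding Basis
      by simp
    finally show ?thesis
      by (simp only: eq)
  qed
  have "(\<integral>\<^sup>+y. f ((?w x + y *\<^sub>R b0) + (a \<bullet> (?w x + y *\<^sub>R b0)) *\<^sub>R b0) \<partial>lborel)
      = (\<integral>\<^sup>+y. f (?w x + y *\<^sub>R b0) \<partial>lborel)" for x
  proof -
    have "(\<integral>\<^sup>+y. f (?w x + y *\<^sub>R b0) \<partial>lborel)
        = (\<integral>\<^sup>+y. f (?w x + (a \<bullet> ?w x + 1 * y) *\<^sub>R b0) \<partial>lborel)"
      using nn_integral_real_affine[of "\<lambda>y. f (?w x + y *\<^sub>R b0)" 1 "a \<bullet> ?w x"] by simp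
    moreover have "?w x + (a \<bullet> ?w x + 1 * y) *\<^sub>R b0 = (?w x + y *\<^sub>R b0) + (a \<bullet> (?w x + y *\<^sub>R b0)) *\<^sub>R b0" for y
      using a by (simp add: inner_add_right algebra_simps)
    ultimately show ?thesis
      by (simp only:)
  qed
  then show ?thesis
    by (subst (1 2) split) simp_all
qed

text \<open>The formula is multiplicative in \<open>A\<close>, so elementary matrices suffice: a
  zero row contradicts the determinant, a diagonal matrix stretches the axes, and the two remaining
  kinds swap coordinates or shear, with determinant of modulus 1.\<close>

lemma nn_integral_lborel_matrix:
  fixes A :: "real^'n^'n" and f :: "real^'n \<Rightarrow> ennreal"
  assumes "f \<in> borel_measurable borel" and "det A \<noteq> 0"
  shows "(\<integral>\<^sup>+x. f x \<partial>lborel) = ennreal \<bar>det A\<bar> * (\<integral>\<^sup>+x. f (A *v x) \<partial>lborel)"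
proof -
  have meas: "(\<lambda>x. f (A *v x)) \<in> borel_measurable borel" if "f \<in> borel_measurable borel"
    for f :: "real^'n \<Rightarrow> ennreal" and A :: "real^'n^'n"
    using that by (rule measurable_compose[rotated])
      (intro borel_measurable_continuous_onI matrix_vector_mult_linear_continuous_on)
  \<comment> \<open>\<open>f\<close> is quantified inside the induction: for a product of matrices,
    the hypothesis on the second factor is applied to \<open>f\<close> composed with the
    first.\<close>
  have "det A \<noteq> 0 \<longrightarrow> (\<forall>f\<in>borel_measurable borel.
      (\<integral>\<^sup>+x. f x \<partial>lborel) = ennreal \<bar>det A\<bar> * (\<integral>\<^sup>+x. f (A *v x) \<partial>lborel))"
  proof (induction A rule: induct_matrix_elementary)
    case (1 A B)
    show ?case
    proof (intro impI ballI)
      fix f :: "real^'n \<Rightarrow> ennreal"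
      assume det: "det (A ** B) \<noteq> 0" and f: "f \<in> borel_measurable borel"
      have "(\<integral>\<^sup>+x. f x \<partial>lborel) = ennreal \<bar>det A\<bar> * (\<integral>\<^sup>+x. f (A *v x) \<partial>lborel)"
        using 1 det f by (auto simp: det_mul)
      also have "(\<integral>\<^sup>+x. f (A *v x) \<partial>lborel) = ennreal \<bar>det B\<bar> * (\<integral>\<^sup>+x. f (A *v (B *v x)) \<partial>lborel)"
        using 1(2) det meas[OF f, of A] by (auto simp: det_mul)
      finally show "(\<integral>\<^sup>+x. f x \<partial>lborel) = ennreal \<bar>det (A ** B)\<bar> * (\<integral>\<^sup>+x. f (A ** B *v x) \<partial>lborel)"
        by (simp add: det_mul abs_mult ennreal_mult mult.assoc matrix_vector_mul_assoc)
    qed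
  next
    case (2 A i)
    then show ?case
      by (simp add: det_zero_row)
  next
    case (3 A)
    show ?case
    proof (intro impI ballI)
      fix f :: "real^'n \<Rightarrow> ennreal"
      assume det: "det A \<noteq> 0" and f: "f \<in> borel_measurable borel"
      have d: "det A = (\<Prod>i\<in>UNIV. A $ i $ i)"
        using 3 by (rule det_diagonal)
      have "A *v x = (\<chi> i. A $ i $ i * x $ i)" for x
      proof -
        have "(\<Sum>j\<in>UNIV. A $ i $ j * x $ j) = A $ i $ i * x $ i" for i
          by (subst sum.remove[of _ i]) (auto simp: 3)
        then show ?thesis
          by (simp add: matrix_vector_mult_def)
      qed
      then show "(\<integral>\<^sup>+x. f x \<partial>lborel) = ennreal \<bar>det A\<bar> * (\<integral>\<^sup>+x. f (A *v x) \<partial>lborel)"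
        using nn_integral_lborel_stretch[OF f, of "\<lambda>i. A $ i $ i"] det
        by (simp add: d abs_prod)
    qed
  next
    case (4 m n)
    let ?s = "Transposition.transpose m n"
    let ?A = "\<chi> i j. mat 1 $ i $ ?s j :: real^'n^'n"
    have "det ?A = of_int (sign ?s) * det (mat 1 :: real^'n^'n)"
      by (rule det_permute_columns) (simp add: permutes_swap_id)
    then have det: "\<bar>det ?A\<bar> = 1"
      by (simp add: sign_swap_id)
    have "?A *v x = (\<chi> i. x $ ?s i)" for x
    proof -
      have "(\<Sum>j\<in>UNIV. mat 1 $ i $ ?s j * x $ j) = x $ ?s i" for i
      proof -
        have "(\<Sum>j\<in>UNIV. mat 1 $ i $ ?s j * x $ j) = (\<Sum>j\<in>UNIV. if j = ?s i then x $ j else 0)"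
          by (rule sum.cong) (auto simp: mat_def)
        then show ?thesis by simp
      qed
      then show ?thesis
        by (simp add: matrix_vector_mult_def)
    qed
    then show ?case
      using nn_integral_lborel_involution[of _ ?s] by (auto simp: det)
  next
    case (5 m n c)
    let ?A = "(\<chi> i j. if i = m \<and> j = n then c else of_bool (i = j)) :: real^'n^'n"
    have "?A = (\<chi> k. if k = m then row m (mat 1) + c *s row n (mat 1) else row k (mat 1))"
      using 5 by (auto simp: vec_eq_iff row_def mat_def)
    then have det: "det ?A = 1"
      using det_row_operation[OF 5, of "mat 1" c] by simp
    have Av: "?A *v x = x + ((c *\<^sub>R axis n 1) \<bullet> x) *\<^sub>R axis m 1" for x
    proof -
      have "(\<Sum>j\<in>UNIV. (if i = m \<and> j = n then c else of_bool (i = j)) * x $ j)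
          = x $ i + (if i = m then c * x $ n else 0)" for i
      proof -
        have "(\<Sum>j\<in>UNIV. (if i = m \<and> j = n then c else of_bool (i = j)) * x $ j)
          = (\<Sum>j\<in>UNIV. (if j = i then x $ j else 0) + (if j = n then (if i = m then c * x $ j else 0) else 0))"
          by (rule sum.cong) (use 5 in auto)
        then show ?thesis
          by (simp add: sum.distrib)
      qed
      moreover have "(c *\<^sub>R axis n 1) \<bullet> x = c * x $ n"
        by (simp add: inner_axis')
      moreover have "axis m 1 $ i = (if i = m then 1 else 0 :: real)" for i
        by (simp add: axis_def)
      ultimately show ?thesis
        by (auto simp: matrix_vector_mult_def vec_eq_iff)
    qed
    have "(\<integral>\<^sup>+x. f x \<partial>lborel) = (\<integral>\<^sup>+x. f (?A *v x) \<partial>lborel)"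
      if "f \<in> borel_measurable borel" for f :: "real^'n \<Rightarrow> ennreal"
      unfolding Av using that by (rule nn_integral_lborel_shear) (use 5 in \<open>auto simp: inner_axis_axis axis_in_Basis_iff\<close>)
    then show ?case
      by (simp add: det)
  qed
  then show ?thesis
    using assms by blast
qed

text \<open>The columns of \<open>E\<close> are obtained by the Gram--Schmidt process for the inner product of \<open>A\<close>.\<close>

lemma pos_def_congruent_identity:
  fixes A :: "real^'n^'n"
  assumes "pos_def A"
  obtains E :: "real^'n^'n" where "transpose E ** A ** E = mat 1"
proof -
  have sym: "x \<bullet> (A *v y) = y \<bullet> (A *v x)" for x y
    using assms by (metis pos_def_def dot_lmul_matrix inner_commute transpose_matrix_vector)
  have pos: "0 < x \<bullet> (A *v x)" if "x \<noteq> 0" for x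
    using assms that by (simp add: pos_def_def)
  have "k \<le> CARD('n) \<Longrightarrow> \<exists>B. finite B \<and> card B = k \<and> (\<forall>x\<in>B. \<forall>y\<in>B. x \<bullet> (A *v y) = of_bool (x = y))" for k
  proof (induction k)
    case 0
    then show ?case by (intro exI[of _ "{}"]) simp
  next
    case (Suc k)
    then obtain B where B: "finite B" "card B = k" "\<And>x y. x \<in> B \<Longrightarrow> y \<in> B \<Longrightarrow> x \<bullet> (A *v y) = of_bool (x = y)"
      by auto
    have "dim (span B) \<le> k"
      using B dim_le_card' by (metis dim_span)
    then have "dim (span B) < dim (UNIV :: (real^'n) set)"
      using Suc.prems by simp
    then have "span B \<noteq> UNIV"
      by (metis less_irrefl)
    then obtain w where w: "w \<notin> span B"
      by auto
    define v where "v = w - (\<Sum>b\<in>B. (b \<bullet> (A *v w)) *\<^sub>R b)"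
    have "v \<notin> span B"
    proof
      assume "v \<in> span B"
      moreover have "(\<Sum>b\<in>B. (b \<bullet> (A *v w)) *\<^sub>R b) \<in> span B"
        by (intro span_sum span_scale span_base)
      ultimately have "v + (\<Sum>b\<in>B. (b \<bullet> (A *v w)) *\<^sub>R b) \<in> span B"
        by (rule span_add)
      with w show False
        by (simp add: v_def)
    qed
    then have "v \<noteq> 0"
      using span_zero by metis
    have orth: "b \<bullet> (A *v v) = 0" if "b \<in> B" for b
    proof -
      have "b \<bullet> (A *v v) = b \<bullet> (A *v w) - (\<Sum>y\<in>B. (y \<bullet> (A *v w)) * (b \<bullet> (A *v y)))"
        by (simp add: v_def matrix_vector_mult_diff_distrib inner_diff_right inner_sum_right
            linear_sum[OF matrix_vector_mul_linear] matrix_vector_mult_scaleR)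
      also have "(\<Sum>y\<in>B. (y \<bullet> (A *v w)) * (b \<bullet> (A *v y))) = (\<Sum>y\<in>B. if y = b then y \<bullet> (A *v w) else 0)"
        by (rule sum.cong) (use B(3) that in auto)
      also have "\<dots> = b \<bullet> (A *v w)"
        using B(1) that by simp
      finally show ?thesis by simp
    qed
    let ?u = "v /\<^sub>R sqrt (v \<bullet> (A *v v))"
    have u1: "?u \<bullet> (A *v ?u) = 1"
      using pos[OF \<open>v \<noteq> 0\<close>] by (simp add: matrix_vector_mult_scaleR divide_inverse[symmetric])
        (simp add: field_simps)
    have u0: "b \<bullet> (A *v ?u) = 0" "?u \<bullet> (A *v b) = 0" if "b \<in> B" for b
      using orth[OF that] sym[of ?u b] by (simp_all add: matrix_vector_mult_scaleR)
    have "?u \<notin> B"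
      using u0(1)[of ?u] u1 by auto
    have "\<forall>x\<in>insert ?u B. \<forall>y\<in>insert ?u B. x \<bullet> (A *v y) = of_bool (x = y)"
    proof (intro ballI)
      fix x y assume "x \<in> insert ?u B" "y \<in> insert ?u B"
      then consider "x = ?u" "y = ?u" | "x = ?u" "y \<in> B" | "x \<in> B" "y = ?u" | "x \<in> B" "y \<in> B"
        by blast
      then show "x \<bullet> (A *v y) = of_bool (x = y)"
      proof cases
        case 1
        then show ?thesis using u1 by simp
      next
        case 2
        moreover from 2 have "x \<noteq> y"
          using \<open>?u \<notin> B\<close> by blast
        ultimately show ?thesis using u0(2)[of y] by simp
      next
        case 3
        moreover from 3 have "x \<noteq> y"
          using \<open>?u \<notin> B\<close> by blast
        ultimately show ?thesis using u0(1)[of x] by simp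
      next
        case 4
        then show ?thesis using B(3) by simp
      qed
    qed
    then show ?case
      using B \<open>?u \<notin> B\<close> by (intro exI[of _ "insert ?u B"]) auto
  qed
  from this[of "CARD('n)"] obtain B where B: "finite B" "card B = CARD('n)"
    "\<And>x y. x \<in> B \<Longrightarrow> y \<in> B \<Longrightarrow> x \<bullet> (A *v y) = of_bool (x = y)"
    by auto
  obtain f where f: "bij_betw f (UNIV::'n set) B"
    using finite_same_card_bij[of "UNIV::'n set" B] B by auto
  define E :: "real^'n^'n" where "E = (\<chi> i j. f j $ i)"
  have "(transpose E ** A ** E) $ i $ j = f i \<bullet> (A *v f j)" for i j
  proof -
    have "(transpose E ** A ** E) $ i $ j = (transpose E ** (A ** E)) $ i $ j"
      by (simp add: matrix_mul_assoc)
    then show ?thesis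
      by (simp add: matrix_matrix_mult_def E_def transpose_def inner_vec_def matrix_vector_mult_def)
  qed
  moreover have "f i \<bullet> (A *v f j) = of_bool (i = j)" for i j
  proof -
    have "f i \<in> B" "f j \<in> B" "f i = f j \<longleftrightarrow> i = j"
      using f by (auto simp: bij_betw_def inj_on_def)
    then show ?thesis
      using B(3) by simp
  qed
  ultimately have "transpose E ** A ** E = mat 1"
    by (simp add: vec_eq_iff mat_def)
  then show ?thesis
    by (rule that)
qed

section \<open>The standard normal law and its linear images\<close>

definition std_normal_law :: "'v::euclidean_space measure" where
  "std_normal_law = density lborel (\<lambda>x. ennreal (\<Prod>b\<in>Basis. std_normal_density (x \<bullet> b)))"

text \<open>Density and exponential both factor over the coordinates, so Fubini reduces the integral
  to one-dimensional characteristic functions at \<open>u \<bullet> b\<close>.\<close>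

lemma char_std_normal_law:
  fixes u :: "'v::euclidean_space"
  shows "(\<integral>x. iexp (u \<bullet> x) \<partial>std_normal_law) = exp (- (norm u)\<^sup>2 / 2)"
proof -
  interpret product_sigma_finite "\<lambda>_::'v. lborel :: real measure"
    by standard
  let ?g = "\<lambda>b (y::real). std_normal_density y *\<^sub>R iexp ((u \<bullet> b) * y)"
  have int: "integrable lborel (?g b)" for b
    by (rule Bochner_Integration.integrable_bound[of _ std_normal_density]) auto
  have g: "(\<integral>y. ?g b y \<partial>lborel) = exp (- (u \<bullet> b)\<^sup>2 / 2)" for b
  proof -
    have "(\<integral>y. ?g b y \<partial>lborel) = char std_normal_distribution (u \<bullet> b)"
      unfolding char_def by (subst integral_density) auto
    then show ?thesis
      by (simp add: char_std_normal_distribution)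
  qed
  have "(\<integral>x. iexp (u \<bullet> x) \<partial>std_normal_law)
      = (\<integral>x. (\<Prod>b\<in>Basis. std_normal_density (x \<bullet> b)) *\<^sub>R iexp (u \<bullet> x) \<partial>lborel)"
    unfolding std_normal_law_def by (subst integral_density) (auto simp: prod_nonneg)
  also have "\<dots> = (\<integral>x. (\<Prod>b\<in>Basis. ?g b (x \<bullet> b)) \<partial>lborel)"
  proof (rule Bochner_Integration.integral_cong[OF refl])
    fix x :: 'v
    have "iexp (u \<bullet> x) = (\<Prod>b\<in>Basis. iexp ((u \<bullet> b) * (x \<bullet> b)))"
      by (subst euclidean_inner) (simp add: sum_distrib_left exp_sum)
    then show "(\<Prod>b\<in>Basis. std_normal_density (x \<bullet> b)) *\<^sub>R iexp (u \<bullet> x) = (\<Prod>b\<in>Basis. ?g b (x \<bullet> b))"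
      by (simp add: scaleR_conv_of_real prod.distrib)
  qed
  also have "\<dots> = (\<integral>x. (\<Prod>b\<in>Basis. ?g b (x b)) \<partial>Pi\<^sub>M Basis (\<lambda>_. lborel))"
    by (subst lborel_eq, subst integral_distr)
       (auto intro!: Bochner_Integration.integral_cong prod.cong)
  also have "\<dots> = (\<Prod>b\<in>Basis. \<integral>y. ?g b y \<partial>lborel)"
    by (rule product_integral_prod) (rule finite_Basis, rule int)
  also have "\<dots> = (\<Prod>b\<in>Basis. of_real (exp (- (u \<bullet> b)\<^sup>2 / 2)))"
    by (simp only: g)
  also have "\<dots> = exp (\<Sum>b\<in>Basis. - (u \<bullet> b)\<^sup>2 / 2)"
    by (simp add: exp_sum)
  also have "(\<Sum>b\<in>Basis. - (u \<bullet> b)\<^sup>2 / 2) = - (norm u)\<^sup>2 / 2"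
    by (subst power2_norm_eq_inner, subst euclidean_inner)
       (simp add: sum_negf sum_divide_distrib[symmetric] power2_eq_square)
  finally show ?thesis .
qed

lemma prob_space_std_normal_law: "prob_space (std_normal_law :: 'v::euclidean_space measure)"
proof
  have "emeasure (std_normal_law :: 'v measure) (space std_normal_law)
      = (\<integral>\<^sup>+x. (\<Prod>b\<in>Basis. ennreal (std_normal_density ((x::'v) \<bullet> b))) \<partial>lborel)"
    by (simp add: std_normal_law_def emeasure_density prod_ennreal)
  also have "\<dots> = (\<Prod>b\<in>(Basis::'v set). \<integral>\<^sup>+y. ennreal (std_normal_density y) \<partial>lborel)"
    by (rule nn_integral_lborel_prod) auto
  also have "\<dots> = 1"
    by (simp add: nn_integral_eq_integral)
  finally show "emeasure (std_normal_law :: 'v measure) (space std_normal_law) = 1" .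
qed

lemma std_normal_law_cart:
  "(\<Prod>b\<in>Basis. std_normal_density ((z::real^'n) \<bullet> b)) = exp (- (z \<bullet> z) / 2) / sqrt ((2 * pi) ^ CARD('n))"
proof -
  have "(\<Prod>b\<in>Basis. std_normal_density (z \<bullet> b)) = (\<Prod>b\<in>(Basis::(real^'n) set). 1 / sqrt (2 * pi)) * exp (\<Sum>b\<in>Basis. - (z \<bullet> b)\<^sup>2 / 2)"
    by (simp only: std_normal_density_def prod.distrib exp_sum finite_Basis)
  also have "(\<Sum>b\<in>Basis. - (z \<bullet> b)\<^sup>2 / 2) = - (z \<bullet> z) / 2"
    by (subst (2) euclidean_inner)
       (simp add: sum_negf sum_divide_distrib[symmetric] power2_eq_square)
  also have "(\<Prod>b\<in>(Basis::(real^'n) set). 1 / sqrt (2 * pi)) = 1 / sqrt ((2 * pi) ^ CARD('n))"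
    by (simp add: power_one_over real_sqrt_power real_sqrt_mult power_mult_distrib)
  finally show ?thesis
    by simp
qed

lemma matrix_inv_mult:
  fixes A :: "real^'n^'n"
  assumes "invertible A"
  shows "A ** matrix_inv A = mat 1" "matrix_inv A ** A = mat 1"
  using someI_ex[OF assms[unfolded invertible_def]] unfolding matrix_inv_def by blast+

lemma matrix_inv_eqI:
  fixes A :: "real^'n^'n"
  assumes "A ** B = mat 1"
  shows "invertible A" "matrix_inv A = B"
proof -
  have BA: "B ** A = mat 1"
    using assms by (rule matrix_left_right_inverse[THEN iffD1])
  then show inv: "invertible A"
    using assms by (auto simp: invertible_def)
  have "matrix_inv A ** A = mat 1"
    by (rule matrix_inv_mult[OF inv])
  then have "B = matrix_inv A ** (A ** B)"
    by (simp add: matrix_mul_assoc)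
  then show "matrix_inv A = B"
    by (simp add: assms)
qed

text \<open>Under the substitution of \<open>E *v z\<close> for \<open>x\<close> the quadratic form
  of \<open>A\<close> becomes the standard inner product, and the Jacobian cancels the determinant
  in the normalising constant because \<open>det (matrix_inv A)\<close> is the square of
  \<open>det E\<close>.\<close>

lemma normal_law_eq_distr:
  fixes A E :: "real^'n^'n"
  assumes E: "transpose E ** A ** E = mat 1"
  shows "normal_law 0 (matrix_inv A) = distr std_normal_law borel ((*v) E)"
    and "matrix_inv A = E ** transpose E" and "A ** matrix_inv A = mat 1"
proof -
  have "transpose E ** (A ** E) = mat 1"
    using E by (simp add: matrix_mul_assoc)
  then have "(A ** E) ** transpose E = mat 1"
    by (rule matrix_left_right_inverse[THEN iffD1])
  then have AE: "A ** (E ** transpose E) = mat 1"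
    by (simp add: matrix_mul_assoc)
  show S: "matrix_inv A = E ** transpose E"
    using matrix_inv_eqI(2)[OF AE] .
  show "A ** matrix_inv A = mat 1"
    using AE by (simp add: S)
  have SA: "matrix_inv (matrix_inv A) = A"
    using AE by (intro matrix_inv_eqI(2)) (simp add: S matrix_left_right_inverse[of "E ** transpose E"])
  have "det (transpose E ** A ** E) = 1"
    by (simp add: E)
  then have detE: "det E \<noteq> 0"
    by (auto simp: det_mul)
  have detS: "sqrt (c * det (matrix_inv A)) = sqrt c * \<bar>det E\<bar>" for c
    by (simp add: S det_mul real_sqrt_mult)
  have [measurable]: "(*v) E \<in> borel_measurable borel"
    by (intro borel_measurable_continuous_onI matrix_vector_mult_linear_continuous_on)
  have [measurable]: "(*v) A \<in> borel_measurable borel"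
    by (intro borel_measurable_continuous_onI matrix_vector_mult_linear_continuous_on)
  have quad: "(E *v z) \<bullet> (A *v (E *v z)) = z \<bullet> z" for z
  proof -
    have "(E *v z) \<bullet> (A *v (E *v z)) = z \<bullet> (transpose E *v (A *v (E *v z)))"
      by (metis dot_lmul_matrix transpose_matrix_vector transpose_transpose)
    also have "\<dots> = z \<bullet> z"
      using E by (simp add: matrix_vector_mul_assoc matrix_mul_assoc)
    finally show ?thesis .
  qed
  let ?\<phi> = "\<lambda>x::real^'n. ennreal (exp (- (x \<bullet> (A *v x)) / 2) / sqrt ((2 * pi) ^ CARD('n) * det (matrix_inv A)))"
  have \<phi>: "ennreal \<bar>det E\<bar> * ?\<phi> (E *v z) = ennreal (\<Prod>b\<in>Basis. std_normal_density (z \<bullet> b))" for z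
    using detE by (simp add: quad detS std_normal_law_cart ennreal_mult[symmetric])
  have law: "normal_law 0 (matrix_inv A) = density lborel ?\<phi>"
    by (simp add: normal_law_def SA)
  show "normal_law 0 (matrix_inv A) = distr std_normal_law borel ((*v) E)"
  proof (rule measure_eqI)
    fix B assume "B \<in> sets (normal_law 0 (matrix_inv A))"
    then have B[measurable]: "B \<in> sets borel"
      by (simp add: law)
    have "emeasure (normal_law 0 (matrix_inv A)) B = (\<integral>\<^sup>+x. ?\<phi> x * indicator B x \<partial>lborel)"
      unfolding law by (rule emeasure_density) auto
    also have "\<dots> = ennreal \<bar>det E\<bar> * (\<integral>\<^sup>+z. ?\<phi> (E *v z) * indicator B (E *v z) \<partial>lborel)"
      by (rule nn_integral_lborel_matrix[OF _ detE]) measurable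
    also have "\<dots> = (\<integral>\<^sup>+z. ennreal \<bar>det E\<bar> * (?\<phi> (E *v z) * indicator B (E *v z)) \<partial>lborel)"
      by (rule nn_integral_cmult[symmetric]) measurable
    also have "\<dots> = (\<integral>\<^sup>+z. ennreal (\<Prod>b\<in>Basis. std_normal_density (z \<bullet> b)) * indicator ((*v) E -` B) z \<partial>lborel)"
      by (rule nn_integral_cong) (simp add: \<phi>[symmetric] mult.assoc indicator_def)
    also have "\<dots> = emeasure std_normal_law ((*v) E -` B)"
      unfolding std_normal_law_def using measurable_sets_borel[OF \<open>(*v) E \<in> borel_measurable borel\<close> B]
      by (intro emeasure_density[symmetric]) auto
    also have "\<dots> = emeasure (distr std_normal_law borel ((*v) E)) B"
      by (subst emeasure_distr) (auto simp: std_normal_law_def)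
    finally show "emeasure (normal_law 0 (matrix_inv A)) B = emeasure (distr std_normal_law borel ((*v) E)) B" .
  qed (simp add: law)
qed

lemma normal_law_prob_and_char:
  fixes A :: "real^'n^'n"
  assumes "pos_def A"
  shows prob_space_normal_law: "prob_space (normal_law 0 (matrix_inv A))"
    and char_normal_law: "(\<integral>x. iexp (u \<bullet> x) \<partial>normal_law 0 (matrix_inv A)) = exp (- (u \<bullet> (matrix_inv A *v u)) / 2)"
    and pos_def_matrix_inv: "A ** matrix_inv A = mat 1"
proof -
  obtain E :: "real^'n^'n" where E: "transpose E ** A ** E = mat 1"
    using pos_def_congruent_identity[OF assms] .
  note law = normal_law_eq_distr[OF E]
  have m: "(*v) E \<in> borel_measurable borel"
    by (intro borel_measurable_continuous_onI matrix_vector_mult_linear_continuous_on)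
  then have meas: "(*v) E \<in> measurable std_normal_law borel"
    by (simp add: std_normal_law_def)
  show "prob_space (normal_law 0 (matrix_inv A))"
    unfolding law(1) by (rule prob_space.prob_space_distr[OF prob_space_std_normal_law meas])
  have "(\<integral>x. iexp (u \<bullet> x) \<partial>normal_law 0 (matrix_inv A)) = (\<integral>z. iexp (u \<bullet> (E *v z)) \<partial>std_normal_law)"
    unfolding law(1) by (rule integral_distr[OF meas]) measurable
  also have "\<dots> = (\<integral>z. iexp ((transpose E *v u) \<bullet> z) \<partial>std_normal_law)"
    by (simp add: dot_lmul_matrix transpose_matrix_vector)
  also have "\<dots> = exp (- (norm (transpose E *v u))\<^sup>2 / 2)"
    by (rule char_std_normal_law)
  also have "(norm (transpose E *v u))\<^sup>2 = u \<bullet> (matrix_inv A *v u)"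
    by (simp add: power2_norm_eq_inner law(2) matrix_vector_mul_assoc[symmetric] transpose_matrix_vector dot_lmul_matrix)
  finally show "(\<integral>x. iexp (u \<bullet> x) \<partial>normal_law 0 (matrix_inv A)) = exp (- (u \<bullet> (matrix_inv A *v u)) / 2)" .
  show "A ** matrix_inv A = mat 1"
    by (rule law(3))
qed

subsection \<open>The law of the data\<close>

text \<open>The conditional probability of an observed pair given its gate value. At a closed gate
  it does not involve \<open>q\<close>, so closed gates contribute the factor 1 to likelihood
  ratios.\<close>

definition emission :: "real \<Rightarrow> bool \<times> bool \<Rightarrow> real" where
  "emission q x = (if fst x then (if snd x then q else 1 - q) else of_bool (\<not> snd x))"

text \<open>\<open>\<kappa> t past v\<close> is to be read as the conditional probability that gate
  \<open>t\<close> takes the value \<open>v\<close> given the past. It is kept apart from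
  \<open>q\<close> because only the event probabilities vary with the parameter.\<close>

definition path_weight ::
  "(nat \<Rightarrow> (bool \<times> bool) list \<Rightarrow> bool \<Rightarrow> real) \<Rightarrow> (nat \<Rightarrow> real) \<Rightarrow> (bool \<times> bool) list \<Rightarrow> real" where
  "path_weight \<kappa> q xs = (\<Prod>t<length xs. \<kappa> t (take t xs) (fst (xs ! t)) * emission (q t) (xs ! t))"

lemma path_weight_snoc:
  "path_weight \<kappa> q (xs @ [x]) = path_weight \<kappa> q xs * (\<kappa> (length xs) xs (fst x) * emission (q (length xs)) x)"
proof -
  have "(\<Prod>t<length xs. \<kappa> t (take t (xs @ [x])) (fst ((xs @ [x]) ! t)) * emission (q t) ((xs @ [x]) ! t))
      = path_weight \<kappa> q xs"
    unfolding path_weight_def by (rule prod.cong) (auto simp: nth_append)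
  then show ?thesis
    by (simp add: path_weight_def)
qed

lemma finite_length_lists: "finite {xs :: (bool \<times> bool) list. length xs = T}"
  using finite_lists_length_eq[of "UNIV :: (bool \<times> bool) set" T] by simp

lemma sum_length_Suc:
  "(\<Sum>xs | length xs = Suc T. f xs) = (\<Sum>xs | length xs = T. \<Sum>x\<in>UNIV. f (xs @ [x :: bool \<times> bool]))"
proof -
  have eq: "{xs. length xs = Suc T} = (\<lambda>(xs, x). xs @ [x]) ` ({xs. length xs = T} \<times> UNIV)"
    by (auto simp: image_iff length_Suc_conv_rev)
  have "inj_on (\<lambda>(xs, x). xs @ [x]) ({xs. length xs = T} \<times> UNIV)"
    by (auto simp: inj_on_def)
  then show ?thesis
    unfolding eq by (subst sum.reindex) (auto simp: sum.cartesian_product split_def)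
qed

text \<open>The factors \<open>m\<close> are arbitrary apart from having conditional mean 1 given an open gate: squared
  likelihood ratios, exponential moments and characteristic functions are all of this form.\<close>

lemma sum_path_weight:
  fixes m :: "nat \<Rightarrow> bool \<Rightarrow> 'b::real_normed_field"
  assumes \<kappa>: "\<And>t xs. length xs = t \<Longrightarrow> \<kappa> t xs True + \<kappa> t xs False = 1"
    and m: "\<And>t. t < T \<Longrightarrow> of_real (q t) * m t True + of_real (1 - q t) * m t False = 1"
  shows "(\<Sum>xs | length xs = T. of_real (path_weight \<kappa> q xs)
    * (\<Prod>t<T. if fst (xs ! t) then m t (snd (xs ! t)) else 1)) = 1"
  using m
proof (induction T)
  case 0
  have "{xs :: (bool \<times> bool) list. length xs = 0} = {[]}"
    by auto
  then show ?case
    by (simp add: path_weight_def)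
next
  case (Suc T)
  let ?M = "\<lambda>T xs. \<Prod>t<T. if fst (xs ! t) then m t (snd (xs ! t)) else 1"
  have "(\<Sum>x\<in>UNIV. of_real (path_weight \<kappa> q (xs @ [x])) * ?M (Suc T) (xs @ [x]))
      = of_real (path_weight \<kappa> q xs) * ?M T xs" if l: "length xs = T" for xs
  proof -
    have M: "?M T (xs @ [x]) = ?M T xs" for x
      by (rule prod.cong) (auto simp: l nth_append)
    have nth: "(xs @ [x]) ! T = x" for x
      using l by auto
    have U: "(UNIV :: (bool \<times> bool) set) = {(True, True), (True, False), (False, True), (False, False)}"
      by auto
    \<comment> \<open>Of the four continuations, the two with an open gate average \<open>m\<close>
      to 1; with a closed gate the factor is 1, and only the continuation without an event has
      nonzero emission.\<close>
    have "(\<Sum>x\<in>UNIV. of_real (path_weight \<kappa> q (xs @ [x])) * ?M (Suc T) (xs @ [x]))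
      = of_real (path_weight \<kappa> q xs) * ?M T xs
        * (of_real (\<kappa> T xs True) * (of_real (q T) * m T True + of_real (1 - q T) * m T False)
           + of_real (\<kappa> T xs False))"
      unfolding U prod.lessThan_Suc M path_weight_snoc nth by (simp add: emission_def l algebra_simps)
    also have "of_real (\<kappa> T xs True) * (of_real (q T) * m T True + of_real (1 - q T) * m T False)
           + of_real (\<kappa> T xs False) = (of_real (\<kappa> T xs True + \<kappa> T xs False) :: 'b)"
      using Suc.prems[of T] by simp
    also have "\<dots> = 1"
      using \<kappa>[OF l] by simp
    finally show ?thesis by simp
  qed
  then show ?case
    using Suc by (simp add: sum_length_Suc del: prod.lessThan_Suc)
qed

lemma (in ded_process) measurable_observations:
  assumes "\<theta> \<in> \<Theta>"
  shows "observations G Y T \<in> P \<theta> \<rightarrow>\<^sub>M data_space T"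
proof -
  have [measurable]: "G t \<in> P \<theta> \<rightarrow>\<^sub>M count_space UNIV" "Y t \<in> P \<theta> \<rightarrow>\<^sub>M count_space UNIV" for t
    using assms measurable_G measurable_Y by auto
  show ?thesis
    unfolding data_space_def
  proof (subst measurable_count_space_eq2, rule finite_length_lists, intro conjI ballI)
    show "observations G Y T \<in> space (P \<theta>) \<rightarrow> {xs. length xs = T}"
      by (auto simp: observations_def)
    fix xs :: "(bool \<times> bool) list" assume "xs \<in> {xs. length xs = T}"
    then have "observations G Y T \<omega> = xs \<longleftrightarrow> (\<forall>t\<in>{..<T}. G t \<omega> = fst (xs ! t) \<and> Y t \<omega> = snd (xs ! t))" for \<omega>
      by (simp add: observations_def list_eq_iff_nth_eq prod_eq_iff Ball_def)
    then have "observations G Y T -` {xs} \<inter> space (P \<theta>)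
        = {\<omega> \<in> space (P \<theta>). \<forall>t\<in>{..<T}. G t \<omega> = fst (xs ! t) \<and> Y t \<omega> = snd (xs ! t)}"
      by (simp only: vimage_def singleton_iff Int_def mem_Collect_eq conj_commute)
    also have "\<dots> \<in> sets (P \<theta>)"
      by measurable
    finally show "observations G Y T -` {xs} \<inter> space (P \<theta>) \<in> sets (P \<theta>)" .
  qed
qed

lemma observations_Suc_eq:
  "length xs = t \<Longrightarrow> observations G Y (Suc t) \<omega> = xs @ [x]
    \<longleftrightarrow> observations G Y t \<omega> = xs \<and> G t \<omega> = fst x \<and> Y t \<omega> = snd x"
  by (auto simp: observations_def prod_eq_iff)

text \<open>The kernel \<kappa> is the uniform measure of the randomizer values that produce a given
  gate value, hence the same for all \<theta>. Randomizers of different times may be dependent, so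
  no joint law of them is available: each step splits off the randomizer of that time alone, which
  is independent of the past and of all events together. For this the induction has to carry events
  that are still to come.\<close>

theorem (in ded_process) data_law_factorization:
  "\<exists>\<kappa>. (\<forall>t xs g. 0 \<le> \<kappa> t xs g) \<and> (\<forall>t xs. length xs = t \<longrightarrow> \<kappa> t xs True + \<kappa> t xs False = 1) \<and>
    (\<forall>\<theta>\<in>\<Theta>. \<forall>T xs. length xs = T \<longrightarrow>
      measure (data_law P G Y \<theta> T) {xs} = path_weight \<kappa> (\<lambda>t. p t \<theta>) xs)"
proof -
  from observation_causality obtain \<Phi> :: "nat \<Rightarrow> (bool \<times> bool) list \<times> real \<Rightarrow> bool" where
    meas_\<Phi>: "\<And>t. \<Phi> t \<in> data_space t \<Otimes>\<^sub>M restrict_space borel {0..1} \<rightarrow>\<^sub>M count_space UNIV"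
    and ex: "\<forall>\<theta>\<in>\<Theta>. \<exists>Z :: nat \<Rightarrow> 'a \<Rightarrow> bool.
          prob_space.indep_vars (P \<theta>) (\<lambda>_. count_space UNIV) Z UNIV \<and>
          (\<forall>t. distr (P \<theta>) (count_space UNIV) (Z t) = measure_pmf (bernoulli_pmf (p t \<theta>))) \<and>
          (\<forall>t. AE \<omega> in P \<theta>. Y t \<omega> \<longleftrightarrow> G t \<omega> \<and> Z t \<omega>) \<and>
          (\<forall>t. \<exists>U :: 'a \<Rightarrow> real.
            U \<in> borel_measurable (P \<theta>) \<and>
            distr (P \<theta>) borel U = uniform_measure lborel {0..1} \<and>
            prob_space.indep_set (P \<theta>)
              (sets (vimage_algebra (space (P \<theta>)) U borel))
              (sets (vimage_algebra (space (P \<theta>)) (\<lambda>\<omega>. (\<lambda>s. Z s \<omega>, observations G Y t \<omega>))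
                 (PiM UNIV (\<lambda>_. count_space UNIV) \<Otimes>\<^sub>M data_space t))) \<and>
            (AE \<omega> in P \<theta>. G t \<omega> = \<Phi> t (observations G Y t \<omega>, U \<omega>)))"
    by blast
  \<comment> \<open>Cut to the unit interval, on which \<open>\<Phi> t\<close> is measurable; almost
    surely the randomizer takes its values there.\<close>
  define A where "A = (\<lambda>t xs g. {u \<in> {0..1}. \<Phi> t (xs, u) = g})"
  define \<kappa> where "\<kappa> = (\<lambda>t xs g. measure (uniform_measure lborel {0..1}) (A t xs g))"
  have A: "A t xs g \<in> sets borel" if "length xs = t" for t xs g
  proof -
    have "(\<lambda>u. \<Phi> t (xs, u)) \<in> restrict_space borel {0..1} \<rightarrow>\<^sub>M count_space UNIV"
      using that by (intro measurable_compose[OF _ meas_\<Phi>] measurable_Pair measurable_const measurable_ident_sets)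
        (auto simp: data_space_def)
    then have "(\<lambda>u. \<Phi> t (xs, u)) -` {g} \<inter> space (restrict_space borel {0..1}) \<in> sets (restrict_space borel {0..1})"
      by (rule measurable_sets) simp
    also have "(\<lambda>u. \<Phi> t (xs, u)) -` {g} \<inter> space (restrict_space borel {0..1}) = A t xs g"
      by (auto simp: A_def space_restrict_space)
    finally show ?thesis
      by (subst (asm) sets_restrict_space_iff) auto
  qed
  have uniform: "prob_space (uniform_measure lborel {0..1::real})"
    by (rule prob_space_uniform_measure) auto
  have \<kappa>_sum: "\<kappa> t xs True + \<kappa> t xs False = 1" if "length xs = t" for t xs
  proof -
    interpret U: prob_space "uniform_measure lborel {0..1::real}"
      by (rule uniform)
    have "\<kappa> t xs True + \<kappa> t xs False = measure (uniform_measure lborel {0..1}) (A t xs True \<union> A t xs False)"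
      unfolding \<kappa>_def using A[OF that, of True] A[OF that, of False]
      by (intro U.finite_measure_Union[symmetric]) (simp_all, auto simp: A_def)
    also have "A t xs True \<union> A t xs False = {0..1}"
      by (auto simp: A_def)
    also have "measure (uniform_measure lborel {0..1}) {0..1::real} = 1"
      by (subst measure_uniform_measure) auto
    finally show ?thesis .
  qed
  have main: "measure (data_law P G Y \<theta> T) {xs} = path_weight \<kappa> (\<lambda>t. p t \<theta>) xs"
    if \<theta>: "\<theta> \<in> \<Theta>" and "length xs = T" for \<theta> T xs
  proof -
    interpret prob_space "P \<theta>"
      using \<theta> by (rule prob_space_P)
    from ex \<theta> obtain Z :: "nat \<Rightarrow> 'a \<Rightarrow> bool" where
      indep: "indep_vars (\<lambda>_. count_space UNIV) Z UNIV"
      and Z: "\<And>t. distr (P \<theta>) (count_space UNIV) (Z t) = measure_pmf (bernoulli_pmf (p t \<theta>))"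
      and Y: "\<And>t. AE \<omega> in P \<theta>. Y t \<omega> \<longleftrightarrow> G t \<omega> \<and> Z t \<omega>"
      and exU: "\<And>t. \<exists>U :: 'a \<Rightarrow> real.
            U \<in> borel_measurable (P \<theta>) \<and>
            distr (P \<theta>) borel U = uniform_measure lborel {0..1} \<and>
            indep_set
              (sets (vimage_algebra (space (P \<theta>)) U borel))
              (sets (vimage_algebra (space (P \<theta>)) (\<lambda>\<omega>. (\<lambda>s. Z s \<omega>, observations G Y t \<omega>))
                 (PiM UNIV (\<lambda>_. count_space UNIV) \<Otimes>\<^sub>M data_space t))) \<and>
            (AE \<omega> in P \<theta>. G t \<omega> = \<Phi> t (observations G Y t \<omega>, U \<omega>))"
      by blast
    have [measurable]: "Z t \<in> P \<theta> \<rightarrow>\<^sub>M count_space UNIV" for t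
      using indep by (simp add: indep_vars_def)
    have [measurable]: "G t \<in> P \<theta> \<rightarrow>\<^sub>M count_space UNIV" "Y t \<in> P \<theta> \<rightarrow>\<^sub>M count_space UNIV" for t
      using \<theta> measurable_G measurable_Y by auto
    have obs_sets: "{\<omega> \<in> space (P \<theta>). observations G Y t \<omega> = xs} \<in> sets (P \<theta>)" for t xs
    proof (cases "length xs = t")
      case True
      then have "observations G Y t -` {xs} \<inter> space (P \<theta>) \<in> sets (P \<theta>)"
        by (intro measurable_sets[OF measurable_observations[OF \<theta>]]) (simp add: data_space_def)
      moreover have "{\<omega> \<in> space (P \<theta>). observations G Y t \<omega> = xs} = observations G Y t -` {xs} \<inter> space (P \<theta>)"
        by auto
      ultimately show ?thesis
        by simp
    next
      case False
      then have "{\<omega> \<in> space (P \<theta>). observations G Y t \<omega> = xs} = {}"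
        by (auto simp: observations_def)
      then show ?thesis by (simp only: sets.empty_sets)
    qed
    have Z_sets: "{\<omega> \<in> space (P \<theta>). \<forall>j\<in>J. Z j \<omega> = z j} \<in> sets (P \<theta>)" if "finite J" for J z
    proof (rule sets.sets_Collect_finite_All[OF _ that])
      fix j
      have "Z j -` {z j} \<inter> space (P \<theta>) \<in> sets (P \<theta>)"
        by (rule measurable_sets[where A = "count_space UNIV"]) auto
      moreover have "{\<omega> \<in> space (P \<theta>). Z j \<omega> = z j} = Z j -` {z j} \<inter> space (P \<theta>)"
        by auto
      ultimately show "{\<omega> \<in> space (P \<theta>). Z j \<omega> = z j} \<in> sets (P \<theta>)"
        by simp
    qed
    define b where "b = (\<lambda>t v. if v then p t \<theta> else 1 - p t \<theta>)"
    define E where "E = (\<lambda>t xs J z. {\<omega> \<in> space (P \<theta>). observations G Y t \<omega> = xs \<and> (\<forall>j\<in>J. Z j \<omega> = z j)})"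
    have E_sets: "E t xs J z \<in> sets (P \<theta>)" if "finite J" for t xs J z
    proof -
      have "E t xs J z = {\<omega> \<in> space (P \<theta>). observations G Y t \<omega> = xs} \<inter> {\<omega> \<in> space (P \<theta>). \<forall>j\<in>J. Z j \<omega> = z j}"
        by (auto simp: E_def)
      then show ?thesis
        using obs_sets Z_sets[OF that] by auto
    qed
    have prob_Z: "prob {\<omega> \<in> space (P \<theta>). Z t \<omega> = v} = b t v" for t v
    proof -
      have "prob {\<omega> \<in> space (P \<theta>). Z t \<omega> = v} = measure (distr (P \<theta>) (count_space UNIV) (Z t)) {v}"
        by (subst measure_distr) (auto intro!: arg_cong[where f = prob])
      also have "\<dots> = b t v"
        using event_prob_range[OF \<theta>, of t] by (simp add: Z measure_pmf_single b_def)
      finally show ?thesis .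
    qed
    have prob_ZJ: "prob {\<omega> \<in> space (P \<theta>). \<forall>j\<in>J. Z j \<omega> = z j} = (\<Prod>j\<in>J. b j (z j))" if "finite J" for J z
    proof (cases "J = {}")
      case True
      then show ?thesis by (simp add: prob_space)
    next
      case False
      have "prob (\<Inter>j\<in>J. Z j -` {z j} \<inter> space (P \<theta>)) = (\<Prod>j\<in>J. prob (Z j -` {z j} \<inter> space (P \<theta>)))"
        using False that by (intro indep_varsD[OF indep]) auto
      moreover have "(\<Inter>j\<in>J. Z j -` {z j} \<inter> space (P \<theta>)) = {\<omega> \<in> space (P \<theta>). \<forall>j\<in>J. Z j \<omega> = z j}"
        using False by auto
      moreover have "Z j -` {z j} \<inter> space (P \<theta>) = {\<omega> \<in> space (P \<theta>). Z j \<omega> = z j}" for j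
        by auto
      ultimately show ?thesis
        by (simp add: prob_Z)
    qed
    \<comment> \<open>One time step. The gate value contributes the factor \<kappa>. At an open gate
      the observed event is \<open>Z t\<close>, which becomes one more constraint on the events; at
      a closed gate an observed event is impossible, hence the empty set.\<close>
    have U_indep: "prob (E (Suc t) (xs @ [(g, y)]) J z)
        = \<kappa> t xs g * prob (if g then E t xs (insert t J) (z(t := y)) else if y then {} else E t xs J z)"
      if len: "length xs = t" and J: "finite J" "J \<subseteq> {Suc t..}" for t xs g y J z
    proof -
      obtain U where U: "U \<in> borel_measurable (P \<theta>)" "distr (P \<theta>) borel U = uniform_measure lborel {0..1}"
        and ind: "indep_set
              (sets (vimage_algebra (space (P \<theta>)) U borel))
              (sets (vimage_algebra (space (P \<theta>)) (\<lambda>\<omega>. (\<lambda>s. Z s \<omega>, observations G Y t \<omega>))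
                 (PiM UNIV (\<lambda>_. count_space UNIV) \<Otimes>\<^sub>M data_space t)))"
        and G: "AE \<omega> in P \<theta>. G t \<omega> = \<Phi> t (observations G Y t \<omega>, U \<omega>)"
        using exU by blast
      have U01: "AE \<omega> in P \<theta>. U \<omega> \<in> {0..1}"
      proof -
        have "AE u in uniform_measure lborel {0..1}. u \<in> {0..1::real}"
          by (rule AE_uniform_measureI) auto
        then show ?thesis
          unfolding U(2)[symmetric] by (subst (asm) AE_distr_iff) (use U in auto)
      qed
      have prod: "prob ({\<omega> \<in> space (P \<theta>). U \<omega> \<in> A t xs g} \<inter> E t xs J' z')
          = \<kappa> t xs g * prob (E t xs J' z')" if J': "finite J'" for J' z'
      proof -
        have "{\<omega> \<in> space (P \<theta>). U \<omega> \<in> A t xs g} \<in> sets (vimage_algebra (space (P \<theta>)) U borel)"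
        proof -
          have "U -` A t xs g \<inter> space (P \<theta>) \<in> sets (vimage_algebra (space (P \<theta>)) U borel)"
            using A[OF len] by (rule in_vimage_algebra)
          moreover have "{\<omega> \<in> space (P \<theta>). U \<omega> \<in> A t xs g} = U -` A t xs g \<inter> space (P \<theta>)"
            by auto
          ultimately show ?thesis
            by simp
        qed
        moreover have "E t xs J' z' \<in> sets (vimage_algebra (space (P \<theta>)) (\<lambda>\<omega>. (\<lambda>s. Z s \<omega>, observations G Y t \<omega>))
                 (PiM UNIV (\<lambda>_. count_space UNIV) \<Otimes>\<^sub>M data_space t))"
        proof -
          have "{f :: nat \<Rightarrow> bool. \<forall>j\<in>J'. f j = z' j} \<in> sets (PiM UNIV (\<lambda>_. count_space UNIV))"
          proof -
            have "{f \<in> space (PiM UNIV (\<lambda>_. count_space UNIV)). \<forall>j\<in>J'. (f :: nat \<Rightarrow> bool) j = z' j}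
                \<in> sets (PiM UNIV (\<lambda>_. count_space UNIV))"
            proof (rule sets.sets_Collect_finite_All[OF _ J'])
              fix j
              let ?S = "PiM UNIV (\<lambda>_. count_space UNIV) :: (nat \<Rightarrow> bool) measure"
              have "(\<lambda>f. f j) -` {z' j} \<inter> space ?S \<in> sets ?S"
                by (rule measurable_sets[OF measurable_component_singleton]) auto
              moreover have "{f \<in> space ?S. f j = z' j} = (\<lambda>f. f j) -` {z' j} \<inter> space ?S"
                by auto
              ultimately show "{f \<in> space ?S. f j = z' j} \<in> sets ?S"
                by simp
            qed
            then show ?thesis
              by (simp add: space_PiM)
          qed
          moreover have "{xs} \<in> sets (data_space t)"
            using len by (simp add: data_space_def)
          ultimately have "{f :: nat \<Rightarrow> bool. \<forall>j\<in>J'. f j = z' j} \<times> {xs}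
              \<in> sets (PiM UNIV (\<lambda>_. count_space UNIV) \<Otimes>\<^sub>M data_space t)"
            by (rule pair_measureI)
          moreover have "E t xs J' z' = (\<lambda>\<omega>. (\<lambda>s. Z s \<omega>, observations G Y t \<omega>)) -`
              ({f. \<forall>j\<in>J'. f j = z' j} \<times> {xs}) \<inter> space (P \<theta>)"
            by (auto simp: E_def)
          ultimately show ?thesis
            by (simp only: in_vimage_algebra)
        qed
        ultimately have "prob ({\<omega> \<in> space (P \<theta>). U \<omega> \<in> A t xs g} \<inter> E t xs J' z')
            = prob {\<omega> \<in> space (P \<theta>). U \<omega> \<in> A t xs g} * prob (E t xs J' z')"
          using ind by (intro indep_setD)
        also have "prob {\<omega> \<in> space (P \<theta>). U \<omega> \<in> A t xs g} = measure (distr (P \<theta>) borel U) (A t xs g)"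
          by (subst measure_distr) (use U A[OF len] in \<open>auto intro!: arg_cong[where f = prob]\<close>)
        finally show ?thesis
          by (simp add: U \<kappa>_def)
      qed
      have U_sets: "{\<omega> \<in> space (P \<theta>). U \<omega> \<in> A t xs g} \<in> sets (P \<theta>)"
        using measurable_sets[OF U(1) A[OF len, of g]] by (simp add: vimage_def Int_def conj_commute)
      let ?F = "if g then E t xs (insert t J) (z(t := y)) else if y then {} else E t xs J z"
      have tJ: "t \<notin> J"
        using J by auto
      have "AE \<omega> in P \<theta>. \<omega> \<in> E (Suc t) (xs @ [(g, y)]) J z
          \<longleftrightarrow> \<omega> \<in> {\<omega> \<in> space (P \<theta>). U \<omega> \<in> A t xs g} \<inter> ?F"
        using G U01 Y[of t] AE_space
      proof eventually_elim
        case (elim \<omega>)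
        have zJ: "(\<forall>j\<in>J. Z j \<omega> = (z(t := y)) j) \<longleftrightarrow> (\<forall>j\<in>J. Z j \<omega> = z j)"
          using tJ by auto
        show ?case
        proof (cases "observations G Y t \<omega> = xs")
          case True
          then have UA: "U \<omega> \<in> A t xs g \<longleftrightarrow> G t \<omega> = g"
            using elim(1,2) by (simp add: A_def)
          have "\<omega> \<in> E (Suc t) (xs @ [(g, y)]) J z \<longleftrightarrow> G t \<omega> = g \<and> Y t \<omega> = y \<and> (\<forall>j\<in>J. Z j \<omega> = z j)"
            using elim(4) True by (simp add: E_def observations_Suc_eq[OF len])
          moreover have "\<omega> \<in> E t xs J z \<longleftrightarrow> (\<forall>j\<in>J. Z j \<omega> = z j)"
            using elim(4) True by (simp add: E_def)
          moreover have "\<omega> \<in> E t xs (insert t J) (z(t := y)) \<longleftrightarrow> Z t \<omega> = y \<and> (\<forall>j\<in>J. Z j \<omega> = z j)"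
            using elim(4) True zJ by (simp add: E_def del: fun_upd_apply add: fun_upd_same)
          moreover have "\<omega> \<in> {\<omega> \<in> space (P \<theta>). U \<omega> \<in> A t xs g} \<longleftrightarrow> G t \<omega> = g"
            using elim(4) UA by simp
          ultimately show ?thesis
            using elim(3) unfolding Int_iff by (cases g; cases y) (simp_all only: if_True if_False empty_iff, blast+)
        next
          case False
          then show ?thesis
            by (auto simp: E_def observations_Suc_eq[OF len])
        qed
      qed
      then have "prob (E (Suc t) (xs @ [(g, y)]) J z) = prob ({\<omega> \<in> space (P \<theta>). U \<omega> \<in> A t xs g} \<inter> ?F)"
        using E_sets J U_sets by (intro finite_measure_eq_AE) auto
      also have "\<dots> = \<kappa> t xs g * prob ?F"
        using prod J by auto
      finally show ?thesis
        by simp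
    qed
    \<comment> \<open>The invariant: the past is jointly described with finitely many events from
      time \<open>t\<close> on. Earlier events are excluded because the past already carries
      information on them. At an open gate the step applies the hypothesis with \<open>t\<close>
      added to \<open>J\<close>.\<close>
    have fact: "prob (E t xs J z) = path_weight \<kappa> (\<lambda>t. p t \<theta>) xs * (\<Prod>j\<in>J. b j (z j))"
      if "length xs = t" "finite J" "J \<subseteq> {t..}" for t xs J z
      using that
    proof (induction t arbitrary: xs J z)
      case 0
      then show ?case
        using prob_ZJ[of J z] by (simp add: E_def observations_def path_weight_def)
    next
      case (Suc t)
      then obtain xs' g y where xs: "xs = xs' @ [(g, y)]" "length xs' = t"
        by (metis length_Suc_conv_rev surj_pair)
      have J: "finite J" "J \<subseteq> {Suc t..}"
        using Suc.prems by auto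
      then have tJ: "t \<notin> J" "J \<subseteq> {t..}"
        by auto
      have "prob (E t xs' (insert t J) (z(t := y))) = path_weight \<kappa> (\<lambda>t. p t \<theta>) xs' * (b t y * (\<Prod>j\<in>J. b j (z j)))"
      proof -
        have "(\<Prod>j\<in>J. b j ((z(t := y)) j)) = (\<Prod>j\<in>J. b j (z j))"
          by (rule prod.cong) (use tJ in auto)
        then show ?thesis
          using Suc.IH[of xs' "insert t J" "z(t := y)"] xs J tJ by (simp add: fun_upd_def)
      qed
      moreover have "prob (E t xs' J z) = path_weight \<kappa> (\<lambda>t. p t \<theta>) xs' * (\<Prod>j\<in>J. b j (z j))"
        using Suc.IH xs J tJ by simp
      ultimately show ?case
        using U_indep[OF xs(2) J, of g y z]
        by (auto simp: xs path_weight_snoc emission_def b_def)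
    qed
    have "measure (data_law P G Y \<theta> T) {xs} = prob (E T xs {} (\<lambda>_. True))"
      unfolding data_law_def using \<open>length xs = T\<close>
      by (subst measure_distr[OF measurable_observations[OF \<theta>]])
         (auto simp: data_space_def E_def intro!: arg_cong[where f = prob])
    then show ?thesis
      using fact[of xs T "{}"] \<open>length xs = T\<close> by simp
  qed
  show ?thesis
    by (rule exI[of _ \<kappa>]) (use \<kappa>_sum main in \<open>auto simp: \<kappa>_def\<close>)
qed

subsection \<open>Convergence in probability\<close>

definition vanishing_in_prob :: "(nat \<Rightarrow> 'b measure) \<Rightarrow> (nat \<Rightarrow> 'b \<Rightarrow> real) \<Rightarrow> bool" where
  "vanishing_in_prob M X \<longleftrightarrow>
     (\<forall>\<epsilon>>0. (\<lambda>T. measure (M T) {x \<in> space (M T). \<bar>X T x\<bar> > \<epsilon>}) \<longlonglongrightarrow> 0)"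

text \<open>Required for large \<open>T\<close> only, since a local parameter may lie outside the
  parameter set for small \<open>T\<close>. As all subsets are measurable, arbitrary functions of
  the data, estimators included, are random variables.\<close>

definition discrete_laws :: "(nat \<Rightarrow> 'b measure) \<Rightarrow> bool" where
  "discrete_laws M \<longleftrightarrow>
     (\<forall>\<^sub>F T in sequentially. prob_space (M T) \<and> finite (space (M T)) \<and> sets (M T) = Pow (space (M T)))"

lemma measure_eventually_le_union:
  assumes "discrete_laws M"
    and "\<forall>\<^sub>F T in sequentially. A T \<subseteq> B T \<union> C T \<and> B T \<subseteq> space (M T) \<and> C T \<subseteq> space (M T)"
  shows "\<forall>\<^sub>F T in sequentially. measure (M T) (A T) \<le> measure (M T) (B T) + measure (M T) (C T)"
  using assms unfolding discrete_laws_def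
proof eventually_elim
  case (elim T)
  then interpret prob_space "M T" by simp
  have "measure (M T) (A T) \<le> measure (M T) (B T \<union> C T)"
    using elim by (intro finite_measure_mono) auto
  also have "\<dots> \<le> measure (M T) (B T) + measure (M T) (C T)"
    using elim by (intro measure_Un_le) auto
  finally show ?case .
qed

text \<open>The sum of the norms, rather than the norm of a sum, is what the reduction to data
  sequences consumes: a single bound then controls both quantities.\<close>

lemma bounded_in_prob_add:
  fixes X :: "nat \<Rightarrow> 'b \<Rightarrow> 'v::real_normed_vector" and Y :: "nat \<Rightarrow> 'b \<Rightarrow> 'w::real_normed_vector"
  assumes M: "discrete_laws M" and X: "bounded_in_prob M X" and Y: "bounded_in_prob M Y"
  shows "bounded_in_prob M (\<lambda>T x. norm (X T x) + norm (Y T x))"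
  unfolding bounded_in_prob_def
proof (intro allI impI)
  fix e :: real assume "0 < e"
  then have "0 < e / 2" by simp
  obtain C where C: "\<forall>\<^sub>F T in sequentially. measure (M T) {x \<in> space (M T). norm (X T x) > C} \<le> e / 2"
    using X \<open>0 < e / 2\<close> unfolding bounded_in_prob_def by blast
  obtain C' where C': "\<forall>\<^sub>F T in sequentially. measure (M T) {x \<in> space (M T). norm (Y T x) > C'} \<le> e / 2"
    using Y \<open>0 < e / 2\<close> unfolding bounded_in_prob_def by blast
  have "\<forall>\<^sub>F T in sequentially. measure (M T) {x \<in> space (M T). norm (norm (X T x) + norm (Y T x)) > C + C'}
      \<le> measure (M T) {x \<in> space (M T). norm (X T x) > C} + measure (M T) {x \<in> space (M T). norm (Y T x) > C'}"
    by (intro measure_eventually_le_union M always_eventually) auto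
  with C C' have "\<forall>\<^sub>F T in sequentially.
      measure (M T) {x \<in> space (M T). norm (norm (X T x) + norm (Y T x)) > C + C'} \<le> e"
    by eventually_elim auto
  then show "\<exists>C. \<forall>\<^sub>F T in sequentially.
      measure (M T) {x \<in> space (M T). norm (norm (X T x) + norm (Y T x)) > C} \<le> e" ..
qed

lemma bounded_in_prob_zero:
  "bounded_in_prob M (\<lambda>T x. 0 :: real)"
  unfolding bounded_in_prob_def by (auto intro!: exI[of _ 0] always_eventually)

lemma bounded_in_prob_sum:
  fixes X :: "'i \<Rightarrow> nat \<Rightarrow> 'b \<Rightarrow> real"
  assumes M: "discrete_laws M" and "finite I" and "\<And>i. i \<in> I \<Longrightarrow> bounded_in_prob M (X i)"
  shows "bounded_in_prob M (\<lambda>T x. \<Sum>i\<in>I. \<bar>X i T x\<bar>)"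
  using assms(2,3)
proof (induction I rule: finite_induct)
  case (insert i I)
  then have "bounded_in_prob M (\<lambda>T x. norm (X i T x) + norm (\<Sum>i\<in>I. \<bar>X i T x\<bar>))"
    by (intro bounded_in_prob_add M) auto
  then show ?case
    using insert by (simp add: sum_nonneg)
qed (simp add: bounded_in_prob_zero)

lemma vanishing_in_prob_sum:
  fixes X :: "'i \<Rightarrow> nat \<Rightarrow> 'b \<Rightarrow> real"
  assumes M: "discrete_laws M" and "finite I" and "\<And>i. i \<in> I \<Longrightarrow> vanishing_in_prob M (X i)"
  shows "vanishing_in_prob M (\<lambda>T x. \<Sum>i\<in>I. \<bar>X i T x\<bar>)"
  using assms(2,3)
proof (induction I rule: finite_induct)
  case empty
  then show ?case by (simp add: vanishing_in_prob_def)
next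
  case (insert i I)
  show ?case
    unfolding vanishing_in_prob_def
  proof (intro allI impI)
    fix e :: real assume "0 < e"
    then have e2: "0 < e / 2" by simp
    let ?A = "\<lambda>T. {x \<in> space (M T). \<bar>X i T x\<bar> > e / 2}"
    let ?B = "\<lambda>T. {x \<in> space (M T). \<bar>\<Sum>i\<in>I. \<bar>X i T x\<bar>\<bar> > e / 2}"
    have "(\<lambda>T. measure (M T) (?A T)) \<longlonglongrightarrow> 0"
      using insert.prems[of i] e2 unfolding vanishing_in_prob_def by blast
    moreover have "(\<lambda>T. measure (M T) (?B T)) \<longlonglongrightarrow> 0"
      using insert.IH insert.prems e2 unfolding vanishing_in_prob_def by blast
    ultimately have lim: "(\<lambda>T. measure (M T) (?A T) + measure (M T) (?B T)) \<longlonglongrightarrow> 0"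
      using tendsto_add by fastforce
    have "\<forall>\<^sub>F T in sequentially. measure (M T) {x \<in> space (M T). \<bar>\<Sum>i\<in>insert i I. \<bar>X i T x\<bar>\<bar> > e}
        \<le> measure (M T) (?A T) + measure (M T) (?B T)"
      using insert.hyps by (intro measure_eventually_le_union M always_eventually allI) auto
    then show "(\<lambda>T. measure (M T) {x \<in> space (M T). \<bar>\<Sum>i\<in>insert i I. \<bar>X i T x\<bar>\<bar> > e}) \<longlonglongrightarrow> 0"
      by (intro tendsto_sandwich[OF always_eventually _ tendsto_const lim]) simp_all
  qed
qed

text \<open>Reduces a stochastic expansion to a deterministic limit along arbitrary sequences of data.\<close>

lemma vanishing_in_probI_sequences:
  fixes R Q D :: "nat \<Rightarrow> 'b \<Rightarrow> real"
  assumes M: "discrete_laws M" and R: "bounded_in_prob M R" and Q: "vanishing_in_prob M Q"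
    and seq: "\<And>\<tau> X c. filterlim \<tau> sequentially sequentially \<Longrightarrow> (\<And>k. X k \<in> space (M (\<tau> k))) \<Longrightarrow>
      (\<And>k. \<bar>R (\<tau> k) (X k)\<bar> \<le> c) \<Longrightarrow> (\<lambda>k. Q (\<tau> k) (X k)) \<longlonglongrightarrow> 0 \<Longrightarrow> (\<lambda>k. D (\<tau> k) (X k)) \<longlonglongrightarrow> 0"
  shows "vanishing_in_prob M D"
  unfolding vanishing_in_prob_def
proof (intro allI impI)
  fix e :: real assume "0 < e"
  \<comment> \<open>A uniform form of the hypothesis \<open>seq\<close>. If it failed for some
    \<open>c\<close>, counterexamples with \<open>d = 1 / (k + 1)\<close> and \<open>T\<close> at
    least \<open>k\<close> would form a sequence on which \<open>Q\<close> tends to 0 while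
    \<open>D\<close> stays above \<open>e\<close>.\<close>
  have det: "\<exists>d>0. \<forall>\<^sub>F T in sequentially. \<forall>x\<in>space (M T). \<bar>R T x\<bar> \<le> c \<longrightarrow> \<bar>Q T x\<bar> \<le> d \<longrightarrow> \<bar>D T x\<bar> \<le> e" for c
  proof (rule ccontr)
    assume "\<not> ?thesis"
    then have neg: "\<exists>T\<ge>N. \<exists>x\<in>space (M T). \<bar>R T x\<bar> \<le> c \<and> \<bar>Q T x\<bar> \<le> d \<and> e < \<bar>D T x\<bar>" if "0 < d" for d N
      using that unfolding eventually_sequentially by (meson not_le)
    have "\<forall>k. \<exists>T x. k \<le> T \<and> x \<in> space (M T) \<and> \<bar>R T x\<bar> \<le> c \<and> \<bar>Q T x\<bar> \<le> 1 / real (Suc k) \<and> e < \<bar>D T x\<bar>"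
    proof
      fix k
      show "\<exists>T x. k \<le> T \<and> x \<in> space (M T) \<and> \<bar>R T x\<bar> \<le> c \<and> \<bar>Q T x\<bar> \<le> 1 / real (Suc k) \<and> e < \<bar>D T x\<bar>"
        using neg[of "1 / real (Suc k)" k] by auto
    qed
    then obtain \<tau> X where \<tau>: "\<And>k. k \<le> \<tau> k" "\<And>k. X k \<in> space (M (\<tau> k))" "\<And>k. \<bar>R (\<tau> k) (X k)\<bar> \<le> c"
      "\<And>k. \<bar>Q (\<tau> k) (X k)\<bar> \<le> 1 / real (Suc k)" "\<And>k. e < \<bar>D (\<tau> k) (X k)\<bar>"
      by metis
    have "filterlim \<tau> sequentially sequentially"
      by (rule filterlim_at_top_mono[OF filterlim_ident]) (simp add: \<tau>(1))
    moreover have "(\<lambda>k. Q (\<tau> k) (X k)) \<longlonglongrightarrow> 0"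
      by (rule Lim_null_comparison[OF _ LIMSEQ_inverse_real_of_nat])
         (use \<tau>(4) in \<open>auto simp: inverse_eq_divide intro!: always_eventually\<close>)
    ultimately have "(\<lambda>k. D (\<tau> k) (X k)) \<longlonglongrightarrow> 0"
      using seq[of \<tau> X c] \<tau>(2,3) by blast
    then have "\<forall>\<^sub>F k in sequentially. \<bar>D (\<tau> k) (X k)\<bar> < e"
      using \<open>0 < e\<close> tendstoD by fastforce
    then have "\<exists>k. \<bar>D (\<tau> k) (X k)\<bar> < e"
      by (rule eventually_happens'[rotated]) simp
    then show False
      using \<tau>(5) by (meson less_asym)
  qed
  show "(\<lambda>T. measure (M T) {x \<in> space (M T). \<bar>D T x\<bar> > e}) \<longlonglongrightarrow> 0"
  proof (rule tendstoI)
    fix a :: real assume "0 < a"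
    then have "0 < a / 2" by simp
    then obtain c where c: "\<forall>\<^sub>F T in sequentially. measure (M T) {x \<in> space (M T). norm (R T x) > c} \<le> a / 2"
      using R unfolding bounded_in_prob_def by blast
    obtain d where "0 < d" and d: "\<forall>\<^sub>F T in sequentially. \<forall>x\<in>space (M T). \<bar>R T x\<bar> \<le> c \<longrightarrow> \<bar>Q T x\<bar> \<le> d \<longrightarrow> \<bar>D T x\<bar> \<le> e"
      using det[of c] by blast
    have "\<forall>\<^sub>F T in sequentially. {x \<in> space (M T). \<bar>D T x\<bar> > e}
        \<subseteq> {x \<in> space (M T). norm (R T x) > c} \<union> {x \<in> space (M T). \<bar>Q T x\<bar> > d}
        \<and> {x \<in> space (M T). norm (R T x) > c} \<subseteq> space (M T) \<and> {x \<in> space (M T). \<bar>Q T x\<bar> > d} \<subseteq> space (M T)"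
      using d by eventually_elim force
    then have le: "\<forall>\<^sub>F T in sequentially. measure (M T) {x \<in> space (M T). \<bar>D T x\<bar> > e}
        \<le> measure (M T) {x \<in> space (M T). norm (R T x) > c} + measure (M T) {x \<in> space (M T). \<bar>Q T x\<bar> > d}"
      by (rule measure_eventually_le_union[OF M])
    have "\<forall>\<^sub>F T in sequentially. measure (M T) {x \<in> space (M T). \<bar>Q T x\<bar> > d} < a / 2"
      using Q \<open>0 < d\<close> \<open>0 < a / 2\<close> unfolding vanishing_in_prob_def by (intro order_tendstoD(2)) auto
    with le c show "\<forall>\<^sub>F T in sequentially. dist (measure (M T) {x \<in> space (M T). \<bar>D T x\<bar> > e}) 0 < a"
      by eventually_elim (simp add: dist_real_def)
  qed
qed

text \<open>The integrand is at most \<open>e\<close>, except on a set of vanishing probability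
  where it is at most \<open>c\<close>.\<close>

lemma vanishing_in_prob_expectation:
  assumes M: "discrete_laws M" and X: "vanishing_in_prob M X"
    and bound: "\<forall>\<^sub>F T in sequentially. \<forall>x\<in>space (M T). \<bar>X T x\<bar> \<le> c" and "0 \<le> c"
  shows "(\<lambda>T. \<integral>x. \<bar>X T x\<bar> \<partial>M T) \<longlonglongrightarrow> 0"
proof (rule tendstoI)
  fix a :: real assume "0 < a"
  define e where "e = a / 2"
  have "0 < e" using \<open>0 < a\<close> by (simp add: e_def)
  have "(\<lambda>T. c * measure (M T) {x \<in> space (M T). \<bar>X T x\<bar> > e}) \<longlonglongrightarrow> 0"
    using X \<open>0 < e\<close> unfolding vanishing_in_prob_def by (auto intro: tendsto_mult_right_zero)
  then have "\<forall>\<^sub>F T in sequentially. c * measure (M T) {x \<in> space (M T). \<bar>X T x\<bar> > e} < e"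
    using \<open>0 < e\<close> by (rule order_tendstoD)
  with M[unfolded discrete_laws_def] bound show "\<forall>\<^sub>F T in sequentially. dist (\<integral>x. \<bar>X T x\<bar> \<partial>M T) 0 < a"
  proof eventually_elim
    case (elim T)
    then interpret prob_space "M T" by simp
    have s: "sets (M T) = Pow (space (M T))"
      using elim by simp
    have meas: "f \<in> borel_measurable (M T)" for f :: "'a \<Rightarrow> real"
      by (simp add: measurable_def s)
    let ?A = "{x \<in> space (M T). \<bar>X T x\<bar> > e}"
    have A: "?A \<in> sets (M T)"
      by (simp add: s)
    have intX: "integrable (M T) (\<lambda>x. \<bar>X T x\<bar>)"
      by (rule integrable_const_bound[where B = c]) (use elim in \<open>auto intro!: AE_I2 meas\<close>)
    have intA: "integrable (M T) (indicator ?A :: _ \<Rightarrow> real)"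
      by (rule integrable_const_bound[where B = 1]) (auto intro!: AE_I2 meas)
    have "(\<integral>x. \<bar>X T x\<bar> \<partial>M T) \<le> (\<integral>x. e + c * indicator ?A x \<partial>M T)"
    proof (intro integral_mono intX)
      show "integrable (M T) (\<lambda>x. e + c * indicator ?A x)"
        using intA by simp
      show "\<bar>X T x\<bar> \<le> e + c * indicator ?A x" if "x \<in> space (M T)" for x
        using that elim(2) \<open>0 < e\<close> \<open>0 \<le> c\<close> by (auto simp: indicator_def)
    qed
    also have "\<dots> = e + c * measure (M T) ?A"
      using intA A by (simp add: prob_space)
    also have "\<dots> < a"
      using elim by (simp add: e_def)
    finally show ?case
      by (simp add: dist_real_def integral_nonneg_AE)
  qed
qed

lemma integral_finite_discrete:
  fixes f :: "'b \<Rightarrow> 'c::{banach, second_countable_topology}"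
  assumes "prob_space M" and fin: "finite (space M)" and sets: "sets M = Pow (space M)"
  shows "(\<integral>x. f x \<partial>M) = (\<Sum>x\<in>space M. measure M {x} *\<^sub>R f x)"
proof -
  interpret prob_space M by fact
  have int: "integrable M (\<lambda>x. indicator {y} x *\<^sub>R f y)" if "y \<in> space M" for y
    using that sets by (intro integrable_scaleR_left integrable_real_indicator) (auto simp: emeasure_eq_measure)
  have "(\<integral>x. f x \<partial>M) = (\<integral>x. (\<Sum>y\<in>space M. indicator {y} x *\<^sub>R f y) \<partial>M)"
  proof (rule Bochner_Integration.integral_cong[OF refl])
    fix x assume x: "x \<in> space M"
    have "(\<Sum>y\<in>space M. indicator {y} x *\<^sub>R f y) = (\<Sum>y\<in>space M. if y = x then f y else 0)"
      by (rule sum.cong) auto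
    then show "f x = (\<Sum>y\<in>space M. indicator {y} x *\<^sub>R f y)"
      using fin x by simp
  qed
  also have "\<dots> = (\<Sum>y\<in>space M. \<integral>x. indicator {y} x *\<^sub>R f y \<partial>M)"
    by (rule Bochner_Integration.integral_sum) (rule int)
  also have "\<dots> = (\<Sum>y\<in>space M. measure M {y} *\<^sub>R f y)"
  proof (rule sum.cong[OF refl])
    fix y assume "y \<in> space M"
    then have "space M \<inter> {y} = {y}" "{y} \<in> sets M"
      using sets by auto
    then show "(\<integral>x. indicator {y} x *\<^sub>R f y \<partial>M) = measure M {y} *\<^sub>R f y"
      by (subst integral_scaleR_left) (auto simp: emeasure_eq_measure Int_commute)
  qed
  finally show ?thesis .
qed

subsection \<open>Score and Fisher information\<close>

lemma grad_eqI:
  assumes "GDERIV f x :> v"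
  shows "grad f x = v"
  unfolding grad_def
proof (rule the_equality[of "\<lambda>v. GDERIV f x :> v", OF assms])
  fix w assume "GDERIV f x :> w"
  then have "(\<lambda>h. h \<bullet> w) = (\<lambda>h. h \<bullet> v)"
    using assms unfolding gderiv_def by (rule has_derivative_unique)
  then show "w = v"
    by (metis inner_commute vector_eq_rdot)
qed

lemma GDERIV_sum:
  "(\<And>i. i \<in> I \<Longrightarrow> GDERIV (f i) x :> v i) \<Longrightarrow> GDERIV (\<lambda>x. \<Sum>i\<in>I. f i x) x :> (\<Sum>i\<in>I. v i)"
  unfolding gderiv_def by (simp add: inner_sum_right has_derivative_sum)

lemma GDERIV_frechet:
  fixes f :: "'v::euclidean_space \<Rightarrow> real"
  assumes "f differentiable (at x)"
  shows "GDERIV f x :> (\<Sum>b\<in>Basis. frechet_derivative f (at x) b *\<^sub>R b)"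
proof -
  let ?D = "frechet_derivative f (at x)"
  have D: "(f has_derivative ?D) (at x)"
    using assms by (simp add: frechet_derivative_works)
  have "?D h = h \<bullet> (\<Sum>b\<in>Basis. ?D b *\<^sub>R b)" for h
  proof -
    have "?D h = ?D (\<Sum>b\<in>Basis. (h \<bullet> b) *\<^sub>R b)"
      by (simp add: euclidean_representation)
    also have "\<dots> = (\<Sum>b\<in>Basis. (h \<bullet> b) * ?D b)"
      using has_derivative_linear[OF D] by (simp add: linear_sum linear_scale)
    finally show ?thesis
      by (simp add: inner_sum_right mult.commute)
  qed
  then have "?D = (\<lambda>h. h \<bullet> (\<Sum>b\<in>Basis. ?D b *\<^sub>R b))"
    by (rule ext)
  with D show ?thesis
    unfolding gderiv_def by metis
qed

lemma Ck_on_GDERIV: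
  fixes f :: "'v::euclidean_space \<Rightarrow> real"
  assumes "Ck_on (Suc k) f S" "x \<in> S"
  shows "GDERIV f x :> grad f x"
  using GDERIV_frechet[of f x] grad_eqI[OF GDERIV_frechet[of f x]] assms by simp

lemma Ck_on_imp_continuous_on: "Ck_on k f S \<Longrightarrow> continuous_on S f"
  by (cases k) (auto intro!: differentiable_imp_continuous_on differentiable_at_imp_differentiable_on)

lemma Ck_on_isCont_grad:
  fixes f :: "'v::euclidean_space \<Rightarrow> real"
  assumes "Ck_on (Suc k) f S" "open S" "x \<in> S"
  shows "isCont (grad f) x"
proof -
  have "continuous_on S (\<lambda>x. frechet_derivative f (at x) b)" for b
    using assms(1) by (auto intro: Ck_on_imp_continuous_on)
  then have "continuous_on S (\<lambda>x. \<Sum>b\<in>Basis. frechet_derivative f (at x) b *\<^sub>R b)"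
    by (intro continuous_intros)
  moreover have "grad f x = (\<Sum>b\<in>Basis. frechet_derivative f (at x) b *\<^sub>R b)" if "x \<in> S" for x
    using assms(1) that by (intro grad_eqI GDERIV_frechet) simp
  ultimately have "continuous_on S (grad f)"
    by (simp cong: continuous_on_cong)
  then show ?thesis
    using assms(2,3) by (simp add: continuous_on_eq_continuous_at)
qed

lemma GDERIV_event_prob:
  assumes "GDERIV (lam r) \<theta> :> v"
  shows "GDERIV (event_prob lam r) \<theta> :> (1 - event_prob lam r \<theta>) *\<^sub>R v"
  using assms unfolding event_prob_def gderiv_def
  by (auto intro!: derivative_eq_intros)

text \<open>Since \<open>1 - event_prob\<close> is \<open>exp (- lam)\<close>, the no-event part of
  the log-likelihood is linear in the rate. Combined with the derivative of the event part, each
  phase contributes its centred count over the event probability, times the gradient of the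
  rate.\<close>

lemma score_eq:
  fixes \<theta> :: "'v::euclidean_space"
  assumes G: "\<And>r. r < K \<Longrightarrow> GDERIV (lam r) \<theta> :> grad (lam r) \<theta>"
    and pos: "\<And>r. r < K \<Longrightarrow> 0 < event_prob lam r \<theta>"
  shows "score K lam T xs \<theta> = (\<Sum>r<K. ((event_count K T xs r - event_prob lam r \<theta> * gate_count K T xs r)
      / event_prob lam r \<theta>) *\<^sub>R grad (lam r) \<theta>)"
  unfolding score_def
proof (rule grad_eqI)
  let ?q = "\<lambda>r. event_prob lam r \<theta>"
  have log_lik: "log_lik K (event_prob lam) T xs = (\<lambda>\<theta>. \<Sum>r<K. event_count K T xs r * ln (event_prob lam r \<theta>)
           + (gate_count K T xs r - event_count K T xs r) * (- lam r \<theta>))"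
    by (rule ext) (simp add: log_lik_def event_prob_def)
  show "GDERIV (log_lik K (event_prob lam) T xs) \<theta> :> (\<Sum>r<K. ((event_count K T xs r - ?q r * gate_count K T xs r)
      / ?q r) *\<^sub>R grad (lam r) \<theta>)"
    unfolding log_lik
  proof (rule GDERIV_sum)
    fix r assume "r \<in> {..<K}"
    then have r: "r < K" by simp
    let ?E = "event_count K T xs r" and ?N = "gate_count K T xs r" and ?v = "grad (lam r) \<theta>"
    have "GDERIV (\<lambda>\<theta>. ?E * ln (event_prob lam r \<theta>) + (?N - ?E) * (- lam r \<theta>)) \<theta>
        :> (?E / ?q r) *\<^sub>R ((1 - ?q r) *\<^sub>R ?v) + (?N - ?E) *\<^sub>R (- ?v)"
      using GDERIV_event_prob[of lam r \<theta>, OF G[OF r]] G[OF r] pos[OF r] unfolding gderiv_def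
      by (auto intro!: derivative_eq_intros simp: inner_diff_right field_simps)
    also have "(?E / ?q r) *\<^sub>R ((1 - ?q r) *\<^sub>R ?v) + (?N - ?E) *\<^sub>R (- ?v)
        = (?E / ?q r * (1 - ?q r) - (?N - ?E)) *\<^sub>R ?v"
      using scaleR_left_diff_distrib[of "?E / ?q r * (1 - ?q r)" "?N - ?E" ?v]
      by (simp only: scaleR_scaleR scaleR_minus_right add_uminus_conv_diff)
    also have "?E / ?q r * (1 - ?q r) - (?N - ?E) = (?E - ?q r * ?N) / ?q r"
      using pos[OF r] by (simp add: field_simps)
    finally show "GDERIV (\<lambda>\<theta>. ?E * ln (event_prob lam r \<theta>) + (?N - ?E) * (- lam r \<theta>)) \<theta>
        :> ((?E - ?q r * ?N) / ?q r) *\<^sub>R ?v" .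
  qed
qed

lemma fisher_mult_vec:
  "fisher K lam \<theta> \<alpha> *v x = (\<Sum>r<K. (\<alpha> r / real K * ((1 - event_prob lam r \<theta>) / event_prob lam r \<theta>)
      * (grad (lam r) \<theta> \<bullet> x)) *\<^sub>R grad (lam r) \<theta>)"
proof -
  have outer: "outer v *v x = (v \<bullet> x) *\<^sub>R v" for v x :: "real^'d"
    by (simp add: vec_eq_iff outer_def matrix_vector_mult_def inner_vec_def sum_distrib_left sum_distrib_right mult_ac)
  have lin: "linear (\<lambda>A. A *v x)"
    by (rule linearI) (auto simp: matrix_vector_mult_add_rdistrib scaleR_matrix_vector_assoc)
  show ?thesis
    by (simp add: fisher_def fisher_component_def scaleR_matrix_vector_assoc[symmetric] linear_sum[OF lin] outer
        scaleR_sum_right mult_ac)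
qed

lemma tendsto_outer: "(f \<longlongrightarrow> v) F \<Longrightarrow> ((\<lambda>x. outer (f x)) \<longlongrightarrow> outer v) F"
  unfolding outer_def by (intro vec_tendstoI) (auto intro!: tendsto_intros)

section \<open>Expansions along sequences and perturbed linear systems\<close>

lemma tendsto_of_scaled_bound:
  fixes x :: "'v::real_normed_vector"
  assumes s: "filterlim s at_top sequentially" and bound: "\<And>k. norm (s k *\<^sub>R (y k - x)) \<le> c"
  shows "y \<longlonglongrightarrow> x"
proof -
  have "\<forall>\<^sub>F k in sequentially. 0 < s k"
    using s by (simp add: filterlim_at_top_dense)
  then have "\<forall>\<^sub>F k in sequentially. norm (y k - x) \<le> c / s k"
  proof eventually_elim
    case (elim k)
    have "s k * norm (y k - x) \<le> c"
      using bound[of k, unfolded norm_scaleR] elim by simp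
    then show ?case
      using elim by (simp add: field_simps)
  qed
  then have "(\<lambda>k. y k - x) \<longlonglongrightarrow> 0"
    by (rule Lim_null_comparison[OF _ real_tendsto_divide_at_top[OF tendsto_const s]])
  then show ?thesis
    by (simp add: LIM_zero_iff)
qed

text \<open>The remainder of the derivative at the single point \<open>x\<close> is small relative
  to the distance from \<open>x\<close>, which is at most \<open>c / s k\<close>; multiplying by
  \<open>s k\<close> leaves a null sequence.\<close>

lemma differentiable_expansion:
  fixes f :: "'v::euclidean_space \<Rightarrow> real"
  assumes G: "GDERIV f x :> v" and s: "filterlim s at_top sequentially"
    and bound: "\<And>k. norm (s k *\<^sub>R (y k - x)) \<le> c"
  shows "(\<lambda>k. s k * (f (y k) - f x) - v \<bullet> (s k *\<^sub>R (y k - x))) \<longlonglongrightarrow> 0"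
proof -
  have "0 \<le> c"
    using bound[of 0] norm_ge_zero order_trans by blast
  have spos: "\<forall>\<^sub>F k in sequentially. 0 < s k"
    using s by (simp add: filterlim_at_top_dense)
  have yx: "y \<longlonglongrightarrow> x"
    by (rule tendsto_of_scaled_bound[OF s bound])
  show ?thesis
  proof (rule tendstoI)
    fix e :: real assume "0 < e"
    \<comment> \<open>The 1 in the denominator makes \<open>e' * c\<close> strictly smaller than
      \<open>e\<close> and covers \<open>c = 0\<close>.\<close>
    define e' where "e' = e / (c + 1)"
    have "0 < e'" and e'c: "e' * c < e"
      using \<open>0 < e\<close> \<open>0 \<le> c\<close> by (auto simp: e'_def field_simps)
    obtain d where "0 < d" and d: "\<And>z. norm (z - x) < d \<Longrightarrow> norm (f z - f x - (z - x) \<bullet> v) \<le> e' * norm (z - x)"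
      using G \<open>0 < e'\<close> unfolding gderiv_def has_derivative_at_alt by blast
    have "\<forall>\<^sub>F k in sequentially. norm (y k - x) < d"
      using yx \<open>0 < d\<close> by (auto simp: tendsto_iff dist_norm)
    with spos show "\<forall>\<^sub>F k in sequentially. dist (s k * (f (y k) - f x) - v \<bullet> (s k *\<^sub>R (y k - x))) 0 < e"
    proof eventually_elim
      case (elim k)
      have "\<bar>s k * (f (y k) - f x) - v \<bullet> (s k *\<^sub>R (y k - x))\<bar> = s k * \<bar>f (y k) - f x - (y k - x) \<bullet> v\<bar>"
        using elim by (simp add: abs_mult[symmetric] inner_commute right_diff_distrib[symmetric])
          (simp add: abs_mult)
      also have "\<dots> \<le> s k * (e' * norm (y k - x))"
        using d[of "y k"] elim by (intro mult_left_mono) auto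
      also have "\<dots> = e' * norm (s k *\<^sub>R (y k - x))"
        using elim by simp
      also have "\<dots> \<le> e' * c"
        using bound \<open>0 < e'\<close> by (intro mult_left_mono) auto
      finally show ?case
        using e'c by (simp add: dist_real_def)
    qed
  qed
qed

lemma bounded_bilinear_matrix_vector_mult:
  "bounded_bilinear (\<lambda>(A :: real^'n^'m) x. A *v x)"
  unfolding bilinear_conv_bounded_bilinear[symmetric] bilinear_def
  by (auto intro!: linearI simp: matrix_vector_mult_add_rdistrib matrix_vector_right_distrib
      scaleR_matrix_vector_assoc matrix_vector_mult_scaleR)

lemma tendsto_scaleR_bounded_null:
  fixes f :: "nat \<Rightarrow> real" and g :: "nat \<Rightarrow> 'v::real_normed_vector"
  assumes "\<And>k. \<bar>f k\<bar> \<le> c" "g \<longlonglongrightarrow> 0"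
  shows "(\<lambda>k. f k *\<^sub>R g k) \<longlonglongrightarrow> 0"
proof (rule Lim_null_comparison)
  show "\<forall>\<^sub>F k in sequentially. norm (f k *\<^sub>R g k) \<le> c * norm (g k)"
    using assms(1) by (auto intro!: always_eventually mult_right_mono)
  show "(\<lambda>k. c * norm (g k)) \<longlonglongrightarrow> 0"
    using assms(2) by (auto intro: tendsto_mult_right_zero tendsto_norm_zero)
qed

text \<open>Instead of continuity of matrix inversion, a lower bound is used: \<open>A\<close>
  expands norms by at least \<open>m\<close>, so every \<open>J k\<close> close to \<open>A\<close>
  expands them by at least \<open>m / 2\<close>. This gives invertibility and bounds the difference
  of the two solutions by its image under \<open>J k\<close>.\<close>

lemma linear_system_perturbation:
  fixes J :: "nat \<Rightarrow> real^'n^'n" and A :: "real^'n^'n"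
  assumes AB: "A ** B = mat 1" and J: "J \<longlonglongrightarrow> A"
    and zw: "(\<lambda>k. z k - w k) \<longlonglongrightarrow> 0" and w: "\<And>k. norm (w k) \<le> c"
  shows "\<forall>\<^sub>F k in sequentially. invertible (J k)"
    and "(\<lambda>k. matrix_inv (J k) *v z k - B *v w k) \<longlonglongrightarrow> 0"
proof -
  interpret mv: bounded_bilinear "\<lambda>(A :: real^'n^'n) x. A *v x"
    by (rule bounded_bilinear_matrix_vector_mult)
  obtain C where C: "0 < C" "\<And>A x. norm ((A :: real^'n^'n) *v x) \<le> norm A * norm x * C"
    using mv.pos_bounded by blast
  have BA: "B ** A = mat 1"
    using AB by (rule matrix_left_right_inverse[THEN iffD1])
  \<comment> \<open>The norm of \<open>B\<close> bounds how much \<open>A\<close> can shrink a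
    vector; adding 1 keeps the denominator positive.\<close>
  define m where "m = 1 / (norm B * C + 1)"
  have pos: "0 < norm B * C + 1"
    using C(1) by (simp add: add_nonneg_pos)
  then have "0 < m"
    by (simp add: m_def)
  have mA: "m * norm x \<le> norm (A *v x)" for x
  proof -
    have "norm x = norm (B *v (A *v x))"
      by (simp add: matrix_vector_mul_assoc BA)
    also have "\<dots> \<le> norm B * norm (A *v x) * C"
      by (rule C)
    also have "\<dots> \<le> (norm B * C + 1) * norm (A *v x)"
      by (simp add: algebra_simps)
    finally show ?thesis
      using pos by (simp add: m_def pos_divide_le_eq mult.commute)
  qed
  have "\<forall>\<^sub>F k in sequentially. norm (J k - A) < m / (2 * C)"
    using J \<open>0 < m\<close> C(1) by (auto simp: tendsto_iff dist_norm)
  then have ev: "\<forall>\<^sub>F k in sequentially. \<forall>x. m / 2 * norm x \<le> norm (J k *v x)"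
  proof eventually_elim
    case (elim k)
    show ?case
    proof
      fix x
      have "norm ((J k - A) *v x) \<le> norm (J k - A) * norm x * C"
        by (rule C)
      also have "\<dots> \<le> m / (2 * C) * norm x * C"
        using elim C(1) by (intro mult_right_mono) auto
      finally have "norm ((J k - A) *v x) \<le> m / 2 * norm x"
        using C(1) by simp
      moreover have "A *v x = J k *v x - (J k - A) *v x"
        by (simp add: mv.diff_left)
      then have "norm (A *v x) \<le> norm (J k *v x) + norm ((J k - A) *v x)"
        by (metis norm_triangle_ineq4)
      ultimately show "m / 2 * norm x \<le> norm (J k *v x)"
        using mA[of x] by simp
    qed
  qed
  show inv: "\<forall>\<^sub>F k in sequentially. invertible (J k)"
    using ev
  proof eventually_elim
    case (elim k)
    have "x = 0" if "J k *v x = 0" for x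
    proof -
      have "m / 2 * norm x \<le> 0"
        using elim[rule_format, of x] that by simp
      then show ?thesis
        using \<open>0 < m\<close> by (simp add: mult_le_0_iff)
    qed
    then have "\<exists>B. B ** J k = mat 1"
      by (simp add: matrix_left_invertible_ker)
    then show ?case
      using matrix_left_right_inverse unfolding invertible_def by blast
  qed
  have Bw: "norm (B *v w k) \<le> norm B * c * C" for k
    using C(2)[of B "w k"] w[of k] C(1)
    by (meson mult_left_mono mult_right_mono norm_ge_zero order_trans less_imp_le)
  have "(\<lambda>k. norm (z k - w k) + norm (A - J k) * (norm B * c * C) * C) \<longlonglongrightarrow> 0"
  proof -
    have "(\<lambda>k. A - J k) \<longlonglongrightarrow> 0"
      using tendsto_diff[OF tendsto_const J, of A] by simp
    then show ?thesis
      using zw by (auto intro!: tendsto_add_zero tendsto_mult_left_zero tendsto_norm_zero)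
  qed
  then have lim: "(\<lambda>k. 2 / m * (norm (z k - w k) + norm (A - J k) * (norm B * c * C) * C)) \<longlonglongrightarrow> 0"
    by (rule tendsto_mult_right_zero)
  show "(\<lambda>k. matrix_inv (J k) *v z k - B *v w k) \<longlonglongrightarrow> 0"
  proof (rule Lim_null_comparison[OF _ lim])
    show "\<forall>\<^sub>F k in sequentially. norm (matrix_inv (J k) *v z k - B *v w k)
        \<le> 2 / m * (norm (z k - w k) + norm (A - J k) * (norm B * c * C) * C)"
      using ev inv
    proof eventually_elim
      case (elim k)
      let ?x = "matrix_inv (J k) *v z k - B *v w k"
      have "J k ** matrix_inv (J k) = mat 1"
        by (rule matrix_inv_mult[OF elim(2)])
      then have "J k *v (matrix_inv (J k) *v z k) = z k"
        by (simp add: matrix_vector_mul_assoc)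
      moreover have "A *v (B *v w k) = w k"
        by (simp add: matrix_vector_mul_assoc AB)
      \<comment> \<open>The image of the difference of the solutions splits into the change of the
        right-hand side and the effect of replacing \<open>A\<close> by \<open>J k\<close> on the
        bounded vector \<open>B *v w k\<close>.\<close>
      ultimately have "J k *v ?x = (z k - w k) + (A - J k) *v (B *v w k)"
        by (simp add: mv.diff_left mv.diff_right)
      then have "norm (J k *v ?x) \<le> norm (z k - w k) + norm ((A - J k) *v (B *v w k))"
        by (metis norm_triangle_ineq)
      also have "norm ((A - J k) *v (B *v w k)) \<le> norm (A - J k) * norm (B *v w k) * C"
        by (rule C)
      also have "\<dots> \<le> norm (A - J k) * (norm B * c * C) * C"
        using Bw[of k] C(1) by (intro mult_right_mono mult_left_mono) auto
      finally have "m / 2 * norm ?x \<le> norm (z k - w k) + norm (A - J k) * (norm B * c * C) * C"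
        using elim(1)[rule_format, of ?x] by simp
      then show ?case
        using \<open>0 < m\<close> by (simp add: field_simps)
    qed
  qed
qed

subsection \<open>Local asymptotics of the gated model\<close>

lemma iexp_diff_le: "cmod (iexp a - iexp b) \<le> \<bar>a - b\<bar>"
proof -
  have "iexp a - iexp b = iexp b * (iexp (a - b) - 1)"
    by (simp add: exp_diff right_diff_distrib)
  then have "cmod (iexp a - iexp b) = cmod (iexp (a - b) - 1)"
    by (simp only: norm_mult norm_exp_i_times mult_1_left)
  also have "\<dots> \<le> \<bar>a - b\<bar>"
    using iexp_approx1[of "a - b" 0] by simp
  finally show ?thesis .
qed

lemma path_weight_support:
  assumes "path_weight \<kappa> q xs \<noteq> 0" "t < length xs" "snd (xs ! t)"
  shows "fst (xs ! t)"
proof (rule ccontr)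
  assume "\<not> fst (xs ! t)"
  then have "emission (q t) (xs ! t) = 0"
    using assms(3) by (simp add: emission_def)
  then have "path_weight \<kappa> q xs = 0"
    unfolding path_weight_def using assms(2) by (intro prod_zero) auto
  with assms(1) show False by simp
qed

lemma path_weight_nonneg:
  assumes "\<And>t xs g. 0 \<le> \<kappa> t xs g" "\<And>t. 0 \<le> q t" "\<And>t. q t \<le> 1"
  shows "0 \<le> path_weight \<kappa> q xs"
  unfolding path_weight_def emission_def using assms by (intro prod_nonneg ballI mult_nonneg_nonneg) auto

text \<open>\<open>\<psi> t\<close> is the conditional moment generating function of the centred
  event at an open gate. At a closed gate the exponent vanishes as well, provided that no event is
  recorded there, which holds on every string of nonzero weight. The field is left general: real for
  tail bounds, complex for characteristic functions.\<close>

lemma sum_path_weight_exp: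
  fixes q :: "nat \<Rightarrow> real" and z :: "nat \<Rightarrow> 'b::{real_normed_field,banach}"
  assumes \<kappa>: "\<And>t xs. length xs = t \<Longrightarrow> \<kappa> t xs True + \<kappa> t xs False = 1"
  defines "\<psi> \<equiv> \<lambda>t. of_real (q t) * exp (z t * of_real (1 - q t)) + of_real (1 - q t) * exp (- (z t * of_real (q t)))"
  assumes \<psi>: "\<And>t. t < T \<Longrightarrow> \<psi> t \<noteq> 0"
  shows "(\<Sum>xs | length xs = T. of_real (path_weight \<kappa> q xs)
    * (exp (\<Sum>t<T. z t * of_real (of_bool (snd (xs ! t)) - q t * of_bool (fst (xs ! t))))
       / (\<Prod>t<T. if fst (xs ! t) then \<psi> t else 1))) = 1"
proof -
  let ?m = "\<lambda>t y. exp (z t * of_real (of_bool y - q t)) / \<psi> t"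
  have e1: "(\<Sum>xs | length xs = T. of_real (path_weight \<kappa> q xs)
    * (\<Prod>t<T. if fst (xs ! t) then ?m t (snd (xs ! t)) else 1)) = 1"
  proof (rule sum_path_weight[OF \<kappa>])
    fix t assume "t < T"
    then show "of_real (q t) * ?m t True + of_real (1 - q t) * ?m t False = 1"
      using \<psi>[of t] by (simp add: add_divide_distrib[symmetric]) (simp add: \<psi>_def)
  qed
  have e2: "of_real (path_weight \<kappa> q xs) * (\<Prod>t<T. if fst (xs ! t) then ?m t (snd (xs ! t)) else 1)
      = of_real (path_weight \<kappa> q xs)
    * (exp (\<Sum>t<T. z t * of_real (of_bool (snd (xs ! t)) - q t * of_bool (fst (xs ! t))))
       / (\<Prod>t<T. if fst (xs ! t) then \<psi> t else 1))" if xs: "length xs = T" for xs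
  proof (cases "path_weight \<kappa> q xs = 0")
    case False
    have "exp (\<Sum>t<T. z t * of_real (of_bool (snd (xs ! t)) - q t * of_bool (fst (xs ! t))))
        = (\<Prod>t<T. exp (z t * of_real (of_bool (snd (xs ! t)) - q t * of_bool (fst (xs ! t)))))"
      by (simp add: exp_sum)
    also have "\<dots> / (\<Prod>t<T. if fst (xs ! t) then \<psi> t else 1)
        = (\<Prod>t<T. exp (z t * of_real (of_bool (snd (xs ! t)) - q t * of_bool (fst (xs ! t))))
            / (if fst (xs ! t) then \<psi> t else 1))"
      by (simp add: prod_dividef)
    also have "\<dots> = (\<Prod>t<T. if fst (xs ! t) then ?m t (snd (xs ! t)) else 1)"
    proof (rule prod.cong[OF refl])
      fix t assume "t \<in> {..<T}"
      then have "snd (xs ! t) \<Longrightarrow> fst (xs ! t)"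
        using path_weight_support[OF False, of t] xs by simp
      then show "exp (z t * of_real (of_bool (snd (xs ! t)) - q t * of_bool (fst (xs ! t))))
            / (if fst (xs ! t) then \<psi> t else 1) = (if fst (xs ! t) then ?m t (snd (xs ! t)) else 1)"
        by auto
    qed
    finally show ?thesis by simp
  qed simp
  show ?thesis
    by (rule trans[OF sum.cong[OF refl e2[symmetric]] e1]) simp
qed

section \<open>Exponential bounds and the characteristic function of a centred Bernoulli
  variable\<close>

lemma exp_minus_le:
  fixes a :: real
  assumes "0 \<le> a"
  shows "exp (- a) \<le> 1 - a + a\<^sup>2"
proof -
  have "exp (- a) \<le> 1 / (1 + a)"
    using exp_ge_add_one_self[of a] assms by (simp add: exp_minus field_simps)
  also have "\<dots> \<le> 1 - a + a\<^sup>2"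
  proof -
    have "(1 + a) * (1 - a + a\<^sup>2) = 1 + a ^ 3"
      by (simp add: algebra_simps power2_eq_square power3_eq_cube)
    then show ?thesis
      using assms by (simp add: divide_le_eq mult.commute)
  qed
  finally show ?thesis .
qed

lemma exp_le_quadratic:
  fixes x :: real
  assumes "\<bar>x\<bar> \<le> 1"
  shows "exp x \<le> 1 + x + x\<^sup>2"
proof (cases "0 \<le> x")
  case True
  then show ?thesis using assms by (intro exp_bound) auto
next
  case False
  then show ?thesis using exp_minus_le[of "- x"] by simp
qed

lemma exp_minus_le_quadratic:
  fixes a :: real
  assumes "0 \<le> a"
  shows "\<bar>exp (- a) - (1 - a)\<bar> \<le> a\<^sup>2"
  using exp_ge_add_one_self[of "- a"] exp_minus_le[OF assms] by (simp add: abs_le_iff)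

text \<open>A Taylor expansion up to second order: centring removes the linear term, the quadratic
  term gives \<open>1 - a\<close> with \<open>a\<close> half the variance, and the remainder is of
  third order. Passing from \<open>1 - a\<close> to \<open>exp (- a)\<close> costs the square of
  \<open>a\<close>, which is of fourth order and is weakened to third order by
  \<open>1 \<le> s\<close>. With \<open>s = sqrt T\<close>, \<open>T\<close> such errors still sum
  to order \<open>1 / s\<close>.\<close>

lemma char_centered_bernoulli:
  fixes b q s :: real
  assumes q: "0 \<le> q" "q \<le> 1" and s: "1 \<le> s" and b: "\<bar>b\<bar> \<le> B"
  defines "\<phi> \<equiv> of_real q * iexp (b / s * (1 - q)) + of_real (1 - q) * iexp (- (b / s * q))"
  shows "cmod \<phi> \<le> 1"
    and "cmod (\<phi> - of_real (exp (- (b\<^sup>2 * (q * (1 - q)) / (2 * s\<^sup>2))))) \<le> (B ^ 3 + B ^ 4) / s ^ 3"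
proof -
  have "cmod \<phi> \<le> cmod (of_real q * iexp (b / s * (1 - q))) + cmod (of_real (1 - q) * iexp (- (b / s * q)))"
    unfolding \<phi>_def by (rule norm_triangle_ineq)
  also have "\<dots> = 1"
    using q by (simp only: norm_mult norm_exp_i_times norm_of_real) simp
  finally show "cmod \<phi> \<le> 1" .
  have "0 \<le> B" using b by linarith
  define x y where "x = b / s * (1 - q)" and "y = - (b / s * q)"
  let ?t = "\<lambda>x. 1 + \<i> * of_real x - of_real (x\<^sup>2 / 2) :: complex"
  have t: "cmod (iexp x - ?t x) \<le> \<bar>x\<bar> ^ 3 / 6" for x
  proof -
    have "(\<Sum>k\<le>2. (\<i> * complex_of_real x) ^ k / fact k) = ?t x"
      by (simp add: numeral_2_eq_2 power_mult_distrib)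
    then show ?thesis
      using iexp_approx1[of x 2] by (simp add: numeral_3_eq_3[symmetric] fact_numeral)
  qed
  have bs: "\<bar>b / s\<bar> \<le> B / s"
    using b s by (simp add: divide_right_mono)
  have "\<bar>b / s\<bar> * (1 - q) \<le> B / s * 1" "\<bar>b / s\<bar> * q \<le> B / s * 1"
    by (rule mult_mono[OF bs]; use q \<open>0 \<le> B\<close> s in simp)+
  moreover have "\<bar>x\<bar> = \<bar>b / s\<bar> * (1 - q)" "\<bar>y\<bar> = \<bar>b / s\<bar> * q"
    using q by (simp_all only: x_def y_def abs_minus_cancel abs_mult)
  ultimately have "\<bar>x\<bar> \<le> B / s" "\<bar>y\<bar> \<le> B / s"
    by simp_all
  then have xy: "\<bar>x\<bar> ^ 3 \<le> (B / s) ^ 3" "\<bar>y\<bar> ^ 3 \<le> (B / s) ^ 3"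
    by (auto intro!: power_mono)
  define a where "a = b\<^sup>2 * (q * (1 - q)) / (2 * s\<^sup>2)"
  have q4: "q * (1 - q) \<le> 1"
    using q by (simp add: mult_le_one)
  have "0 \<le> a"
    using q by (simp add: a_def)
  \<comment> \<open>Under the weights \<open>q\<close> and \<open>1 - q\<close> the points
    \<open>x\<close> and \<open>y\<close> have mean 0 and second moment
    \<open>2 * a\<close>.\<close>
  have mean: "of_real q * ?t x + of_real (1 - q) * ?t y = of_real (1 - a)"
  proof -
    have "q * x + (1 - q) * y = 0"
      using s by (simp add: x_def y_def field_simps)
    moreover have "q * x\<^sup>2 + (1 - q) * y\<^sup>2 = 2 * a"
    proof -
      have "q * (c * (1 - q))\<^sup>2 + (1 - q) * (- (c * q))\<^sup>2 = c\<^sup>2 * (q * (1 - q))" for c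
        by (simp add: power2_eq_square algebra_simps)
      from this[of "b / s"] show ?thesis
        unfolding x_def y_def by (simp only:) (simp add: a_def power_divide)
    qed
    ultimately have "Re (of_real q * ?t x + of_real (1 - q) * ?t y) = 1 - a"
      "Im (of_real q * ?t x + of_real (1 - q) * ?t y) = 0"
      by (simp_all add: field_simps)
    then show ?thesis
      by (simp add: complex_eq_iff)
  qed
  have \<phi>: "\<phi> = of_real q * iexp x + of_real (1 - q) * iexp y"
    unfolding \<phi>_def x_def y_def by simp
  have "cmod (\<phi> - of_real (1 - a)) = cmod (of_real q * (iexp x - ?t x) + of_real (1 - q) * (iexp y - ?t y))"
    unfolding mean[symmetric] \<phi> by (rule arg_cong[where f = cmod]) (simp add: algebra_simps)
  also have "\<dots> \<le> cmod (of_real q * (iexp x - ?t x)) + cmod (of_real (1 - q) * (iexp y - ?t y))"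
    by (rule norm_triangle_ineq)
  also have "\<dots> = q * cmod (iexp x - ?t x) + (1 - q) * cmod (iexp y - ?t y)"
    using q by (simp only: norm_mult norm_of_real abs_of_nonneg diff_ge_0_iff_ge)
  also have "\<dots> \<le> q * (B / s) ^ 3 + (1 - q) * (B / s) ^ 3"
  proof -
    have "cmod (iexp x - ?t x) \<le> (B / s) ^ 3" "cmod (iexp y - ?t y) \<le> (B / s) ^ 3"
      using t[of x] t[of y] xy zero_le_power[of "\<bar>x\<bar>" 3] zero_le_power[of "\<bar>y\<bar>" 3] by linarith+
    then show ?thesis
      using q by (intro add_mono mult_left_mono) simp_all
  qed
  also have "\<dots> = B ^ 3 / s ^ 3"
    by (simp only: distrib_right[symmetric] power_divide) simp
  finally have 1: "cmod (\<phi> - of_real (1 - a)) \<le> B ^ 3 / s ^ 3" .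
  have a: "a \<le> B\<^sup>2 / s\<^sup>2"
  proof -
    have "b\<^sup>2 \<le> B\<^sup>2"
      using b by (metis abs_ge_zero power2_abs power_mono)
    then have "b\<^sup>2 * (q * (1 - q)) \<le> B\<^sup>2 * 1"
      using q q4 by (intro mult_mono) auto
    then have "a \<le> B\<^sup>2 / (2 * s\<^sup>2)"
      using s by (simp add: a_def divide_right_mono)
    also have "\<dots> \<le> B\<^sup>2 / s\<^sup>2"
      using s by (intro divide_left_mono) auto
    finally show ?thesis .
  qed
  have "\<bar>exp (- a) - (1 - a)\<bar> \<le> a\<^sup>2"
    using \<open>0 \<le> a\<close> by (rule exp_minus_le_quadratic)
  also have "\<dots> \<le> (B\<^sup>2 / s\<^sup>2)\<^sup>2"
    using a \<open>0 \<le> a\<close> by (rule power_mono)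
  also have "\<dots> = B ^ 4 / s ^ 4"
    by (simp add: power_divide)
  also have "\<dots> \<le> B ^ 4 / s ^ 3"
    using s \<open>0 \<le> B\<close> by (intro divide_left_mono power_increasing) auto
  finally have 2: "\<bar>exp (- a) - (1 - a)\<bar> \<le> B ^ 4 / s ^ 3" .
  have "cmod (\<phi> - of_real (exp (- a))) \<le> cmod (\<phi> - of_real (1 - a)) + cmod (of_real (1 - a) - of_real (exp (- a)))"
    by (metis norm_triangle_ineq diff_add_cancel add_diff_eq)
  also have "cmod (of_real (1 - a) - of_real (exp (- a))) = \<bar>exp (- a) - (1 - a)\<bar>"
    by (simp only: of_real_diff[symmetric] norm_of_real abs_minus_commute)
  finally have "cmod (\<phi> - of_real (exp (- a))) \<le> B ^ 3 / s ^ 3 + B ^ 4 / s ^ 3"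
    using 1 2 by linarith
  then show "cmod (\<phi> - of_real (exp (- (b\<^sup>2 * (q * (1 - q)) / (2 * s\<^sup>2))))) \<le> (B ^ 3 + B ^ 4) / s ^ 3"
    by (simp only: a_def add_divide_distrib)
qed

section \<open>Counts by phase, sums over time and gating frequencies\<close>

lemma sum_counts:
  assumes "1 \<le> K"
  shows "(\<Sum>r<K. c r * (event_count K T xs r - q r * gate_count K T xs r))
    = (\<Sum>t<T. c (t mod K) * (of_bool (snd (xs ! t)) - q (t mod K) * of_bool (fst (xs ! t))))"
proof -
  let ?f = "\<lambda>t. c (t mod K) * (of_bool (snd (xs ! t)) - q (t mod K) * of_bool (fst (xs ! t)))"
  have "c r * (event_count K T xs r - q r * gate_count K T xs r) = (\<Sum>t | t \<in> {..<T} \<and> t mod K = r. ?f t)" for r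
  proof -
    have "c r * (event_count K T xs r - q r * gate_count K T xs r)
        = (\<Sum>t | t \<in> {..<T} \<and> t mod K = r. c r * (of_bool (snd (xs ! t)) - q r * of_bool (fst (xs ! t))))"
      by (simp only: event_count_def gate_count_def sum_distrib_left sum_subtractf right_diff_distrib lessThan_iff)
    then show ?thesis
      by (auto intro: sum.cong)
  qed
  then have "(\<Sum>r<K. c r * (event_count K T xs r - q r * gate_count K T xs r))
      = (\<Sum>r\<in>{..<K}. \<Sum>t | t \<in> {..<T} \<and> t mod K = r. ?f t)"
    by simp
  also have "\<dots> = (\<Sum>t<T. ?f t)"
    using assms by (intro sum.group) auto
  finally show ?thesis .
qed

text \<open>The frequency uses complete periods only. The times of phase \<open>r\<close> below
  \<open>T\<close> that it misses lie in the incomplete last period, and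
  \<open>r + (T div K) * K\<close> is the only candidate.\<close>

lemma gate_count_gating_freq:
  assumes K: "1 \<le> K" and r: "r < K"
  shows "\<bar>gate_count K T xs r - real (T div K) * gating_freq K T xs r\<bar> \<le> 1"
proof -
  let ?L = "T div K" and ?g = "\<lambda>t. of_bool (fst (xs ! t)) :: real"
  have K0: "0 < K" using K by simp
  \<comment> \<open>Without a complete period the frequency is a division by 0, and both sides are
    0.\<close>
  have "real ?L * gating_freq K T xs r = (\<Sum>l<?L. ?g (r + l * K))"
    by (cases "?L = 0") (simp_all add: gating_freq_def Let_def)
  also have "\<dots> = sum ?g ((\<lambda>l. r + l * K) ` {..<?L})"
    using K0 by (subst sum.reindex) (auto simp: inj_on_def)
  finally have freq: "real ?L * gating_freq K T xs r = sum ?g ((\<lambda>l. r + l * K) ` {..<?L})" .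
  let ?S = "{t. t < T \<and> t mod K = r}"
  have sub: "(\<lambda>l. r + l * K) ` {..<?L} \<subseteq> ?S"
  proof
    fix t assume "t \<in> (\<lambda>l. r + l * K) ` {..<?L}"
    then obtain l where l: "l < ?L" "t = r + l * K" by auto
    have "(l + 1) * K \<le> ?L * K" using l(1) by (intro mult_right_mono) auto
    also have "\<dots> \<le> T" by simp
    finally have "r + l * K < T" using r by simp
    then show "t \<in> ?S" using l r by simp
  qed
  have rest: "?S - (\<lambda>l. r + l * K) ` {..<?L} \<subseteq> {r + ?L * K}"
  proof
    fix t assume t: "t \<in> ?S - (\<lambda>l. r + l * K) ` {..<?L}"
    then have eq: "t = r + t div K * K"
      using div_mult_mod_eq[of t K] by simp
    have "t div K \<le> ?L" using t by (simp add: div_le_mono)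
    moreover have "\<not> t div K < ?L"
    proof
      assume "t div K < ?L"
      then have "t \<in> (\<lambda>l. r + l * K) ` {..<?L}"
        by (intro image_eqI[where x = "t div K"], intro eq) (simp only: lessThan_iff)
      with t show False by blast
    qed
    ultimately have "t div K = ?L" by simp
    with eq have "t = r + ?L * K" by (simp only:)
    then show "t \<in> {r + ?L * K}" by (simp only: singleton_iff)
  qed
  have "finite ?S" by simp
  then have "gate_count K T xs r = sum ?g ((\<lambda>l. r + l * K) ` {..<?L}) + sum ?g (?S - (\<lambda>l. r + l * K) ` {..<?L})"
    unfolding gate_count_def using sum.subset_diff[OF sub, of ?g] by simp
  moreover have "0 \<le> sum ?g (?S - (\<lambda>l. r + l * K) ` {..<?L})"
    by (intro sum_nonneg) auto
  moreover have "sum ?g (?S - (\<lambda>l. r + l * K) ` {..<?L}) \<le> sum ?g {r + ?L * K}"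
    by (rule sum_mono2[OF _ rest]) auto
  moreover have "sum ?g {r + ?L * K} \<le> 1"
    by (simp del: sum_of_bool_eq)
  ultimately show ?thesis
    unfolding abs_le_iff using freq by linarith
qed

lemma gate_count_limit:
  assumes K: "1 \<le> K" and r: "r < K" and \<tau>: "filterlim \<tau> sequentially sequentially"
    and f: "(\<lambda>k. gating_freq K (\<tau> k) (X k) r) \<longlonglongrightarrow> g"
  shows "(\<lambda>k. gate_count K (\<tau> k) (X k) r / real (\<tau> k)) \<longlonglongrightarrow> g / real K"
proof -
  have r\<tau>: "filterlim (\<lambda>k. real (\<tau> k)) at_top sequentially"
    using filterlim_compose[OF filterlim_real_sequentially \<tau>] by simp
  have pos: "\<forall>\<^sub>F k in sequentially. 0 < \<tau> k"
    using \<tau> by (simp add: filterlim_at_top_dense eventually_gt_at_top filterlim_iff)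
  have inv: "(\<lambda>k. 1 / real (\<tau> k)) \<longlonglongrightarrow> 0"
    by (rule real_tendsto_divide_at_top[OF tendsto_const r\<tau>])
  have "(\<lambda>k. real (\<tau> k div K) / real (\<tau> k) - 1 / real K) \<longlonglongrightarrow> 0"
  proof (rule Lim_null_comparison[OF _ inv])
    show "\<forall>\<^sub>F k in sequentially. norm (real (\<tau> k div K) / real (\<tau> k) - 1 / real K) \<le> 1 / real (\<tau> k)"
      using pos
    proof eventually_elim
      case (elim k)
      have "real (\<tau> k) = real (\<tau> k div K) * real K + real (\<tau> k mod K)"
        by (metis div_mult_mod_eq of_nat_add of_nat_mult)
      then have "real (\<tau> k div K) / real (\<tau> k) - 1 / real K = - (real (\<tau> k mod K) / real K) / real (\<tau> k)"
        using elim K by (simp add: field_simps)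
      moreover have "real (\<tau> k mod K) / real K \<le> 1"
        using K by (simp add: less_imp_le)
      ultimately show ?case
        using divide_right_mono[of "real (\<tau> k mod K) / real K" 1 "real (\<tau> k)"] by simp
    qed
  qed
  then have L: "(\<lambda>k. real (\<tau> k div K) / real (\<tau> k)) \<longlonglongrightarrow> 1 / real K"
    by (simp add: LIM_zero_iff)
  have "(\<lambda>k. gate_count K (\<tau> k) (X k) r / real (\<tau> k)
      - real (\<tau> k div K) / real (\<tau> k) * gating_freq K (\<tau> k) (X k) r) \<longlonglongrightarrow> 0"
  proof (rule Lim_null_comparison[OF _ inv])
    show "\<forall>\<^sub>F k in sequentially. norm (gate_count K (\<tau> k) (X k) r / real (\<tau> k)
      - real (\<tau> k div K) / real (\<tau> k) * gating_freq K (\<tau> k) (X k) r) \<le> 1 / real (\<tau> k)"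
      using pos
    proof eventually_elim
      case (elim k)
      have "gate_count K (\<tau> k) (X k) r / real (\<tau> k) - real (\<tau> k div K) / real (\<tau> k) * gating_freq K (\<tau> k) (X k) r
          = (gate_count K (\<tau> k) (X k) r - real (\<tau> k div K) * gating_freq K (\<tau> k) (X k) r) / real (\<tau> k)"
        by (simp add: diff_divide_distrib)
      then show ?case
        using gate_count_gating_freq[OF K r, of "\<tau> k" "X k"] by (simp add: divide_right_mono)
    qed
  qed
  from tendsto_add[OF this tendsto_mult[OF L f]] show ?thesis
    by simp
qed

section \<open>Local alternatives: contiguity, tightness and the central limit theorem\<close>

locale gated_model =
  fixes K :: nat and \<kappa> :: "nat \<Rightarrow> (bool \<times> bool) list \<Rightarrow> bool \<Rightarrow> real"
    and lam :: "nat \<Rightarrow> real^'d \<Rightarrow> real" and \<Theta> :: "(real^'d) set"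
    and Q :: "real^'d \<Rightarrow> nat \<Rightarrow> (bool \<times> bool) list measure"
    and \<theta>\<^sub>0 :: "real^'d" and g :: "nat \<Rightarrow> real"
  assumes K: "1 \<le> K"
    and \<kappa>_nonneg: "\<And>t xs v. 0 \<le> \<kappa> t xs v"
    and \<kappa>_sum: "\<And>t xs. length xs = t \<Longrightarrow> \<kappa> t xs True + \<kappa> t xs False = 1"
    and prob_Q: "\<And>\<theta> T. \<theta> \<in> \<Theta> \<Longrightarrow> prob_space (Q \<theta> T)"
    and space_Q: "\<And>\<theta> T. space (Q \<theta> T) = {xs. length xs = T}"
    and sets_Q: "\<And>\<theta> T. sets (Q \<theta> T) = Pow {xs. length xs = T}"
    and law: "\<And>\<theta> T xs. \<theta> \<in> \<Theta> \<Longrightarrow> length xs = T \<Longrightarrow>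
      measure (Q \<theta> T) {xs} = path_weight \<kappa> (\<lambda>t. event_prob lam (t mod K) \<theta>) xs"
    and interior: "\<theta>\<^sub>0 \<in> interior \<Theta>"
    and lam_pos: "\<And>r \<theta>. r < K \<Longrightarrow> \<theta> \<in> \<Theta> \<Longrightarrow> 0 < lam r \<theta>"
    and gderiv: "\<And>r \<theta>. r < K \<Longrightarrow> \<theta> \<in> \<Theta> \<Longrightarrow> GDERIV (lam r) \<theta> :> grad (lam r) \<theta>"
    and isCont_grad: "\<And>r. r < K \<Longrightarrow> isCont (grad (lam r)) \<theta>\<^sub>0"
    and freq: "\<And>r. r < K \<Longrightarrow> vanishing_in_prob (Q \<theta>\<^sub>0) (\<lambda>T xs. gating_freq K T xs r - g r)"
begin

abbreviation "q r \<theta> \<equiv> event_prob lam r \<theta>"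
abbreviation "weight \<theta> \<equiv> path_weight \<kappa> (\<lambda>t. q (t mod K) \<theta>)"
abbreviation "loc h T \<equiv> \<theta>\<^sub>0 + h /\<^sub>R sqrt (real T)"
abbreviation "M h T \<equiv> Q (loc h T) T"

text \<open>Centred at the local parameter and not at \<open>\<theta>\<^sub>0\<close>: under
  \<open>M h T\<close> every open gate then contributes an increment of conditional mean exactly
  0.\<close>

definition resid :: "real^'d \<Rightarrow> nat \<Rightarrow> (bool \<times> bool) list \<Rightarrow> nat \<Rightarrow> real" where
  "resid h T xs r = (event_count K T xs r - q r (loc h T) * gate_count K T xs r) / sqrt (real T)"

lemma \<theta>\<^sub>0: "\<theta>\<^sub>0 \<in> \<Theta>"
  using interior interior_subset by blast

lemma mod_K: "t mod K < K"
  using K by simp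

lemma q01: "r < K \<Longrightarrow> \<theta> \<in> \<Theta> \<Longrightarrow> 0 < q r \<theta> \<and> q r \<theta> < 1"
  using lam_pos[of r \<theta>] by (simp add: event_prob_def)

lemma weight_nonneg: "\<theta> \<in> \<Theta> \<Longrightarrow> 0 \<le> weight \<theta> xs"
  using q01[OF mod_K] by (intro path_weight_nonneg \<kappa>_nonneg) (auto intro: less_imp_le)

lemma sqrt_at_top: "filterlim (\<lambda>T. sqrt (real T)) at_top sequentially"
  by (rule filterlim_compose[OF sqrt_at_top filterlim_real_sequentially])

lemma loc_tendsto: "loc h \<longlonglongrightarrow> \<theta>\<^sub>0"
proof -
  have "(\<lambda>T. inverse (sqrt (real T))) \<longlonglongrightarrow> 0"
    by (rule tendsto_inverse_0_at_top[OF sqrt_at_top])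
  then have "(\<lambda>T. \<theta>\<^sub>0 + h /\<^sub>R sqrt (real T)) \<longlonglongrightarrow> \<theta>\<^sub>0 + 0 *\<^sub>R h"
    by (intro tendsto_intros)
  then show ?thesis by simp
qed

lemma loc_in: "\<forall>\<^sub>F T in sequentially. loc h T \<in> \<Theta>"
proof -
  have "\<forall>\<^sub>F T in sequentially. loc h T \<in> interior \<Theta>"
    using loc_tendsto interior by (rule topological_tendstoD[OF _ open_interior])
  then show ?thesis
    by eventually_elim (use interior_subset in blast)
qed

lemma loc_scaled_bound: "norm (sqrt (real T) *\<^sub>R (loc h T - \<theta>\<^sub>0)) \<le> norm h"
  \<comment> \<open>At \<open>T = 0\<close> the scaling factor is 0, so the bound holds at every
    index, as the expansions along sequences demand.\<close>
  by (cases "T = 0") simp_all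

lemma discrete_M: "discrete_laws (M h)"
  unfolding discrete_laws_def using loc_in[of h]
  by eventually_elim (simp add: prob_Q space_Q sets_Q finite_length_lists)

lemma expectation_Q:
  fixes F :: "(bool \<times> bool) list \<Rightarrow> 'c::{banach, second_countable_topology}"
  assumes "\<theta> \<in> \<Theta>"
  shows "(\<integral>xs. F xs \<partial>Q \<theta> T) = (\<Sum>xs | length xs = T. weight \<theta> xs *\<^sub>R F xs)"
  by (subst integral_finite_discrete) (simp_all add: prob_Q assms space_Q sets_Q finite_length_lists law)

lemma measure_Q:
  assumes "\<theta> \<in> \<Theta>" "A \<subseteq> {xs. length xs = T}"
  shows "measure (Q \<theta> T) A = (\<Sum>xs\<in>A. weight \<theta> xs)"
proof -
  interpret prob_space "Q \<theta> T"
    by (rule prob_Q) fact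
  have "finite A"
    by (rule finite_subset[OF assms(2) finite_length_lists])
  then have "measure (Q \<theta> T) A = (\<Sum>xs\<in>A. measure (Q \<theta> T) {xs})"
    using assms by (intro finite_measure_eq_sum_singleton) (auto simp: sets_Q)
  also have "\<dots> = (\<Sum>xs\<in>A. weight \<theta> xs)"
    using assms(2) by (intro sum.cong refl law[OF assms(1)]) blast
  finally show ?thesis .
qed

lemma gderiv_q: "r < K \<Longrightarrow> GDERIV (q r) \<theta>\<^sub>0 :> (1 - q r \<theta>\<^sub>0) *\<^sub>R grad (lam r) \<theta>\<^sub>0"
  by (intro GDERIV_event_prob gderiv \<theta>\<^sub>0)

lemma isCont_q: "r < K \<Longrightarrow> isCont (q r) \<theta>\<^sub>0"
  using gderiv_q unfolding gderiv_def by (rule has_derivative_continuous)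

lemma q_expansion:
  assumes "r < K" "filterlim s at_top sequentially" "\<And>k. norm (s k *\<^sub>R (y k - \<theta>\<^sub>0)) \<le> c"
  shows "(\<lambda>k. s k * (q r (y k) - q r \<theta>\<^sub>0)
    - ((1 - q r \<theta>\<^sub>0) *\<^sub>R grad (lam r) \<theta>\<^sub>0) \<bullet> (s k *\<^sub>R (y k - \<theta>\<^sub>0))) \<longlonglongrightarrow> 0"
  by (rule differentiable_expansion[OF gderiv_q[OF assms(1)] assms(2,3)])

text \<open>It makes the chi-square divergence of a single event between the two parameters of order
  \<open>1 / T\<close>, so that \<open>T\<close> time steps accumulate a bounded amount.\<close>

lemma q_loc_square_bounded:
  assumes "r < K"
  shows "\<exists>c\<ge>0. \<forall>\<^sub>F T in sequentially. real T * (q r (loc h T) - q r \<theta>\<^sub>0)\<^sup>2 \<le> c"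
proof -
  let ?v = "(1 - q r \<theta>\<^sub>0) *\<^sub>R grad (lam r) \<theta>\<^sub>0"
  let ?a = "\<lambda>T. sqrt (real T) * (q r (loc h T) - q r \<theta>\<^sub>0)"
  let ?b = "\<lambda>T. ?v \<bullet> (sqrt (real T) *\<^sub>R (loc h T - \<theta>\<^sub>0))"
  have "(\<lambda>T. ?a T - ?b T) \<longlonglongrightarrow> 0"
    by (rule q_expansion[OF assms sqrt_at_top loc_scaled_bound])
  then have "\<forall>\<^sub>F T in sequentially. \<bar>?a T - ?b T\<bar> < 1"
    by (auto simp: tendsto_iff dist_real_def dest: spec[of _ 1])
  then have "\<forall>\<^sub>F T in sequentially. real T * (q r (loc h T) - q r \<theta>\<^sub>0)\<^sup>2 \<le> (1 + norm ?v * norm h)\<^sup>2"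
  proof eventually_elim
    case (elim T)
    have "\<bar>?b T\<bar> \<le> norm ?v * norm (sqrt (real T) *\<^sub>R (loc h T - \<theta>\<^sub>0))"
      by (rule Cauchy_Schwarz_ineq2)
    also have "\<dots> \<le> norm ?v * norm h"
      by (rule mult_left_mono[OF loc_scaled_bound]) simp
    finally have "\<bar>?a T\<bar> \<le> 1 + norm ?v * norm h"
      using elim by linarith
    then have "\<bar>?a T\<bar>\<^sup>2 \<le> (1 + norm ?v * norm h)\<^sup>2"
      by (rule power_mono) simp
    then show ?case
      by (simp add: power_mult_distrib)
  qed
  then show ?thesis
    by (intro exI[of _ "(1 + norm ?v * norm h)\<^sup>2"]) simp
qed

text \<open>The likelihood ratio has bounded second moment, so that the local alternatives are contiguous to
  the law under the true parameter.\<close>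

lemma contiguity:
  "\<exists>C. \<forall>\<^sub>F T in sequentially. \<forall>A m. A \<subseteq> {xs. length xs = T} \<longrightarrow> 0 < m \<longrightarrow>
    measure (M h T) A \<le> m * measure (Q \<theta>\<^sub>0 T) A + C / m"
proof -
  have "\<forall>r\<in>{..<K}. \<exists>c\<ge>0. \<forall>\<^sub>F T in sequentially. real T * (q r (loc h T) - q r \<theta>\<^sub>0)\<^sup>2 \<le> c"
    using q_loc_square_bounded by simp
  from bchoice[OF this] obtain c where
    cc: "\<forall>r\<in>{..<K}. 0 \<le> c r \<and> (\<forall>\<^sub>F T in sequentially. real T * (q r (loc h T) - q r \<theta>\<^sub>0)\<^sup>2 \<le> c r)"
    by blast
  then have c: "\<And>r. r < K \<Longrightarrow> 0 \<le> c r"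
    "\<And>r. r < K \<Longrightarrow> \<forall>\<^sub>F T in sequentially. real T * (q r (loc h T) - q r \<theta>\<^sub>0)\<^sup>2 \<le> c r"
    by simp_all
  let ?v = "\<lambda>r. q r \<theta>\<^sub>0 * (1 - q r \<theta>\<^sub>0)"
  have v: "0 < ?v r" if "r < K" for r
    using q01[OF that \<theta>\<^sub>0] by simp
  \<comment> \<open>A bound, common to all phases, for \<open>T\<close> times the chi-square
    divergence of one event. The constant in the statement will be \<open>exp C\<close>.\<close>
  define C where "C = (\<Sum>r<K. c r / ?v r)"
  have cC: "c r / ?v r \<le> C" if "r < K" for r
    unfolding C_def by (rule member_le_sum) (use that c(1) v in \<open>auto simp: less_imp_le intro!: divide_nonneg_pos\<close>)
  have "\<forall>\<^sub>F T in sequentially. \<forall>r\<in>{..<K}. real T * (q r (loc h T) - q r \<theta>\<^sub>0)\<^sup>2 \<le> c r"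
    using c(2) by (simp add: eventually_ball_finite_distrib)
  with loc_in[of h] eventually_gt_at_top[of 0]
  have "\<forall>\<^sub>F T in sequentially. \<forall>A m. A \<subseteq> {xs. length xs = T} \<longrightarrow> 0 < m \<longrightarrow>
    measure (M h T) A \<le> m * measure (Q \<theta>\<^sub>0 T) A + exp C / m"
  proof eventually_elim
    case (elim T)
    let ?\<theta> = "loc h T"
    \<comment> \<open>\<rho> is the likelihood ratio of one event at an open gate and \<zeta> its
      conditional second moment under \<open>\<theta>\<^sub>0\<close>, namely 1 plus the chi-square
      divergence. Hence the square of \<rho> over \<zeta> has conditional mean 1, and the product of
      at most \<open>T\<close> factors \<zeta>, each at most \<open>exp (C / T)\<close>, stays below
      \<open>exp C\<close>.\<close>
    define \<rho> where "\<rho> = (\<lambda>t y. if y then q (t mod K) ?\<theta> / q (t mod K) \<theta>\<^sub>0 else (1 - q (t mod K) ?\<theta>) / (1 - q (t mod K) \<theta>\<^sub>0))"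
    define \<zeta> where "\<zeta> = (\<lambda>t. 1 + (q (t mod K) ?\<theta> - q (t mod K) \<theta>\<^sub>0)\<^sup>2 / ?v (t mod K))"
    define L where "L = (\<lambda>xs :: (bool \<times> bool) list. \<Prod>t<T. if fst (xs ! t) then \<rho> t (snd (xs ! t)) else 1)"
    define L2 where "L2 = (\<lambda>xs :: (bool \<times> bool) list. \<Prod>t<T. if fst (xs ! t) then (\<rho> t (snd (xs ! t)))\<^sup>2 / \<zeta> t else 1)"
    have \<zeta>1: "1 \<le> \<zeta> t" for t
      using v[OF mod_K, of t] by (simp add: \<zeta>_def)
    then have \<zeta>0: "\<zeta> t \<noteq> 0" for t
      by (metis not_one_le_zero)
    have \<zeta>: "\<zeta> t \<le> exp (C / real T)" for t
    proof -
      let ?r = "t mod K"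
      have "real T * (q ?r ?\<theta> - q ?r \<theta>\<^sub>0)\<^sup>2 / ?v ?r \<le> c ?r / ?v ?r"
        by (intro divide_right_mono elim(3)[rule_format] less_imp_le[OF v[OF mod_K]]) (simp add: mod_K)
      also have "\<dots> \<le> C"
        by (rule cC[OF mod_K])
      finally have "(q ?r ?\<theta> - q ?r \<theta>\<^sub>0)\<^sup>2 / ?v ?r \<le> C / real T"
        using elim(2) by (simp add: field_simps)
      then have "\<zeta> t \<le> 1 + C / real T"
        by (simp add: \<zeta>_def)
      then show ?thesis
        using exp_ge_add_one_self[of "C / real T"] by linarith
    qed
    have sum_L2: "(\<Sum>xs | length xs = T. weight \<theta>\<^sub>0 xs * L2 xs) = 1"
    proof -
      have "q (t mod K) \<theta>\<^sub>0 * ((\<rho> t True)\<^sup>2 / \<zeta> t) + (1 - q (t mod K) \<theta>\<^sub>0) * ((\<rho> t False)\<^sup>2 / \<zeta> t) = 1" for t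
      proof -
        let ?a = "q (t mod K) \<theta>\<^sub>0" and ?b = "q (t mod K) ?\<theta>"
        have a: "0 < ?a" "?a < 1"
          using q01[OF mod_K \<theta>\<^sub>0] by auto
        have "?a * (?b / ?a)\<^sup>2 + (1 - ?a) * ((1 - ?b) / (1 - ?a))\<^sup>2 = ?b\<^sup>2 / ?a + (1 - ?b)\<^sup>2 / (1 - ?a)"
          using a by (simp add: power2_eq_square)
        also have "\<dots> = 1 + (?b - ?a)\<^sup>2 / (?a * (1 - ?a))"
          using a by (simp add: divide_simps) (simp add: power2_eq_square algebra_simps)
        finally have "?a * (\<rho> t True)\<^sup>2 + (1 - ?a) * (\<rho> t False)\<^sup>2 = \<zeta> t"
          by (simp add: \<rho>_def \<zeta>_def)
        then have "(?a * (\<rho> t True)\<^sup>2 + (1 - ?a) * (\<rho> t False)\<^sup>2) / \<zeta> t = 1"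
          using \<zeta>1[of t] by simp
        then show ?thesis
          by (simp add: add_divide_distrib)
      qed
      then show ?thesis
        using sum_path_weight[where \<kappa> = \<kappa> and T = T and q = "\<lambda>t. q (t mod K) \<theta>\<^sub>0"
            and m = "\<lambda>t y. (\<rho> t y)\<^sup>2 / \<zeta> t", OF \<kappa>_sum]
        by (simp add: L2_def)
    qed
    have LL: "(L xs)\<^sup>2 \<le> exp C * L2 xs" and L2_nonneg: "0 \<le> L2 xs" for xs
    proof -
      have "(L xs)\<^sup>2 = (\<Prod>t<T. if fst (xs ! t) then \<zeta> t else 1) * L2 xs"
        unfolding L_def L2_def prod_power_distrib prod.distrib[symmetric]
        by (rule prod.cong) (auto simp: \<zeta>0)
      show "0 \<le> L2 xs"
        unfolding L2_def using order_trans[OF zero_le_one \<zeta>1] by (intro prod_nonneg) simp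
      moreover have "(\<Prod>t<T. if fst (xs ! t) then \<zeta> t else 1) \<le> (\<Prod>t<T. exp (C / real T))"
      proof (rule prod_mono)
        fix t
        show "0 \<le> (if fst (xs ! t) then \<zeta> t else 1) \<and> (if fst (xs ! t) then \<zeta> t else 1) \<le> exp (C / real T)"
          using order_trans[OF \<zeta>1[of t] \<zeta>[of t]] \<zeta>[of t] \<zeta>1[of t] by (simp del: one_le_exp_iff)
      qed
      moreover have "(\<Prod>t<T. exp (C / real T)) = exp C"
        using elim(2) by (simp add: exp_of_nat_mult[symmetric])
      ultimately show "(L xs)\<^sup>2 \<le> exp C * L2 xs"
        using \<open>(L xs)\<^sup>2 = _\<close> by (simp add: mult_right_mono)
    qed
    have wL: "weight ?\<theta> xs = weight \<theta>\<^sub>0 xs * L xs" if "length xs = T" for xs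
      unfolding path_weight_def L_def that prod.distrib[symmetric]
    proof (rule prod.cong[OF refl])
      fix t
      show "\<kappa> t (take t xs) (fst (xs ! t)) * emission (q (t mod K) ?\<theta>) (xs ! t)
        = \<kappa> t (take t xs) (fst (xs ! t)) * emission (q (t mod K) \<theta>\<^sub>0) (xs ! t)
            * (if fst (xs ! t) then \<rho> t (snd (xs ! t)) else 1)"
        using q01[OF mod_K \<theta>\<^sub>0, of t] by (auto simp: emission_def \<rho>_def)
    qed
    show ?case
    proof (intro allI impI)
      fix A :: "(bool \<times> bool) list set" and m :: real
      assume A: "A \<subseteq> {xs. length xs = T}" and m: "0 < m"
      have fin: "finite A"
        by (rule finite_subset[OF A finite_length_lists])
      have "measure (M h T) A = (\<Sum>xs\<in>A. weight \<theta>\<^sub>0 xs * L xs)"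
        unfolding measure_Q[OF elim(1) A] using A by (intro sum.cong refl wL) blast
      also have "\<dots> \<le> (\<Sum>xs\<in>A. m * weight \<theta>\<^sub>0 xs + exp C / m * (weight \<theta>\<^sub>0 xs * L2 xs))"
      proof (rule sum_mono)
        fix xs
        \<comment> \<open>Truncation at level \<open>m\<close>: a likelihood ratio above
          \<open>m\<close> is at most its square over \<open>m\<close>.\<close>
        have "L xs \<le> m + (L xs)\<^sup>2 / m"
        proof -
          have "0 \<le> (L xs)\<^sup>2 / m"
            using m by simp
          moreover have "L xs \<le> (L xs)\<^sup>2 / m" if "m \<le> L xs"
            using m that mult_right_mono[OF that, of "L xs"] by (simp add: le_divide_eq power2_eq_square mult.commute)
          ultimately show ?thesis
            using m by linarith
        qed
        also have "\<dots> \<le> m + exp C * L2 xs / m"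
          using LL m by (intro add_left_mono divide_right_mono) auto
        finally have "weight \<theta>\<^sub>0 xs * L xs \<le> weight \<theta>\<^sub>0 xs * (m + exp C * L2 xs / m)"
          by (rule mult_left_mono[OF _ weight_nonneg[OF \<theta>\<^sub>0]])
        then show "weight \<theta>\<^sub>0 xs * L xs \<le> m * weight \<theta>\<^sub>0 xs + exp C / m * (weight \<theta>\<^sub>0 xs * L2 xs)"
          by (simp add: algebra_simps)
      qed
      also have "\<dots> = m * (\<Sum>xs\<in>A. weight \<theta>\<^sub>0 xs) + exp C / m * (\<Sum>xs\<in>A. weight \<theta>\<^sub>0 xs * L2 xs)"
        by (simp add: sum.distrib sum_distrib_left)
      also have "\<dots> \<le> m * measure (Q \<theta>\<^sub>0 T) A + exp C / m * 1"
      proof (intro add_mono mult_left_mono)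
        show "(\<Sum>xs\<in>A. weight \<theta>\<^sub>0 xs) \<le> measure (Q \<theta>\<^sub>0 T) A"
          by (simp add: measure_Q[OF \<theta>\<^sub>0 A])
        have "(\<Sum>xs\<in>A. weight \<theta>\<^sub>0 xs * L2 xs) \<le> (\<Sum>xs | length xs = T. weight \<theta>\<^sub>0 xs * L2 xs)"
          by (rule sum_mono2[OF finite_length_lists A]) (simp add: weight_nonneg[OF \<theta>\<^sub>0] L2_nonneg)
        then show "(\<Sum>xs\<in>A. weight \<theta>\<^sub>0 xs * L2 xs) \<le> 1"
          using sum_L2 by simp
      qed (use m in auto)
      finally show "measure (M h T) A \<le> m * measure (Q \<theta>\<^sub>0 T) A + exp C / m"
        by simp
    qed
  qed
  then show ?thesis by blast
qed

lemma contiguity_small: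
  assumes "0 < e"
  shows "\<exists>d>0. \<forall>\<^sub>F T in sequentially. \<forall>A. A \<subseteq> {xs. length xs = T} \<longrightarrow>
    measure (Q \<theta>\<^sub>0 T) A \<le> d \<longrightarrow> measure (M h T) A \<le> e"
proof -
  obtain C where C: "\<forall>\<^sub>F T in sequentially. \<forall>A m. A \<subseteq> {xs. length xs = T} \<longrightarrow> 0 < m \<longrightarrow>
    measure (M h T) A \<le> m * measure (Q \<theta>\<^sub>0 T) A + C / m"
    using contiguity by blast
  \<comment> \<open>Large enough for \<open>C / m\<close> to take at most half of \<open>e\<close>;
    the sign of \<open>C\<close> is not known, hence the absolute value. The other half determines
    the threshold \<open>e / (2 * m)\<close> under \<open>\<theta>\<^sub>0\<close>.\<close>
  define m where "m = 2 * (\<bar>C\<bar> + 1) / e"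
  have m: "0 < m"
    using assms by (simp add: m_def add_nonneg_pos)
  have "C / m \<le> (\<bar>C\<bar> + 1) / m"
    using m by (intro divide_right_mono) auto
  also have "\<dots> = e / 2"
    using assms by (simp add: m_def field_simps)
  finally have Cm: "C / m \<le> e / 2" .
  show ?thesis
  proof (intro exI[of _ "e / (2 * m)"] conjI)
    show "0 < e / (2 * m)"
      using assms m by simp
    show "\<forall>\<^sub>F T in sequentially. \<forall>A. A \<subseteq> {xs. length xs = T} \<longrightarrow>
      measure (Q \<theta>\<^sub>0 T) A \<le> e / (2 * m) \<longrightarrow> measure (M h T) A \<le> e"
      using C
    proof eventually_elim
      case (elim T)
      show ?case
      proof (intro allI impI)
        fix A :: "(bool \<times> bool) list set"
        assume A: "A \<subseteq> {xs. length xs = T}" "measure (Q \<theta>\<^sub>0 T) A \<le> e / (2 * m)"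
        have "measure (M h T) A \<le> m * measure (Q \<theta>\<^sub>0 T) A + C / m"
          using elim A m by blast
        also have "m * measure (Q \<theta>\<^sub>0 T) A \<le> m * (e / (2 * m))"
          using A m by (intro mult_left_mono) auto
        also have "m * (e / (2 * m)) = e / 2"
          using m by simp
        finally show "measure (M h T) A \<le> e"
          using Cm by linarith
      qed
    qed
  qed
qed

text \<open>It supplies the limits of the gating frequencies under the moving local parameter, where
  the model itself only speaks about fixed parameters.\<close>

lemma vanishing_in_prob_local:
  assumes "vanishing_in_prob (Q \<theta>\<^sub>0) X"
  shows "vanishing_in_prob (M h) X"
  unfolding vanishing_in_prob_def
proof (intro allI impI tendstoI)
  fix a e :: real assume "0 < a" "0 < e"
  then have "0 < e / 2" by simp
  then obtain d where "0 < d" and d: "\<forall>\<^sub>F T in sequentially. \<forall>A. A \<subseteq> {xs. length xs = T} \<longrightarrow>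
    measure (Q \<theta>\<^sub>0 T) A \<le> d \<longrightarrow> measure (M h T) A \<le> e / 2"
    using contiguity_small by blast
  have "\<forall>\<^sub>F T in sequentially. measure (Q \<theta>\<^sub>0 T) {x \<in> space (Q \<theta>\<^sub>0 T). \<bar>X T x\<bar> > a} < d"
    using assms \<open>0 < a\<close> \<open>0 < d\<close> unfolding vanishing_in_prob_def by (intro order_tendstoD(2)) auto
  with d show "\<forall>\<^sub>F T in sequentially. dist (measure (M h T) {x \<in> space (M h T). \<bar>X T x\<bar> > a}) 0 < e"
  proof eventually_elim
    case (elim T)
    have "{xs. length xs = T \<and> \<bar>X T xs\<bar> > a} \<subseteq> {xs. length xs = T}"
      by auto
    from elim(1)[rule_format, OF this] elim(2)
    have "measure (M h T) {xs. length xs = T \<and> \<bar>X T xs\<bar> > a} \<le> e / 2"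
      by (simp add: space_Q)
    then show ?case
      using \<open>0 < e\<close> by (simp add: space_Q dist_real_def)
  qed
qed

lemma bounded_in_prob_local:
  assumes "bounded_in_prob (Q \<theta>\<^sub>0) X"
  shows "bounded_in_prob (M h) X"
  unfolding bounded_in_prob_def
proof (intro allI impI)
  fix e :: real assume "0 < e"
  then obtain d where "0 < d" and d: "\<forall>\<^sub>F T in sequentially. \<forall>A. A \<subseteq> {xs. length xs = T} \<longrightarrow>
    measure (Q \<theta>\<^sub>0 T) A \<le> d \<longrightarrow> measure (M h T) A \<le> e"
    using contiguity_small by blast
  obtain C where "\<forall>\<^sub>F T in sequentially. measure (Q \<theta>\<^sub>0 T) {x \<in> space (Q \<theta>\<^sub>0 T). norm (X T x) > C} \<le> d"
    using assms \<open>0 < d\<close> unfolding bounded_in_prob_def by blast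
  with d have "\<forall>\<^sub>F T in sequentially. measure (M h T) {x \<in> space (M h T). norm (X T x) > C} \<le> e"
  proof eventually_elim
    case (elim T)
    have "{xs. length xs = T \<and> norm (X T xs) > C} \<subseteq> {xs. length xs = T}"
      by auto
    from elim(1)[rule_format, OF this] elim(2) show ?case
      by (simp add: space_Q)
  qed
  then show "\<exists>C. \<forall>\<^sub>F T in sequentially. measure (M h T) {x \<in> space (M h T). norm (X T x) > C} \<le> e" ..
qed

lemma sum_resid:
  "(\<Sum>r<K. b r * resid h T xs r)
    = (\<Sum>t<T. b (t mod K) / sqrt (real T) * (of_bool (snd (xs ! t)) - q (t mod K) (loc h T) * of_bool (fst (xs ! t))))"
  using sum_counts[OF K, of "\<lambda>r. b r / sqrt (real T)" T xs "\<lambda>r. q r (loc h T)"]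
  by (simp add: resid_def)

text \<open>The product of the conditional moment generating functions is random through the gates,
  but each factor is at most 1 plus the square of \<open>z t\<close>, hence at most
  \<open>exp (1 / T)\<close>, so the product never exceeds \<open>exp 1\<close>. The two signs of
  \<open>s\<close> give the two tails.\<close>

lemma exp_resid_expectation:
  assumes loc: "loc h T \<in> \<Theta>" and T: "0 < T" and r: "r < K" and s: "\<bar>s\<bar> = 1"
  shows "(\<Sum>xs | length xs = T. weight (loc h T) xs * exp (s * resid h T xs r)) \<le> exp 1"
proof -
  let ?\<theta> = "loc h T"
  define z where "z = (\<lambda>t. if t mod K = r then s / sqrt (real T) else 0)"
  define \<psi> where "\<psi> = (\<lambda>t. q (t mod K) ?\<theta> * exp (z t * (1 - q (t mod K) ?\<theta>))
    + (1 - q (t mod K) ?\<theta>) * exp (- (z t * q (t mod K) ?\<theta>)))"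
  have q: "0 < q (t mod K) ?\<theta>" "q (t mod K) ?\<theta> < 1" for t
    using q01[OF mod_K loc] by auto
  have \<psi>_pos: "0 < \<psi> t" for t
    unfolding \<psi>_def using q[of t] by (intro add_pos_pos mult_pos_pos) auto
  have s2: "s\<^sup>2 = 1"
    using s by (metis one_power2 power2_abs)
  have z2: "(z t)\<^sup>2 \<le> 1 / real T" for t
    using T s2 by (simp add: z_def power_divide)
  have \<psi>_le: "\<psi> t \<le> exp (1 / real T)" for t
  proof -
    let ?q = "q (t mod K) ?\<theta>"
    have "1 / real T \<le> 1"
      using T by simp
    then have "(z t)\<^sup>2 \<le> 1"
      using z2[of t] by linarith
    then have z1: "\<bar>z t\<bar> \<le> 1"
      by (simp add: abs_square_le_1)
    have zq: "\<bar>z t * (1 - ?q)\<bar> \<le> 1" "\<bar>- (z t * ?q)\<bar> \<le> 1"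
      using z1 q[of t] by (auto simp: abs_mult intro!: mult_le_one)
    have "\<psi> t \<le> ?q * (1 + z t * (1 - ?q) + (z t * (1 - ?q))\<^sup>2) + (1 - ?q) * (1 + - (z t * ?q) + (- (z t * ?q))\<^sup>2)"
      unfolding \<psi>_def using q[of t] by (intro add_mono mult_left_mono exp_le_quadratic zq) simp_all
    also have "\<dots> = 1 + (z t)\<^sup>2 * (?q * (1 - ?q))"
      by (simp add: power2_eq_square algebra_simps)
    also have "\<dots> \<le> 1 + (z t)\<^sup>2 * 1"
      using q[of t] by (intro add_left_mono mult_left_mono mult_le_one) auto
    also have "\<dots> \<le> 1 + 1 / real T"
      using z2[of t] by simp
    also have "\<dots> \<le> exp (1 / real T)"
      by (rule exp_ge_add_one_self)
    finally show ?thesis .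
  qed
  let ?P = "\<lambda>xs. \<Prod>t<T. if fst (xs ! t) then \<psi> t else 1"
  have P_pos: "0 < ?P xs" for xs :: "(bool \<times> bool) list"
    using \<psi>_pos by (intro prod_pos) auto
  have P_le: "?P xs \<le> exp 1" for xs :: "(bool \<times> bool) list"
  proof -
    have "?P xs \<le> (\<Prod>t<T. exp (1 / real T))"
      using \<psi>_le \<psi>_pos by (intro prod_mono) (auto simp: less_imp_le)
    also have "\<dots> = exp 1"
      using T by (simp add: exp_of_nat_mult[symmetric])
    finally show ?thesis .
  qed
  have exponent: "s * resid h T xs r = (\<Sum>t<T. z t * (of_bool (snd (xs ! t)) - q (t mod K) ?\<theta> * of_bool (fst (xs ! t))))" for xs
  proof -
    have "s * resid h T xs r = (\<Sum>r'<K. (if r' = r then s else 0) * resid h T xs r')"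
      using r by (simp add: if_distrib[of "\<lambda>x. x * _"] cong: if_cong)
    also have "\<dots> = (\<Sum>t<T. z t * (of_bool (snd (xs ! t)) - q (t mod K) ?\<theta> * of_bool (fst (xs ! t))))"
      unfolding sum_resid by (rule sum.cong) (simp_all add: z_def)
    finally show ?thesis .
  qed
  have \<psi>_eq: "q (t mod K) ?\<theta> * exp (z t * (1 - q (t mod K) ?\<theta>))
    + (1 - q (t mod K) ?\<theta>) * exp (- (z t * q (t mod K) ?\<theta>)) = \<psi> t" for t
    by (simp only: \<psi>_def)
  note main = sum_path_weight_exp[where \<kappa> = \<kappa> and q = "\<lambda>t. q (t mod K) ?\<theta>" and T = T and z = z,
      OF \<kappa>_sum, unfolded of_real_eq_id id_apply \<psi>_eq]
  have "(\<Sum>xs | length xs = T. weight ?\<theta> xs * exp (s * resid h T xs r))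
      \<le> (\<Sum>xs | length xs = T. exp 1 * (weight ?\<theta> xs * (exp (s * resid h T xs r) / ?P xs)))"
  proof (rule sum_mono)
    fix xs
    have "exp (s * resid h T xs r) \<le> exp 1 * (exp (s * resid h T xs r) / ?P xs)"
      using P_pos[of xs] P_le[of xs] by (simp add: le_divide_eq)
    then have "weight ?\<theta> xs * exp (s * resid h T xs r) \<le> weight ?\<theta> xs * (exp 1 * (exp (s * resid h T xs r) / ?P xs))"
      by (rule mult_left_mono[OF _ weight_nonneg[OF loc]])
    then show "weight ?\<theta> xs * exp (s * resid h T xs r) \<le> exp 1 * (weight ?\<theta> xs * (exp (s * resid h T xs r) / ?P xs))"
      by (simp only: mult.left_commute)
  qed
  also have "\<dots> = exp 1 * (\<Sum>xs | length xs = T. weight ?\<theta> xs * (exp (s * resid h T xs r) / ?P xs))"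
    by (simp only: sum_distrib_left)
  also have "(\<Sum>xs | length xs = T. weight ?\<theta> xs * (exp (s * resid h T xs r) / ?P xs)) = 1"
    unfolding exponent by (rule main) (assumption, rule less_imp_neq[OF \<psi>_pos, symmetric])
  finally show ?thesis by simp
qed

lemma resid_bounded:
  assumes r: "r < K"
  shows "bounded_in_prob (M h) (\<lambda>T xs. resid h T xs r)"
  unfolding bounded_in_prob_def
proof (intro allI impI)
  fix e :: real assume "0 < e"
  \<comment> \<open>Chosen so that the exponential Markov bound
    \<open>exp (- c) * (2 * exp 1)\<close>, with one summand for each tail, equals
    \<open>e\<close>.\<close>
  define c where "c = 1 + ln (2 / e)"
  have c: "exp (- c) * (2 * exp 1) = e"
    using \<open>0 < e\<close> by (simp add: c_def exp_diff exp_minus exp_add)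
  have "\<forall>\<^sub>F T in sequentially. measure (M h T) {xs \<in> space (M h T). norm (resid h T xs r) > c} \<le> e"
    using loc_in[of h] eventually_gt_at_top[of 0]
  proof eventually_elim
    case (elim T)
    let ?A = "{xs \<in> space (M h T). norm (resid h T xs r) > c}"
    let ?f = "\<lambda>xs. exp (1 * resid h T xs r) + exp (- 1 * resid h T xs r)"
    have A: "?A \<subseteq> {xs. length xs = T}"
      by (auto simp: space_Q)
    have "measure (M h T) ?A = (\<Sum>xs\<in>?A. weight (loc h T) xs)"
      by (rule measure_Q[OF elim(1) A])
    also have "\<dots> \<le> (\<Sum>xs\<in>?A. exp (- c) * (weight (loc h T) xs * ?f xs))"
    proof (rule sum_mono)
      fix xs assume "xs \<in> ?A"
      then have "c \<le> resid h T xs r \<or> c \<le> - resid h T xs r"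
        by auto
      then have "exp c \<le> ?f xs"
      proof
        assume "c \<le> resid h T xs r"
        then have "exp c \<le> exp (1 * resid h T xs r)" by simp
        then show ?thesis by (simp add: add_increasing2)
      next
        assume "c \<le> - resid h T xs r"
        then have "exp c \<le> exp (- 1 * resid h T xs r)" by simp
        then show ?thesis by (simp add: add_increasing)
      qed
      then have "1 \<le> exp (- c) * ?f xs"
        by (simp add: exp_minus field_simps)
      from mult_left_mono[OF this weight_nonneg[OF elim(1)]]
      show "weight (loc h T) xs \<le> exp (- c) * (weight (loc h T) xs * ?f xs)"
        by (simp only: mult_1_right mult.left_commute)
    qed
    also have "\<dots> \<le> (\<Sum>xs | length xs = T. exp (- c) * (weight (loc h T) xs * ?f xs))"
      by (rule sum_mono2[OF finite_length_lists A])
         (intro mult_nonneg_nonneg add_nonneg_nonneg weight_nonneg[OF elim(1)] exp_ge_zero)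
    also have "\<dots> = exp (- c) * ((\<Sum>xs | length xs = T. weight (loc h T) xs * exp (1 * resid h T xs r))
        + (\<Sum>xs | length xs = T. weight (loc h T) xs * exp (- 1 * resid h T xs r)))"
      by (simp only: sum_distrib_left[symmetric] distrib_left sum.distrib)
    also have "\<dots> \<le> exp (- c) * (exp 1 + exp 1)"
      by (intro mult_left_mono add_mono exp_resid_expectation elim r) auto
    also have "\<dots> = e"
      using c by simp
    finally show ?case .
  qed
  then show "\<exists>C. \<forall>\<^sub>F T in sequentially. measure (M h T) {xs \<in> space (M h T). norm (resid h T xs r) > C} \<le> e" ..
qed

lemma frequency_vanishing:
  "vanishing_in_prob (M h) (\<lambda>T xs. \<Sum>r<K. \<bar>gating_freq K T xs r - g r\<bar>)"
  by (rule vanishing_in_prob_sum[OF discrete_M]) (auto intro: vanishing_in_prob_local freq)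

lemma gating_freq_tendsto:
  assumes "(\<lambda>k. \<Sum>r<K. \<bar>gating_freq K (\<tau> k) (X k) r - g r\<bar>) \<longlonglongrightarrow> 0" "r < K"
  shows "(\<lambda>k. gating_freq K (\<tau> k) (X k) r) \<longlonglongrightarrow> g r"
proof -
  have "(\<lambda>k. gating_freq K (\<tau> k) (X k) r - g r) \<longlonglongrightarrow> 0"
  proof (rule Lim_null_comparison[OF _ assms(1)])
    show "\<forall>\<^sub>F k in sequentially. norm (gating_freq K (\<tau> k) (X k) r - g r) \<le> (\<Sum>r<K. \<bar>gating_freq K (\<tau> k) (X k) r - g r\<bar>)"
      using assms(2) by (intro always_eventually allI) (auto intro: member_le_sum[of r "{..<K}" "\<lambda>r. \<bar>gating_freq K (\<tau> _) (X _) r - g r\<bar>"])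
  qed
  then show ?thesis
    by (simp add: LIM_zero_iff)
qed

lemma q_loc_tendsto:
  assumes "r < K" "filterlim \<tau> sequentially sequentially"
  shows "(\<lambda>k. q r (loc h (\<tau> k))) \<longlonglongrightarrow> q r \<theta>\<^sub>0"
  by (rule isCont_tendsto_compose[OF isCont_q[OF assms(1)] filterlim_compose[OF loc_tendsto assms(2)]])

definition limit_var :: "(nat \<Rightarrow> real) \<Rightarrow> real" where
  "limit_var b = (\<Sum>r<K. g r / real K * (q r \<theta>\<^sub>0 * (1 - q r \<theta>\<^sub>0)) * (b r)\<^sup>2)"

text \<open>The sum over time of the conditional variances of the increments of the combination of
  residuals with coefficients \<open>b\<close>. It is a function of the gates alone, and
  \<open>limit_var b\<close> is its limit in probability.\<close>

definition cond_var :: "real^'d \<Rightarrow> (nat \<Rightarrow> real) \<Rightarrow> nat \<Rightarrow> (bool \<times> bool) list \<Rightarrow> real" where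
  "cond_var h b T xs = (\<Sum>r<K. gate_count K T xs r / real T * (q r (loc h T) * (1 - q r (loc h T))) * (b r)\<^sup>2)"

lemma cond_var_eq:
  "cond_var h b T xs = (\<Sum>t<T. if fst (xs ! t) then (b (t mod K))\<^sup>2 * (q (t mod K) (loc h T) * (1 - q (t mod K) (loc h T))) / real T else 0)"
proof -
  let ?c = "\<lambda>r. (b r)\<^sup>2 * (q r (loc h T) * (1 - q r (loc h T))) / real T"
  \<comment> \<open>Gate counts are isolated as the difference of two centred counts, with centring
    constants 0 and 1, so that the regrouping by phase applies to each.\<close>
  have diff: "c * (E - 0 * N) - c * (E - 1 * N) = c * N" for c E N :: real
    by (simp add: right_diff_distrib)
  have "cond_var h b T xs = (\<Sum>r<K. ?c r * (event_count K T xs r - 0 * gate_count K T xs r))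
      - (\<Sum>r<K. ?c r * (event_count K T xs r - 1 * gate_count K T xs r))"
    unfolding sum_subtractf[symmetric] diff cond_var_def by (simp add: mult_ac)
  also have "\<dots> = (\<Sum>t<T. ?c (t mod K) * of_bool (fst (xs ! t)))"
    unfolding sum_counts[OF K, of ?c T xs "\<lambda>_. 0"] sum_counts[OF K, of ?c T xs "\<lambda>_. 1"]
    by (simp only: sum_subtractf[symmetric] right_diff_distrib[symmetric]) simp
  also have "\<dots> = (\<Sum>t<T. if fst (xs ! t) then ?c (t mod K) else 0)"
    by (rule sum.cong) auto
  finally show ?thesis .
qed

lemma cond_var_vanishing:
  "vanishing_in_prob (M h) (\<lambda>T xs. exp (- cond_var h b T xs / 2) - exp (- limit_var b / 2))"
proof (rule vanishing_in_probI_sequences[OF discrete_M bounded_in_prob_zero frequency_vanishing])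
  fix \<tau> X
  assume \<tau>: "filterlim \<tau> sequentially sequentially"
    and X: "(\<lambda>k. \<Sum>r<K. \<bar>gating_freq K (\<tau> k) (X k) r - g r\<bar>) \<longlonglongrightarrow> 0"
  have "(\<lambda>k. cond_var h b (\<tau> k) (X k)) \<longlonglongrightarrow> limit_var b"
    unfolding cond_var_def limit_var_def
    by (intro tendsto_sum tendsto_mult tendsto_diff tendsto_const gate_count_limit[OF K _ \<tau>] gating_freq_tendsto[OF X] q_loc_tendsto[OF _ \<tau>]) auto
  then have "(\<lambda>k. exp (- cond_var h b (\<tau> k) (X k) / 2) - exp (- limit_var b / 2)) \<longlonglongrightarrow> exp (- limit_var b / 2) - exp (- limit_var b / 2)"
    by (intro tendsto_intros) auto
  then show "(\<lambda>k. exp (- cond_var h b (\<tau> k) (X k) / 2) - exp (- limit_var b / 2)) \<longlonglongrightarrow> 0"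
    by simp
qed

text \<open>Dividing by the product of the conditional characteristic functions gives an identity without any error
  term; the denominator converges in probability since it depends on the gates only.\<close>

lemma char_resid:
  "(\<lambda>T. \<integral>xs. iexp (\<Sum>r<K. b r * resid h T xs r) \<partial>M h T) \<longlonglongrightarrow> of_real (exp (- limit_var b / 2))"
proof -
  define B where "B = (\<Sum>r<K. \<bar>b r\<bar>)"
  have bB: "\<bar>b r\<bar> \<le> B" if "r < K" for r
    unfolding B_def by (rule member_le_sum) (use that in auto)
  have "0 \<le> B"
    unfolding B_def by (simp add: sum_nonneg)
  \<comment> \<open>The conditional variance is at most the square of \<open>B\<close>, so its
    Gaussian factor is at least \<open>2 * \<eta>\<close>. Once \<delta> is below \<eta>, the
    product of conditional characteristic functions keeps modulus at least \<eta> and may be divided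
    by.\<close>
  define \<eta> where "\<eta> = exp (- B\<^sup>2 / 2) / 2"
  have "0 < \<eta>" by (simp add: \<eta>_def)
  \<comment> \<open>\<open>T\<close> single-gate errors of size
    \<open>(B ^ 3 + B ^ 4) / sqrt T ^ 3\<close>.\<close>
  define \<delta> where "\<delta> = (\<lambda>T. (B ^ 3 + B ^ 4) / sqrt (real T))"
  have \<delta>0: "\<delta> \<longlonglongrightarrow> 0"
    unfolding \<delta>_def by (rule real_tendsto_divide_at_top[OF tendsto_const sqrt_at_top])
  then have ev_\<delta>: "\<forall>\<^sub>F T in sequentially. \<delta> T < \<eta>"
    using \<open>0 < \<eta>\<close> by (rule order_tendstoD)
  define Ex where "Ex = (\<lambda>T xs. exp (- cond_var h b T xs / 2) - exp (- limit_var b / 2))"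
  have cond_var_bounds: "0 \<le> cond_var h b T xs \<and> cond_var h b T xs \<le> B\<^sup>2" if loc: "loc h T \<in> \<Theta>" and T: "0 < T" for T xs
  proof -
    have t: "0 \<le> (b (t mod K))\<^sup>2 * (q (t mod K) (loc h T) * (1 - q (t mod K) (loc h T))) / real T
      \<and> (b (t mod K))\<^sup>2 * (q (t mod K) (loc h T) * (1 - q (t mod K) (loc h T))) / real T \<le> B\<^sup>2 / real T" for t
    proof -
      have "(b (t mod K))\<^sup>2 \<le> B\<^sup>2"
        using bB[OF mod_K] by (metis abs_ge_zero power2_abs power_mono)
      moreover have "q (t mod K) (loc h T) * (1 - q (t mod K) (loc h T)) \<le> 1"
        using q01[OF mod_K loc, of t] by (intro mult_le_one) auto
      ultimately have "(b (t mod K))\<^sup>2 * (q (t mod K) (loc h T) * (1 - q (t mod K) (loc h T))) \<le> B\<^sup>2 * 1"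
        using q01[OF mod_K loc, of t] by (intro mult_mono) auto
      then show ?thesis
        using q01[OF mod_K loc, of t] T by (auto intro!: divide_right_mono)
    qed
    have "0 \<le> cond_var h b T xs"
      unfolding cond_var_eq using t by (intro sum_nonneg) simp
    moreover have "cond_var h b T xs \<le> (\<Sum>t<T. B\<^sup>2 / real T)"
      unfolding cond_var_eq using t by (intro sum_mono) auto
    ultimately show ?thesis
      using T by simp
  qed
  have lim: "(\<lambda>T. (\<delta> T + (\<integral>xs. \<bar>Ex T xs\<bar> \<partial>M h T)) / \<eta>) \<longlonglongrightarrow> 0"
  proof -
    have "(\<lambda>T. \<integral>xs. \<bar>Ex T xs\<bar> \<partial>M h T) \<longlonglongrightarrow> 0"
    proof (rule vanishing_in_prob_expectation[OF discrete_M])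
      show "vanishing_in_prob (M h) Ex"
        unfolding Ex_def by (rule cond_var_vanishing)
      show "\<forall>\<^sub>F T in sequentially. \<forall>x\<in>space (M h T). \<bar>Ex T x\<bar> \<le> 1 + exp (- limit_var b / 2)"
        using loc_in[of h] eventually_gt_at_top[of 0]
      proof eventually_elim
        case (elim T)
        show ?case
        proof
          fix xs
          have "exp (- cond_var h b T xs / 2) \<le> 1"
            using cond_var_bounds[OF elim, of xs] by simp
          then show "\<bar>Ex T xs\<bar> \<le> 1 + exp (- limit_var b / 2)"
            unfolding Ex_def using exp_ge_zero[of "- cond_var h b T xs / 2"] exp_ge_zero[of "- limit_var b / 2"]
            by linarith
        qed
      qed
    qed (simp add: add_nonneg_nonneg)
    from tendsto_divide[OF tendsto_add[OF \<delta>0 this] tendsto_const[of \<eta>]] show ?thesis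
      using \<open>0 < \<eta>\<close> by simp
  qed
  have "(\<lambda>T. (\<integral>xs. iexp (\<Sum>r<K. b r * resid h T xs r) \<partial>M h T) - of_real (exp (- limit_var b / 2))) \<longlonglongrightarrow> 0"
  proof (rule Lim_null_comparison[OF _ lim])
    show "\<forall>\<^sub>F T in sequentially. norm ((\<integral>xs. iexp (\<Sum>r<K. b r * resid h T xs r) \<partial>M h T) - of_real (exp (- limit_var b / 2)))
        \<le> (\<delta> T + (\<integral>xs. \<bar>Ex T xs\<bar> \<partial>M h T)) / \<eta>"
      using loc_in[of h] eventually_gt_at_top[of 0] ev_\<delta>
    proof eventually_elim
      case (elim T)
      let ?\<theta> = "loc h T" and ?s = "sqrt (real T)"
      note loc = elim(1) and T = elim(2)
      have s1: "1 \<le> ?s"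
        using T by simp
      define \<phi> where "\<phi> = (\<lambda>t. of_real (q (t mod K) ?\<theta>) * iexp (b (t mod K) / ?s * (1 - q (t mod K) ?\<theta>))
        + of_real (1 - q (t mod K) ?\<theta>) * iexp (- (b (t mod K) / ?s * q (t mod K) ?\<theta>)))"
      define \<epsilon> where "\<epsilon> = (\<lambda>t. exp (- ((b (t mod K))\<^sup>2 * (q (t mod K) ?\<theta> * (1 - q (t mod K) ?\<theta>)) / (2 * ?s\<^sup>2))))"
      have q: "0 \<le> q (t mod K) ?\<theta>" "q (t mod K) ?\<theta> \<le> 1" for t
        using q01[OF mod_K loc, of t] by auto
      have \<phi>1: "cmod (\<phi> t) \<le> 1" and \<phi>\<epsilon>: "cmod (\<phi> t - of_real (\<epsilon> t)) \<le> (B ^ 3 + B ^ 4) / ?s ^ 3" for t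
        unfolding \<phi>_def \<epsilon>_def using char_centered_bernoulli[OF q s1 bB[OF mod_K]] by simp_all
      have \<epsilon>1: "cmod (of_real (\<epsilon> t)) \<le> 1" for t
        using q[of t] by (simp add: \<epsilon>_def)
      define \<Phi> where "\<Phi> = (\<lambda>xs :: (bool \<times> bool) list. \<Prod>t<T. if fst (xs ! t) then \<phi> t else 1)"
      have \<Phi>_close: "cmod (\<Phi> xs - of_real (exp (- cond_var h b T xs / 2))) \<le> \<delta> T" for xs
      proof -
        have "of_real (exp (- cond_var h b T xs / 2)) = (\<Prod>t<T. if fst (xs ! t) then of_real (\<epsilon> t) else (1::complex))"
        proof -
          have "- cond_var h b T xs / 2 = (\<Sum>t<T. if fst (xs ! t) then - ((b (t mod K))\<^sup>2 * (q (t mod K) ?\<theta> * (1 - q (t mod K) ?\<theta>)) / (2 * ?s\<^sup>2)) else 0)"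
            unfolding cond_var_eq sum_negf[symmetric] sum_divide_distrib
            by (rule sum.cong) simp_all
          also have "exp \<dots> = (\<Prod>t<T. if fst (xs ! t) then \<epsilon> t else 1)"
            unfolding exp_sum[OF finite_lessThan] by (rule prod.cong) (simp_all add: \<epsilon>_def)
          finally show ?thesis
            by (simp only: of_real_prod if_distrib[of of_real] of_real_1)
        qed
        \<comment> \<open>All factors of both products have modulus at most 1, so the distance of
          the products is at most the sum of the distances of the factors.\<close>
        then have "cmod (\<Phi> xs - of_real (exp (- cond_var h b T xs / 2)))
            \<le> (\<Sum>t<T. cmod ((if fst (xs ! t) then \<phi> t else 1) - (if fst (xs ! t) then of_real (\<epsilon> t) else 1)))"
          unfolding \<Phi>_def by (simp only:) (rule norm_prod_diff; use \<phi>1 \<epsilon>1 in simp)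
        also have "\<dots> \<le> (\<Sum>t<T. (B ^ 3 + B ^ 4) / ?s ^ 3)"
        proof (rule sum_mono)
          fix t
          show "cmod ((if fst (xs ! t) then \<phi> t else 1) - (if fst (xs ! t) then of_real (\<epsilon> t) else 1)) \<le> (B ^ 3 + B ^ 4) / ?s ^ 3"
            using \<phi>\<epsilon>[of t] \<open>0 \<le> B\<close> by auto
        qed
        also have "\<dots> = \<delta> T"
        proof -
          have "?s ^ 3 = real T * ?s"
            by (simp add: power3_eq_cube)
          then show ?thesis
            using T by (simp add: \<delta>_def)
        qed
        finally show ?thesis .
      qed
      have \<Phi>_ge: "\<eta> \<le> cmod (\<Phi> xs)" for xs
      proof -
        have "exp (- B\<^sup>2 / 2) \<le> exp (- cond_var h b T xs / 2)"
          using cond_var_bounds[OF loc T, of xs] by simp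
        then have "2 * \<eta> \<le> cmod (of_real (exp (- cond_var h b T xs / 2)))"
          by (simp add: \<eta>_def)
        moreover have "cmod (of_real (exp (- cond_var h b T xs / 2))) \<le> cmod (\<Phi> xs) + cmod (\<Phi> xs - of_real (exp (- cond_var h b T xs / 2)))"
          by (metis norm_triangle_sub norm_minus_commute)
        ultimately show ?thesis
          using \<Phi>_close[of xs] elim(3) by linarith
      qed
      \<comment> \<open>On the string with all gates open, \<Phi> is the full product; as it is
        bounded away from 0, no single factor vanishes.\<close>
      have \<phi>0: "\<phi> t \<noteq> 0" if "t < T" for t
      proof
        assume "\<phi> t = 0"
        then have "\<Phi> (replicate T (True, True)) = 0"
          unfolding \<Phi>_def using that by (intro prod_zero) auto
        then show False
          using \<Phi>_ge[of "replicate T (True, True)"] \<open>0 < \<eta>\<close> by simp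
      qed
      let ?A = "\<lambda>xs. iexp (\<Sum>r<K. b r * resid h T xs r)"
      let ?c = "complex_of_real (exp (- limit_var b / 2))"
      have scaleR_complex: "w *\<^sub>R z = of_real w * z" for w and z :: complex
        by (rule scaleR_conv_of_real)
      have one: "(\<Sum>xs | length xs = T. of_real (weight ?\<theta> xs) * (?A xs / \<Phi> xs)) = 1"
      proof -
        let ?z = "\<lambda>t. \<i> * of_real (b (t mod K) / ?s)"
        have \<phi>_eq: "of_real (q (t mod K) ?\<theta>) * exp (?z t * of_real (1 - q (t mod K) ?\<theta>))
            + of_real (1 - q (t mod K) ?\<theta>) * exp (- (?z t * of_real (q (t mod K) ?\<theta>))) = \<phi> t" for t
          by (simp add: \<phi>_def mult.assoc)
        have expo: "(\<Sum>t<T. ?z t * of_real (of_bool (snd (xs ! t)) - q (t mod K) ?\<theta> * of_bool (fst (xs ! t))))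
            = \<i> * of_real (\<Sum>r<K. b r * resid h T xs r)" for xs
          unfolding sum_resid of_real_sum sum_distrib_left by (rule sum.cong) (simp_all only: of_real_mult mult.assoc)
        show ?thesis
          using sum_path_weight_exp[where \<kappa> = \<kappa> and q = "\<lambda>t. q (t mod K) ?\<theta>" and T = T and z = ?z, OF \<kappa>_sum]
          unfolding \<phi>_eq expo \<Phi>_def using \<phi>0 by blast
      qed
      have sum_w: "(\<Sum>xs | length xs = T. weight ?\<theta> xs * f xs) = (\<integral>xs. f xs \<partial>M h T)" for f :: "_ \<Rightarrow> real"
        by (simp add: expectation_Q[OF loc])
      \<comment> \<open>The limit \<open>?c\<close> is multiplied by the identity
        \<open>one\<close>, so that both terms become sums over the same strings and the difference
        carries the small factor \<open>\<Phi> xs - ?c\<close>.\<close>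
      have "(\<integral>xs. ?A xs \<partial>M h T) - ?c = (\<Sum>xs | length xs = T. of_real (weight ?\<theta> xs) * ?A xs)
          - ?c * (\<Sum>xs | length xs = T. of_real (weight ?\<theta> xs) * (?A xs / \<Phi> xs))"
        unfolding one by (simp only: expectation_Q[OF loc] scaleR_complex mult_1_right)
      also have "\<dots> = (\<Sum>xs | length xs = T. of_real (weight ?\<theta> xs) * ?A xs * ((\<Phi> xs - ?c) / \<Phi> xs))"
        unfolding sum_distrib_left sum_subtractf[symmetric]
      proof (rule sum.cong[OF refl])
        fix xs
        have "\<Phi> xs \<noteq> 0"
          using \<Phi>_ge[of xs] \<open>0 < \<eta>\<close> by auto
        then show "of_real (weight ?\<theta> xs) * ?A xs - ?c * (of_real (weight ?\<theta> xs) * (?A xs / \<Phi> xs))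
            = of_real (weight ?\<theta> xs) * ?A xs * ((\<Phi> xs - ?c) / \<Phi> xs)"
          by (simp add: field_simps)
      qed
      finally have "norm ((\<integral>xs. ?A xs \<partial>M h T) - ?c)
          \<le> (\<Sum>xs | length xs = T. norm (of_real (weight ?\<theta> xs) * ?A xs * ((\<Phi> xs - ?c) / \<Phi> xs)))"
        by (simp only: norm_sum)
      also have "\<dots> \<le> (\<Sum>xs | length xs = T. weight ?\<theta> xs * ((\<delta> T + \<bar>Ex T xs\<bar>) / \<eta>))"
      proof (rule sum_mono)
        fix xs
        have "cmod (\<Phi> xs - ?c) \<le> cmod (\<Phi> xs - of_real (exp (- cond_var h b T xs / 2)))
            + cmod (of_real (exp (- cond_var h b T xs / 2)) - ?c)"
          by (metis norm_triangle_ineq diff_add_cancel add_diff_eq)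
        also have "cmod (of_real (exp (- cond_var h b T xs / 2)) - ?c) = \<bar>Ex T xs\<bar>"
          unfolding Ex_def by (simp only: of_real_diff[symmetric] norm_of_real)
        finally have "cmod (\<Phi> xs - ?c) \<le> \<delta> T + \<bar>Ex T xs\<bar>"
          using \<Phi>_close[of xs] by simp
        then have "cmod (\<Phi> xs - ?c) / cmod (\<Phi> xs) \<le> (\<delta> T + \<bar>Ex T xs\<bar>) / \<eta>"
          using \<Phi>_ge[of xs] \<open>0 < \<eta>\<close> by (intro frac_le) (auto intro: order_trans[OF norm_ge_zero])
        then have "weight ?\<theta> xs * (cmod (\<Phi> xs - ?c) / cmod (\<Phi> xs)) \<le> weight ?\<theta> xs * ((\<delta> T + \<bar>Ex T xs\<bar>) / \<eta>)"
          by (rule mult_left_mono[OF _ weight_nonneg[OF loc]])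
        moreover have "norm (of_real (weight ?\<theta> xs) * ?A xs * ((\<Phi> xs - ?c) / \<Phi> xs))
            = weight ?\<theta> xs * (cmod (\<Phi> xs - ?c) / cmod (\<Phi> xs))"
          using weight_nonneg[OF loc, of xs] by (simp only: norm_mult norm_divide norm_of_real norm_exp_i_times abs_of_nonneg mult_1_right)
        ultimately show "norm (of_real (weight ?\<theta> xs) * ?A xs * ((\<Phi> xs - ?c) / \<Phi> xs)) \<le> weight ?\<theta> xs * ((\<delta> T + \<bar>Ex T xs\<bar>) / \<eta>)"
          by simp
      qed
      also have "\<dots> = (\<delta> T * (\<Sum>xs | length xs = T. weight ?\<theta> xs * 1) + (\<Sum>xs | length xs = T. weight ?\<theta> xs * \<bar>Ex T xs\<bar>)) / \<eta>"
        by (simp add: sum_distrib_left sum_divide_distrib sum.distrib[symmetric] add_divide_distrib algebra_simps)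
      also have "(\<Sum>xs | length xs = T. weight ?\<theta> xs * 1) = 1"
        unfolding sum_w using prob_space.prob_space[OF prob_Q[OF loc]] by simp
      finally show ?case
        by (simp add: sum_w)
    qed
  qed
  then show ?thesis
    by (simp add: LIM_zero_iff)
qed

end

section \<open>Expansion and limit law of the one-step estimator\<close>

locale one_step_model = gated_model K \<kappa> lam \<Theta> Q \<theta>\<^sub>0 g
  for K \<kappa> and lam :: "nat \<Rightarrow> real^'d \<Rightarrow> real" and \<Theta> Q \<theta>\<^sub>0 g +
  fixes est :: "nat \<Rightarrow> (bool \<times> bool) list \<Rightarrow> real^'d" and I :: "real^'d^'d"
  assumes I: "I = fisher K lam \<theta>\<^sub>0 g"
    and pos_def_I: "pos_def I"
    and est_in: "\<And>T xs. length xs = T \<Longrightarrow> est T xs \<in> \<Theta>"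
    and est_root_T: "bounded_in_prob (Q \<theta>\<^sub>0) (\<lambda>T xs. sqrt (real T) *\<^sub>R (est T xs - \<theta>\<^sub>0))"
begin

abbreviation "G r \<equiv> grad (lam r) \<theta>\<^sub>0 /\<^sub>R q r \<theta>\<^sub>0"

text \<open>The scaled score at the local parameter with gradients and event probabilities in its
  coefficients frozen at \<open>\<theta>\<^sub>0\<close>; only the residuals remain random.\<close>

definition lin_score :: "real^'d \<Rightarrow> nat \<Rightarrow> (bool \<times> bool) list \<Rightarrow> real^'d" where
  "lin_score h T xs = (\<Sum>r<K. resid h T xs r *\<^sub>R G r)"

text \<open>The counts in the score at \<theta> are recentred at the local parameter. What is left
  over is a drift proportional to the gate counts and to the scaled difference of the event
  probabilities.\<close>

lemma scaled_score_eq: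
  assumes \<theta>: "\<theta> \<in> \<Theta>" and T: "0 < T"
  shows "score K lam T xs \<theta> /\<^sub>R sqrt (real T) = (\<Sum>r<K. (resid h T xs r
    - gate_count K T xs r / real T * (sqrt (real T) * (q r \<theta> - q r (loc h T)))) *\<^sub>R (grad (lam r) \<theta> /\<^sub>R q r \<theta>))"
proof -
  let ?s = "sqrt (real T)"
  have s: "0 < ?s" and ss: "real T = ?s * ?s"
    using T by simp_all
  have "score K lam T xs \<theta> = (\<Sum>r<K. ((event_count K T xs r - q r \<theta> * gate_count K T xs r) / q r \<theta>) *\<^sub>R grad (lam r) \<theta>)"
    by (rule score_eq) (use gderiv q01 \<theta> in auto)
  then have "score K lam T xs \<theta> /\<^sub>R ?s
      = (\<Sum>r<K. (inverse ?s * ((event_count K T xs r - q r \<theta> * gate_count K T xs r) / q r \<theta>)) *\<^sub>R grad (lam r) \<theta>)"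
    by (simp only: scaleR_sum_right scaleR_scaleR)
  also have "\<dots> = (\<Sum>r<K. (resid h T xs r
    - gate_count K T xs r / real T * (?s * (q r \<theta> - q r (loc h T)))) *\<^sub>R (grad (lam r) \<theta> /\<^sub>R q r \<theta>))"
  proof (rule sum.cong[OF refl])
    fix r
    have "gate_count K T xs r / real T * (?s * (q r \<theta> - q r (loc h T))) = gate_count K T xs r * (q r \<theta> - q r (loc h T)) / ?s"
    proof -
      have "x / (a * a) * (a * d) = x * d / a" if "a \<noteq> 0" for a x d :: real
        using that by (simp add: field_simps)
      from this[of ?s] have "x / (?s * ?s) * (?s * d) = x * d / ?s" for x d
        using s by (simp only: order_less_imp_not_eq2 simp_thms)
      then show ?thesis
        by (simp only: ss[symmetric])
    qed
    then have "resid h T xs r - gate_count K T xs r / real T * (?s * (q r \<theta> - q r (loc h T)))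
        = (event_count K T xs r - q r \<theta> * gate_count K T xs r) / ?s"
      unfolding resid_def by (simp add: diff_divide_distrib[symmetric]) (simp add: algebra_simps)
    then show "(inverse ?s * ((event_count K T xs r - q r \<theta> * gate_count K T xs r) / q r \<theta>)) *\<^sub>R grad (lam r) \<theta>
      = (resid h T xs r - gate_count K T xs r / real T * (?s * (q r \<theta> - q r (loc h T)))) *\<^sub>R (grad (lam r) \<theta> /\<^sub>R q r \<theta>)"
      by (simp add: divide_inverse mult_ac)
  qed
  finally show ?thesis .
qed

lemma fisher_mult_G:
  "I *v x = (\<Sum>r<K. (g r / real K * (((1 - q r \<theta>\<^sub>0) *\<^sub>R grad (lam r) \<theta>\<^sub>0) \<bullet> x)) *\<^sub>R G r)"
  unfolding I fisher_mult_vec by (rule sum.cong) (simp_all add: divide_inverse mult_ac)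

text \<open>The scaled difference of event probabilities is asymptotically linear in the scaled
  difference of the parameters, and the relative gate counts tend to \<open>g r / K\<close>, so the
  drift becomes \<open>I\<close> applied to that difference. The coefficients at the estimate may be
  replaced by those at \<open>\<theta>\<^sub>0\<close> because what they multiply stays
  bounded.\<close>

lemma score_expansion:
  assumes \<tau>: "filterlim \<tau> sequentially sequentially" and X: "\<And>k. length (X k) = \<tau> k"
    and est: "\<And>k. norm (sqrt (real (\<tau> k)) *\<^sub>R (est (\<tau> k) (X k) - \<theta>\<^sub>0)) \<le> c"
    and resid: "\<And>k r. r < K \<Longrightarrow> \<bar>resid h (\<tau> k) (X k) r\<bar> \<le> c"
    and freq: "\<And>r. r < K \<Longrightarrow> (\<lambda>k. gating_freq K (\<tau> k) (X k) r) \<longlonglongrightarrow> g r"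
  shows "(\<lambda>k. score K lam (\<tau> k) (X k) (est (\<tau> k) (X k)) /\<^sub>R sqrt (real (\<tau> k))
    + I *v (sqrt (real (\<tau> k)) *\<^sub>R (est (\<tau> k) (X k) - loc h (\<tau> k))) - lin_score h (\<tau> k) (X k)) \<longlonglongrightarrow> 0"
    and "(\<lambda>k. est (\<tau> k) (X k)) \<longlonglongrightarrow> \<theta>\<^sub>0"
proof -
  define s where "s = (\<lambda>k. sqrt (real (\<tau> k)))"
  define e where "e = (\<lambda>k. est (\<tau> k) (X k))"
  define n where "n = (\<lambda>k r. gate_count K (\<tau> k) (X k) r / real (\<tau> k))"
  define W where "W = (\<lambda>k r. resid h (\<tau> k) (X k) r)"
  have s: "filterlim s at_top sequentially"
    unfolding s_def using filterlim_compose[OF sqrt_at_top \<tau>] by simp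
  have pos: "\<forall>\<^sub>F k in sequentially. 0 < \<tau> k"
    using filterlim_iff[THEN iffD1, OF \<tau>] eventually_gt_at_top by blast
  have e_in: "e k \<in> \<Theta>" for k
    unfolding e_def by (rule est_in[OF X])
  have e_bound: "norm (s k *\<^sub>R (e k - \<theta>\<^sub>0)) \<le> c" for k
    using est by (simp only: s_def e_def)
  have e_lim: "e \<longlonglongrightarrow> \<theta>\<^sub>0"
    by (rule tendsto_of_scaled_bound[OF s e_bound])
  then show "(\<lambda>k. est (\<tau> k) (X k)) \<longlonglongrightarrow> \<theta>\<^sub>0"
    by (simp only: e_def)
  define \<delta> where "\<delta> = (\<lambda>k. s k *\<^sub>R (e k - loc h (\<tau> k)))"
  have \<delta>_eq: "\<delta> k = s k *\<^sub>R (e k - \<theta>\<^sub>0) - s k *\<^sub>R (loc h (\<tau> k) - \<theta>\<^sub>0)" for k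
    unfolding \<delta>_def by (simp only: scaleR_diff_right[symmetric]) simp
  have loc_bound: "norm (s k *\<^sub>R (loc h (\<tau> k) - \<theta>\<^sub>0)) \<le> norm h" for k
    unfolding s_def by (rule loc_scaled_bound)
  have \<delta>_bound: "norm (\<delta> k) \<le> c + norm h" for k
    unfolding \<delta>_eq using e_bound[of k] loc_bound[of k] by (meson norm_triangle_le_diff add_mono order_trans norm_triangle_ineq4)
  define v where "v = (\<lambda>r. (1 - q r \<theta>\<^sub>0) *\<^sub>R grad (lam r) \<theta>\<^sub>0)"
  have term_lim: "(\<lambda>k. (W k r - n k r * (s k * (q r (e k) - q r (loc h (\<tau> k))))) *\<^sub>R (grad (lam r) (e k) /\<^sub>R q r (e k))
      - W k r *\<^sub>R G r + (g r / real K * (v r \<bullet> \<delta> k)) *\<^sub>R G r) \<longlonglongrightarrow> 0" if r: "r < K" for r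
  proof -
    define a where "a = (\<lambda>k. s k * (q r (e k) - q r (loc h (\<tau> k))))"
    define Ge where "Ge = (\<lambda>k. grad (lam r) (e k) /\<^sub>R q r (e k))"
    have Ge: "Ge \<longlonglongrightarrow> G r"
      unfolding Ge_def
      by (intro tendsto_intros isCont_tendsto_compose[OF isCont_grad[OF r] e_lim] isCont_tendsto_compose[OF isCont_q[OF r] e_lim])
         (use q01[OF r \<theta>\<^sub>0] in simp)
    \<comment> \<open>Estimate and local parameter are both expanded around
      \<open>\<theta>\<^sub>0\<close>, and the two expansions are subtracted.\<close>
    have a_lim: "(\<lambda>k. a k - v r \<bullet> \<delta> k) \<longlonglongrightarrow> 0"
    proof -
      have "(\<lambda>k. (s k * (q r (e k) - q r \<theta>\<^sub>0) - v r \<bullet> (s k *\<^sub>R (e k - \<theta>\<^sub>0)))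
          - (s k * (q r (loc h (\<tau> k)) - q r \<theta>\<^sub>0) - v r \<bullet> (s k *\<^sub>R (loc h (\<tau> k) - \<theta>\<^sub>0)))) \<longlonglongrightarrow> 0 - 0"
        unfolding v_def by (intro tendsto_diff q_expansion[OF r s e_bound] q_expansion[OF r s loc_bound])
      moreover have "(s k * (q r (e k) - q r \<theta>\<^sub>0) - v r \<bullet> (s k *\<^sub>R (e k - \<theta>\<^sub>0)))
          - (s k * (q r (loc h (\<tau> k)) - q r \<theta>\<^sub>0) - v r \<bullet> (s k *\<^sub>R (loc h (\<tau> k) - \<theta>\<^sub>0))) = a k - v r \<bullet> \<delta> k" for k
        unfolding a_def \<delta>_eq inner_diff_right by (simp only: right_diff_distrib)
      ultimately show ?thesis
        by simp
    qed
    have vd_bound: "\<bar>v r \<bullet> \<delta> k\<bar> \<le> norm (v r) * (c + norm h)" for k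
      by (rule order_trans[OF Cauchy_Schwarz_ineq2 mult_left_mono[OF \<delta>_bound norm_ge_zero]])
    have n_lim: "(\<lambda>k. n k r) \<longlonglongrightarrow> g r / real K"
      unfolding n_def by (rule gate_count_limit[OF K r \<tau> freq[OF r]])
    define u where "u = (\<lambda>k. n k r * a k - g r / real K * (v r \<bullet> \<delta> k))"
    have u_lim: "u \<longlonglongrightarrow> 0"
    proof -
      have "(\<lambda>k. n k r - g r / real K) \<longlonglongrightarrow> 0"
        using n_lim by (simp add: LIM_zero_iff)
      from tendsto_scaleR_bounded_null[OF vd_bound this]
      have "(\<lambda>k. (v r \<bullet> \<delta> k) * (n k r - g r / real K)) \<longlonglongrightarrow> 0"
        by simp
      from tendsto_add[OF tendsto_mult[OF n_lim a_lim] this]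
      have "(\<lambda>k. n k r * (a k - v r \<bullet> \<delta> k) + (v r \<bullet> \<delta> k) * (n k r - g r / real K)) \<longlonglongrightarrow> 0"
        by simp
      moreover have "n k r * (a k - v r \<bullet> \<delta> k) + (v r \<bullet> \<delta> k) * (n k r - g r / real K) = u k" for k
        by (simp add: u_def algebra_simps)
      ultimately show ?thesis
        by simp
    qed
    have GeG: "(\<lambda>k. Ge k - G r) \<longlonglongrightarrow> 0"
      using Ge by (simp add: LIM_zero_iff)
    have WB: "\<bar>W k r\<bar> \<le> c" for k
      unfolding W_def by (rule resid[OF r])
    have gvB: "\<bar>g r / real K * (v r \<bullet> \<delta> k)\<bar> \<le> \<bar>g r / real K\<bar> * (norm (v r) * (c + norm h))" for k
      unfolding abs_mult by (rule mult_left_mono[OF vd_bound]) simp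
    \<comment> \<open>Three errors: replacing the coefficient in the residual term and in the linear
      drift, each a bounded factor times a null sequence, and linearising the drift, which is
      \<open>u k\<close> times a convergent sequence.\<close>
    have "(\<lambda>k. W k r *\<^sub>R (Ge k - G r) - (g r / real K * (v r \<bullet> \<delta> k)) *\<^sub>R (Ge k - G r) - u k *\<^sub>R Ge k) \<longlonglongrightarrow> 0 - 0 - 0 *\<^sub>R G r"
      by (intro tendsto_diff tendsto_scaleR u_lim Ge tendsto_scaleR_bounded_null[OF WB GeG] tendsto_scaleR_bounded_null[OF gvB GeG])
    moreover have "W k r *\<^sub>R (Ge k - G r) - (g r / real K * (v r \<bullet> \<delta> k)) *\<^sub>R (Ge k - G r) - u k *\<^sub>R Ge k
        = (W k r - n k r * a k) *\<^sub>R Ge k - W k r *\<^sub>R G r + (g r / real K * (v r \<bullet> \<delta> k)) *\<^sub>R G r" for k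
      unfolding u_def by (simp only: scaleR_diff_right scaleR_diff_left) simp
    ultimately show ?thesis
      by (simp add: a_def Ge_def)
  qed
  have "(\<lambda>k. \<Sum>r<K. (W k r - n k r * (s k * (q r (e k) - q r (loc h (\<tau> k))))) *\<^sub>R (grad (lam r) (e k) /\<^sub>R q r (e k))
      - W k r *\<^sub>R G r + (g r / real K * (v r \<bullet> \<delta> k)) *\<^sub>R G r) \<longlonglongrightarrow> (\<Sum>r<K. 0)"
    by (intro tendsto_sum term_lim) simp
  then have lim: "(\<lambda>k. \<Sum>r<K. (W k r - n k r * (s k * (q r (e k) - q r (loc h (\<tau> k))))) *\<^sub>R (grad (lam r) (e k) /\<^sub>R q r (e k))
      - W k r *\<^sub>R G r + (g r / real K * (v r \<bullet> \<delta> k)) *\<^sub>R G r) \<longlonglongrightarrow> 0"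
    by simp
  have "\<forall>\<^sub>F k in sequentially. (\<Sum>r<K. (W k r - n k r * (s k * (q r (e k) - q r (loc h (\<tau> k))))) *\<^sub>R (grad (lam r) (e k) /\<^sub>R q r (e k))
      - W k r *\<^sub>R G r + (g r / real K * (v r \<bullet> \<delta> k)) *\<^sub>R G r)
      = score K lam (\<tau> k) (X k) (e k) /\<^sub>R s k + I *v \<delta> k - lin_score h (\<tau> k) (X k)"
    using pos
  proof eventually_elim
    case (elim k)
    show ?case
      unfolding s_def scaled_score_eq[OF e_in elim, where h = h] fisher_mult_G lin_score_def
      by (simp only: sum.distrib sum_subtractf W_def n_def v_def s_def) simp
  qed
  from Lim_transform_eventually[OF lim this]
  show "(\<lambda>k. score K lam (\<tau> k) (X k) (est (\<tau> k) (X k)) /\<^sub>R sqrt (real (\<tau> k))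
    + I *v (sqrt (real (\<tau> k)) *\<^sub>R (est (\<tau> k) (X k) - loc h (\<tau> k))) - lin_score h (\<tau> k) (X k)) \<longlonglongrightarrow> 0"
    by (simp only: s_def e_def \<delta>_def)
qed

text \<open>\<open>J k\<close> applied to the scaled error of the one-step estimator is
  \<open>z k\<close>, that is \<open>J k *v \<delta> k\<close> plus the scaled score. The score
  contributes the linear score minus \<open>I *v \<delta> k\<close>, and \<open>J k\<close> tends to
  \<open>I\<close> while \<open>\<delta> k\<close> stays bounded, so the preliminary error \<delta>
  cancels and a perturbed linear system for the linear score remains.\<close>

lemma one_step_expansion_sequences:
  assumes \<tau>: "filterlim \<tau> sequentially sequentially" and X: "\<And>k. length (X k) = \<tau> k"
    and est: "\<And>k. norm (sqrt (real (\<tau> k)) *\<^sub>R (est (\<tau> k) (X k) - \<theta>\<^sub>0)) \<le> c"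
    and resid: "\<And>k r. r < K \<Longrightarrow> \<bar>resid h (\<tau> k) (X k) r\<bar> \<le> c"
    and freq: "\<And>r. r < K \<Longrightarrow> (\<lambda>k. gating_freq K (\<tau> k) (X k) r) \<longlonglongrightarrow> g r"
  shows "(\<lambda>k. sqrt (real (\<tau> k)) *\<^sub>R (one_step K lam est (\<tau> k) (X k) - loc h (\<tau> k))
    - matrix_inv I *v lin_score h (\<tau> k) (X k)) \<longlonglongrightarrow> 0"
proof -
  define s where "s = (\<lambda>k. sqrt (real (\<tau> k)))"
  define e where "e = (\<lambda>k. est (\<tau> k) (X k))"
  define J where "J = (\<lambda>k. fisher K lam (e k) (gating_freq K (\<tau> k) (X k)))"
  define \<delta> where "\<delta> = (\<lambda>k. s k *\<^sub>R (e k - loc h (\<tau> k)))"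
  define U where "U = (\<lambda>k. score K lam (\<tau> k) (X k) (e k))"
  have pos: "\<forall>\<^sub>F k in sequentially. 0 < \<tau> k"
    using filterlim_iff[THEN iffD1, OF \<tau>] eventually_gt_at_top by blast
  note exps = score_expansion[of \<tau> X c h, OF \<tau> X est resid freq]
  have e_lim: "e \<longlonglongrightarrow> \<theta>\<^sub>0"
    unfolding e_def by (rule exps(2))
  have J_lim: "J \<longlonglongrightarrow> I"
    unfolding J_def I fisher_def fisher_component_def
    by (intro tendsto_intros tendsto_outer isCont_tendsto_compose[OF isCont_grad e_lim]
        isCont_tendsto_compose[OF isCont_q e_lim] freq) (use q01[OF _ \<theta>\<^sub>0] in \<open>auto simp: less_imp_neq[symmetric]\<close>)
  have "norm (\<delta> k) \<le> c + norm h" for k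
  proof -
    have "\<delta> k = s k *\<^sub>R (e k - \<theta>\<^sub>0) - s k *\<^sub>R (loc h (\<tau> k) - \<theta>\<^sub>0)"
      unfolding \<delta>_def by (simp only: scaleR_diff_right[symmetric]) simp
    then have "norm (\<delta> k) \<le> norm (s k *\<^sub>R (e k - \<theta>\<^sub>0)) + norm (s k *\<^sub>R (loc h (\<tau> k) - \<theta>\<^sub>0))"
      by (simp only: norm_triangle_ineq4)
    then show ?thesis
      using est[of k] loc_scaled_bound[of "\<tau> k" h] unfolding s_def e_def by linarith
  qed
  then have \<delta>B: "Bfun \<delta> sequentially"
    by (auto intro!: BfunI always_eventually)
  have J\<delta>: "(\<lambda>k. (J k - I) *v \<delta> k) \<longlonglongrightarrow> 0"
  proof -
    interpret mv: bounded_bilinear "\<lambda>(A :: real^'d^'d) x. A *v x"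
      by (rule bounded_bilinear_matrix_vector_mult)
    have "Zfun (\<lambda>k. J k - I) sequentially"
      using J_lim by (simp add: tendsto_Zfun_iff)
    from mv.Zfun_prod_Bfun[OF this \<delta>B] show ?thesis
      by (simp add: tendsto_Zfun_iff)
  qed
  define z where "z = (\<lambda>k. J k *v \<delta> k + U k /\<^sub>R s k)"
  have zw: "(\<lambda>k. z k - lin_score h (\<tau> k) (X k)) \<longlonglongrightarrow> 0"
  proof -
    have "(\<lambda>k. (J k - I) *v \<delta> k + (U k /\<^sub>R s k + I *v \<delta> k - lin_score h (\<tau> k) (X k))) \<longlonglongrightarrow> 0 + 0"
      unfolding U_def e_def s_def \<delta>_def
      by (intro tendsto_add J\<delta>[unfolded \<delta>_def s_def e_def] exps(1))
    then show ?thesis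
      by (simp add: z_def matrix_vector_mult_diff_rdistrib algebra_simps)
  qed
  have wB: "norm (lin_score h (\<tau> k) (X k)) \<le> (\<Sum>r<K. c * norm (G r))" for k
  proof -
    have "norm (lin_score h (\<tau> k) (X k)) \<le> (\<Sum>r<K. norm (resid h (\<tau> k) (X k) r *\<^sub>R G r))"
      unfolding lin_score_def by (rule norm_sum)
    also have "\<dots> \<le> (\<Sum>r<K. c * norm (G r))"
      unfolding norm_scaleR[of "resid _ _ _ _"] by (intro sum_mono mult_right_mono resid) auto
    finally show ?thesis .
  qed
  note pert = linear_system_perturbation[OF pos_def_matrix_inv[OF pos_def_I] J_lim zw wB]
  have "\<forall>\<^sub>F k in sequentially. matrix_inv (J k) *v z k - matrix_inv I *v lin_score h (\<tau> k) (X k)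
      = s k *\<^sub>R (one_step K lam est (\<tau> k) (X k) - loc h (\<tau> k)) - matrix_inv I *v lin_score h (\<tau> k) (X k)"
    using pert(1) pos
  proof eventually_elim
    case (elim k)
    have "matrix_inv (J k) ** J k = mat 1"
      by (rule matrix_inv_mult[OF elim(1)])
    then have "matrix_inv (J k) *v z k = \<delta> k + matrix_inv (J k) *v (U k /\<^sub>R s k)"
      by (simp add: z_def matrix_vector_right_distrib matrix_vector_mul_assoc)
    moreover have "one_step K lam est (\<tau> k) (X k) = e k + matrix_inv (J k) *v (U k /\<^sub>R real (\<tau> k))"
      using elim(1) by (simp add: one_step_def Let_def J_def e_def U_def)
    moreover have "s k *\<^sub>R (matrix_inv (J k) *v (U k /\<^sub>R real (\<tau> k))) = matrix_inv (J k) *v (U k /\<^sub>R s k)"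
    proof -
      have "s k * inverse (real (\<tau> k)) = inverse (s k)"
        using elim(2) by (simp add: s_def field_simps)
      then show ?thesis
        by (simp only: matrix_vector_mult_scaleR[symmetric] scaleR_scaleR)
    qed
    ultimately show ?case
      by (simp add: \<delta>_def scaleR_diff_right scaleR_add_right)
  qed
  from Lim_transform_eventually[OF pert(2) this] show ?thesis
    by (simp only: s_def)
qed

lemma one_step_expansion:
  "vanishing_in_prob (M h) (\<lambda>T xs. norm (sqrt (real T) *\<^sub>R (one_step K lam est T xs - loc h T) - matrix_inv I *v lin_score h T xs))"
proof (rule vanishing_in_probI_sequences[OF discrete_M _ frequency_vanishing])
  let ?R = "\<lambda>T xs. norm (sqrt (real T) *\<^sub>R (est T xs - \<theta>\<^sub>0)) + norm (\<Sum>r<K. \<bar>resid h T xs r\<bar>)"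
  show "bounded_in_prob (M h) ?R"
    by (intro bounded_in_prob_add discrete_M bounded_in_prob_local est_root_T bounded_in_prob_sum resid_bounded) auto
  fix \<tau> X c
  assume \<tau>: "filterlim \<tau> sequentially sequentially" and X: "\<And>k. X k \<in> space (M h (\<tau> k))"
    and R: "\<And>k. \<bar>?R (\<tau> k) (X k)\<bar> \<le> c"
    and Q: "(\<lambda>k. \<Sum>r<K. \<bar>gating_freq K (\<tau> k) (X k) r - g r\<bar>) \<longlonglongrightarrow> 0"
  have est: "norm (sqrt (real (\<tau> k)) *\<^sub>R (est (\<tau> k) (X k) - \<theta>\<^sub>0)) \<le> c"
    and sum: "(\<Sum>r<K. \<bar>resid h (\<tau> k) (X k) r\<bar>) \<le> c" for k
    using R[of k] norm_ge_zero[of "sqrt (real (\<tau> k)) *\<^sub>R (est (\<tau> k) (X k) - \<theta>\<^sub>0)"]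
    unfolding real_norm_def by linarith+
  have "\<bar>resid h (\<tau> k) (X k) r\<bar> \<le> c" if "r < K" for k r
    by (rule order_trans[OF member_le_sum[of r "{..<K}" "\<lambda>r. \<bar>resid h (\<tau> k) (X k) r\<bar>"] sum]) (use that in auto)
  moreover have "length (X k) = \<tau> k" for k
    using X[of k] by (simp add: space_Q)
  ultimately have "(\<lambda>k. sqrt (real (\<tau> k)) *\<^sub>R (one_step K lam est (\<tau> k) (X k) - loc h (\<tau> k))
    - matrix_inv I *v lin_score h (\<tau> k) (X k)) \<longlonglongrightarrow> 0"
    by (intro one_step_expansion_sequences[OF \<tau> _ est _ gating_freq_tendsto[OF Q]])
  then show "(\<lambda>k. norm (sqrt (real (\<tau> k)) *\<^sub>R (one_step K lam est (\<tau> k) (X k) - loc h (\<tau> k))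
    - matrix_inv I *v lin_score h (\<tau> k) (X k))) \<longlonglongrightarrow> 0"
    by (rule tendsto_norm_zero)
qed

text \<open>The information identity: the limiting covariance of the linear score is
  \<open>I\<close> itself. With \<open>w\<close> the transposed inverse applied to \<open>u\<close>,
  the limiting variance is therefore the form of \<open>I\<close> at \<open>w\<close>, which is the
  form of \<open>matrix_inv I\<close> at \<open>u\<close>.\<close>

lemma char_lin_score:
  "(\<lambda>T. \<integral>xs. iexp (u \<bullet> (matrix_inv I *v lin_score h T xs)) \<partial>M h T)
    \<longlonglongrightarrow> of_real (exp (- (u \<bullet> (matrix_inv I *v u)) / 2))"
proof -
  define w where "w = transpose (matrix_inv I) *v u"
  define b where "b = (\<lambda>r. w \<bullet> G r)"
  have dot: "u \<bullet> (matrix_inv I *v x) = w \<bullet> x" for x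
    by (simp add: w_def transpose_matrix_vector dot_lmul_matrix)
  have "limit_var b = (\<Sum>r<K. (g r / real K * (((1 - q r \<theta>\<^sub>0) *\<^sub>R grad (lam r) \<theta>\<^sub>0) \<bullet> w)) * (w \<bullet> G r))"
    unfolding limit_var_def
  proof (rule sum.cong[OF refl])
    fix r assume "r \<in> {..<K}"
    then have "q r \<theta>\<^sub>0 \<noteq> 0"
      using q01[OF _ \<theta>\<^sub>0, of r] by auto
    have cancel: "a * (c * d) * (x / c * (x / c)) = a * (d * x) * (x / c)" if "c \<noteq> 0" for a c d x :: real
      using that by (simp add: field_simps)
    have "((1 - q r \<theta>\<^sub>0) *\<^sub>R grad (lam r) \<theta>\<^sub>0) \<bullet> w = (1 - q r \<theta>\<^sub>0) * (w \<bullet> grad (lam r) \<theta>\<^sub>0)"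
      by (simp only: inner_scaleR_left inner_commute[of w])
    moreover have "w \<bullet> G r = (w \<bullet> grad (lam r) \<theta>\<^sub>0) / q r \<theta>\<^sub>0"
      by (simp add: divide_inverse)
    ultimately show "g r / real K * (q r \<theta>\<^sub>0 * (1 - q r \<theta>\<^sub>0)) * (b r)\<^sup>2
        = g r / real K * (((1 - q r \<theta>\<^sub>0) *\<^sub>R grad (lam r) \<theta>\<^sub>0) \<bullet> w) * (w \<bullet> G r)"
      unfolding b_def by (simp only: power2_eq_square cancel[OF \<open>q r \<theta>\<^sub>0 \<noteq> 0\<close>])
  qed
  also have "\<dots> = w \<bullet> (I *v w)"
    unfolding fisher_mult_G by (simp add: inner_sum_right mult_ac)
  also have "\<dots> = u \<bullet> (matrix_inv I *v (I *v w))"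
    by (simp only: dot)
  also have "\<dots> = u \<bullet> w"
    using pos_def_matrix_inv[OF pos_def_I, THEN matrix_left_right_inverse[THEN iffD1]]
    by (simp add: matrix_vector_mul_assoc)
  also have "\<dots> = u \<bullet> (matrix_inv I *v u)"
    by (simp add: dot inner_commute)
  finally have var: "limit_var b = u \<bullet> (matrix_inv I *v u)" .
  have "u \<bullet> (matrix_inv I *v lin_score h T xs) = (\<Sum>r<K. b r * resid h T xs r)" for T xs
    unfolding dot lin_score_def inner_sum_right b_def by (rule sum.cong) simp_all
  then show ?thesis
    using char_resid[where b = b and h = h] by (simp only: var)
qed

lemma char_one_step:
  "(\<lambda>T. \<integral>xs. iexp (u \<bullet> (sqrt (real T) *\<^sub>R (one_step K lam est T xs - loc h T))) \<partial>M h T)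
    \<longlonglongrightarrow> of_real (exp (- (u \<bullet> (matrix_inv I *v u)) / 2))"
proof -
  define A where "A = (\<lambda>T xs. iexp (u \<bullet> (sqrt (real T) *\<^sub>R (one_step K lam est T xs - loc h T))))"
  define B where "B = (\<lambda>T xs. iexp (u \<bullet> (matrix_inv I *v lin_score h T xs)))"
  have "vanishing_in_prob (M h) (\<lambda>T xs. cmod (A T xs - B T xs))"
  proof (rule vanishing_in_probI_sequences[OF discrete_M bounded_in_prob_zero one_step_expansion])
    fix \<tau> X
    assume lim: "(\<lambda>k. norm (sqrt (real (\<tau> k)) *\<^sub>R (one_step K lam est (\<tau> k) (X k) - loc h (\<tau> k))
      - matrix_inv I *v lin_score h (\<tau> k) (X k))) \<longlonglongrightarrow> 0"
    have "(\<lambda>k. norm u * norm (sqrt (real (\<tau> k)) *\<^sub>R (one_step K lam est (\<tau> k) (X k) - loc h (\<tau> k))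
      - matrix_inv I *v lin_score h (\<tau> k) (X k))) \<longlonglongrightarrow> 0"
      using lim by (rule tendsto_mult_right_zero)
    then show "(\<lambda>k. cmod (A (\<tau> k) (X k) - B (\<tau> k) (X k))) \<longlonglongrightarrow> 0"
    proof (rule Lim_null_comparison[rotated], intro always_eventually allI)
      fix k
      show "norm (cmod (A (\<tau> k) (X k) - B (\<tau> k) (X k)))
        \<le> norm u * norm (sqrt (real (\<tau> k)) *\<^sub>R (one_step K lam est (\<tau> k) (X k) - loc h (\<tau> k))
          - matrix_inv I *v lin_score h (\<tau> k) (X k))"
        unfolding A_def B_def real_norm_def abs_norm_cancel
        by (rule order_trans[OF iexp_diff_le]) (simp only: inner_diff_right[symmetric] Cauchy_Schwarz_ineq2)
    qed
  qed
  moreover have "\<bar>cmod (A T xs - B T xs)\<bar> \<le> 2" for T xs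
    using norm_triangle_ineq4[of "A T xs" "B T xs"] by (simp add: A_def B_def)
  ultimately have lim: "(\<lambda>T. \<integral>xs. \<bar>cmod (A T xs - B T xs)\<bar> \<partial>M h T) \<longlonglongrightarrow> 0"
    by (intro vanishing_in_prob_expectation[OF discrete_M, where c = 2] always_eventually) auto
  have "(\<lambda>T. (\<integral>xs. A T xs \<partial>M h T) - (\<integral>xs. B T xs \<partial>M h T)) \<longlonglongrightarrow> 0"
  proof (rule Lim_null_comparison[OF _ lim])
    show "\<forall>\<^sub>F T in sequentially. norm ((\<integral>xs. A T xs \<partial>M h T) - (\<integral>xs. B T xs \<partial>M h T)) \<le> (\<integral>xs. \<bar>cmod (A T xs - B T xs)\<bar> \<partial>M h T)"
      using loc_in[of h]
    proof eventually_elim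
      case (elim T)
      have "norm ((\<integral>xs. A T xs \<partial>M h T) - (\<integral>xs. B T xs \<partial>M h T))
          = norm (\<Sum>xs | length xs = T. weight (loc h T) xs *\<^sub>R (A T xs - B T xs))"
        by (simp only: expectation_Q[OF elim] scaleR_diff_right sum_subtractf)
      also have "\<dots> \<le> (\<Sum>xs | length xs = T. norm (weight (loc h T) xs *\<^sub>R (A T xs - B T xs)))"
        by (rule norm_sum)
      also have "\<dots> = (\<integral>xs. \<bar>cmod (A T xs - B T xs)\<bar> \<partial>M h T)"
        unfolding expectation_Q[OF elim] norm_scaleR[of "weight _ _"]
        using weight_nonneg[OF elim] by simp
      finally show ?case .
    qed
  qed
  moreover have "(\<lambda>T. \<integral>xs. B T xs \<partial>M h T) \<longlonglongrightarrow> of_real (exp (- (u \<bullet> (matrix_inv I *v u)) / 2))"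
    unfolding B_def by (rule char_lin_score)
  ultimately have "(\<lambda>T. ((\<integral>xs. A T xs \<partial>M h T) - (\<integral>xs. B T xs \<partial>M h T)) + (\<integral>xs. B T xs \<partial>M h T))
      \<longlonglongrightarrow> 0 + of_real (exp (- (u \<bullet> (matrix_inv I *v u)) / 2))"
    by (rule tendsto_add)
  then show ?thesis
    by (simp only: diff_add_cancel add_0_left A_def)
qed

theorem one_step_weak_convergence:
  "weak_conv_to (local_error_law Q (one_step K lam est) \<theta>\<^sub>0 h) (normal_law 0 (matrix_inv I))"
proof -
  define X where "X = (\<lambda>T xs. sqrt (real T) *\<^sub>R (one_step K lam est T xs - loc h T))"
  have law_eq: "local_error_law Q (one_step K lam est) \<theta>\<^sub>0 h T = distr (M h T) borel (X T)" for T
    unfolding local_error_law_def X_def by (simp add: diff_diff_eq)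
  have meas: "X T \<in> measurable (M h T) borel" for T
    unfolding measurable_def by (simp add: sets_Q space_Q)
  \<comment> \<open>Finitely many indices are dropped, since the continuity theorem asks for
    probability measures throughout and the local parameter may lie outside \<Theta> at the
    beginning.\<close>
  obtain N where N: "\<And>n. N \<le> n \<Longrightarrow> loc h n \<in> \<Theta>"
    using loc_in[of h] unfolding eventually_sequentially by blast
  let ?L = "local_error_law Q (one_step K lam est) \<theta>\<^sub>0 h"
  have "weak_conv_to (\<lambda>n. ?L (n + N)) (normal_law 0 (matrix_inv I))"
  proof (rule levy_continuity_euclidean)
    show "prob_space (?L (n + N))" for n
      unfolding law_eq by (rule prob_space.prob_space_distr[OF prob_Q[OF N] meas]) simp
    show "sets (?L (n + N)) = sets borel" for n
      by (simp add: law_eq)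
    show "prob_space (normal_law 0 (matrix_inv I))"
      by (rule prob_space_normal_law[OF pos_def_I])
    show "sets (normal_law 0 (matrix_inv I)) = sets borel"
      by (simp add: normal_law_def)
    fix u
    have eq: "(\<integral>x. iexp (u \<bullet> x) \<partial>?L T) = (\<integral>xs. iexp (u \<bullet> X T xs) \<partial>M h T)" for T
      unfolding law_eq by (rule integral_distr[OF meas]) measurable
    show "(\<lambda>n. \<integral>x. iexp (u \<bullet> x) \<partial>?L (n + N)) \<longlonglongrightarrow> (\<integral>x. iexp (u \<bullet> x) \<partial>normal_law 0 (matrix_inv I))"
      unfolding eq char_normal_law[OF pos_def_I] X_def
      using char_one_step[where u = u and h = h] by (intro LIMSEQ_ignore_initial_segment) simp
  qed
  then show ?thesis
    unfolding weak_conv_to_def by (blast intro: LIMSEQ_offset)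
qed

end

section \<open>From dead-time event detection processes to the abstract gated model\<close>

theorem theorem4:
  fixes K D :: nat
    and \<Theta> :: "(real^'d) set"
    and lam lam_ext :: "nat \<Rightarrow> real^'d \<Rightarrow> real"
    and P :: "real^'d \<Rightarrow> 'a measure"
    and G Y :: "nat \<Rightarrow> 'a \<Rightarrow> bool"
    and \<gamma> :: "real^'d \<Rightarrow> nat \<Rightarrow> real"
    and \<theta>\<^sub>0 :: "real^'d"
    and lam_min lam_max :: real
    and I\<^sub>0 :: "real^'d^'d"
    and est :: "nat \<Rightarrow> (bool \<times> bool) list \<Rightarrow> real^'d"
  assumes ded: "ded_process K D \<Theta> (event_prob lam) P G Y \<gamma>"
    and lam_periodic: "\<And>t \<theta>. \<theta> \<in> \<Theta> \<Longrightarrow> lam t \<theta> = lam (t mod K) \<theta>"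
    and interior: "\<theta>\<^sub>0 \<in> interior \<Theta>"
    and lam_min_pos: "0 < lam_min"
    and lam_min_le_max: "lam_min \<le> lam_max"
    and lam_bounds: "\<And>r \<theta>. r < K \<Longrightarrow> \<theta> \<in> \<Theta> \<Longrightarrow> lam_min \<le> lam r \<theta> \<and> lam r \<theta> \<le> lam_max"
    and lam_smooth: "\<And>r. r < K \<Longrightarrow>
      \<exists>S. open S \<and> \<Theta> \<subseteq> S \<and> Ck_on 3 (lam_ext r) S \<and> (\<forall>\<theta>\<in>\<Theta>. lam_ext r \<theta> = lam r \<theta>)"
    and identifiable: "\<And>\<theta>. \<theta> \<in> \<Theta> \<Longrightarrow>
      (\<And>r. r < K \<Longrightarrow> \<gamma> \<theta>\<^sub>0 r > 0 \<Longrightarrow> lam r \<theta> = lam r \<theta>\<^sub>0) \<Longrightarrow> \<theta> = \<theta>\<^sub>0"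
    and compact: "compact \<Theta>"
    and I\<^sub>0_eq: "I\<^sub>0 = fisher K lam_ext \<theta>\<^sub>0 (\<gamma> \<theta>\<^sub>0)"
    and info_pos_def: "pos_def I\<^sub>0"
    and est_in: "\<And>T xs. length xs = T \<Longrightarrow> est T xs \<in> \<Theta>"
    and est_root_T: "bounded_in_prob (data_law P G Y \<theta>\<^sub>0) (\<lambda>T xs. sqrt T *\<^sub>R (est T xs - \<theta>\<^sub>0))"
  shows "weak_conv_to
           (\<lambda>T. distr (data_law P G Y \<theta>\<^sub>0 T) borel
                  (\<lambda>xs. sqrt T *\<^sub>R (one_step K lam_ext est T xs - \<theta>\<^sub>0)))
           (normal_law 0 (matrix_inv I\<^sub>0))
       \<and> (\<forall>h. weak_conv_to
           (local_error_law (data_law P G Y) (one_step K lam_ext est) \<theta>\<^sub>0 h)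
           (normal_law 0 (matrix_inv I\<^sub>0)))
       \<and> regular_at (data_law P G Y) (one_step K lam_ext est) \<theta>\<^sub>0 (normal_law 0 (matrix_inv I\<^sub>0))"
proof -
  interpret ded: ded_process K D \<Theta> "event_prob lam" P G Y \<gamma>
    by (rule ded)
  from ded.data_law_factorization obtain \<kappa> where
    fact: "(\<forall>t xs g. 0 \<le> \<kappa> t xs g) \<and> (\<forall>t xs. length xs = t \<longrightarrow> \<kappa> t xs True + \<kappa> t xs False = 1) \<and>
      (\<forall>\<theta>\<in>\<Theta>. \<forall>T xs. length xs = T \<longrightarrow>
        measure (data_law P G Y \<theta> T) {xs} = path_weight \<kappa> (\<lambda>t. event_prob lam t \<theta>) xs)" ..
  note \<kappa> = fact[THEN conjunct1, rule_format] fact[THEN conjunct2, THEN conjunct1, rule_format]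
    fact[THEN conjunct2, THEN conjunct2, rule_format]
  have K: "1 \<le> K"
    by (rule ded.period_pos)
  have \<theta>\<^sub>0: "\<theta>\<^sub>0 \<in> \<Theta>"
    using interior interior_subset by blast
  have lam_ext: "lam_ext r \<theta> = lam r \<theta>" if "r < K" "\<theta> \<in> \<Theta>" for r \<theta>
    using lam_smooth[OF that(1)] that(2) by blast
  \<comment> \<open>The law of the data is expressed through \<open>lam\<close>, gradients through
    its extension. On the parameter set the two agree for each phase, and periodicity reduces every
    time to its phase.\<close>
  have event_prob_ext: "event_prob lam t \<theta> = event_prob lam_ext (t mod K) \<theta>" if "\<theta> \<in> \<Theta>" for t \<theta>
    using lam_periodic[OF that, of t] lam_ext[of "t mod K" \<theta>] that K by (simp add: event_prob_def)
  have Ck: "\<exists>S. open S \<and> \<Theta> \<subseteq> S \<and> Ck_on (Suc 2) (lam_ext r) S" if "r < K" for r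
    using lam_smooth[OF that] by (auto simp: numeral_3_eq_3 numeral_2_eq_2)
  interpret one_step_model K \<kappa> lam_ext \<Theta> "data_law P G Y" \<theta>\<^sub>0 "\<gamma> \<theta>\<^sub>0" est I\<^sub>0
  proof (intro one_step_model.intro gated_model.intro one_step_model_axioms.intro)
    show "1 \<le> K" by (rule K)
    show "0 \<le> \<kappa> t xs v" for t xs v by (rule \<kappa>(1))
    show "\<kappa> t xs True + \<kappa> t xs False = 1" if "length xs = t" for t xs
      using that by (rule \<kappa>(2))
    show "prob_space (data_law P G Y \<theta> T)" if "\<theta> \<in> \<Theta>" for \<theta> T
      unfolding data_law_def
      by (rule prob_space.prob_space_distr[OF ded.prob_space_P[OF that] ded.measurable_observations[OF that]])
    show "space (data_law P G Y \<theta> T) = {xs. length xs = T}" for \<theta> T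
      by (simp add: data_law_def data_space_def)
    show "sets (data_law P G Y \<theta> T) = Pow {xs. length xs = T}" for \<theta> T
      by (simp add: data_law_def data_space_def)
    show "measure (data_law P G Y \<theta> T) {xs} = path_weight \<kappa> (\<lambda>t. event_prob lam_ext (t mod K) \<theta>) xs"
      if "\<theta> \<in> \<Theta>" "length xs = T" for \<theta> T xs
      using \<kappa>(3)[OF that] event_prob_ext[OF that(1)] by simp
    show "\<theta>\<^sub>0 \<in> interior \<Theta>" by (rule interior)
    show "0 < lam_ext r \<theta>" if "r < K" "\<theta> \<in> \<Theta>" for r \<theta>
      using lam_bounds[OF that] lam_min_pos lam_ext[OF that] by simp
    show "GDERIV (lam_ext r) \<theta> :> grad (lam_ext r) \<theta>" if "r < K" "\<theta> \<in> \<Theta>" for r \<theta>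
      using Ck[OF that(1)] that(2) by (blast intro: Ck_on_GDERIV)
    show "isCont (grad (lam_ext r)) \<theta>\<^sub>0" if "r < K" for r
      using Ck[OF that] \<theta>\<^sub>0 by (blast intro: Ck_on_isCont_grad)
    show "vanishing_in_prob (data_law P G Y \<theta>\<^sub>0) (\<lambda>T xs. gating_freq K T xs r - \<gamma> \<theta>\<^sub>0 r)" if r: "r < K" for r
      unfolding vanishing_in_prob_def
    proof (intro allI impI)
      fix \<epsilon> :: real assume "0 < \<epsilon>"
      have freq: "gating_freq K T (observations G Y T \<omega>) r = (\<Sum>l<T div K. of_bool (G (r + l * K) \<omega>)) / real (T div K)" for T \<omega>
      proof -
        \<comment> \<open>Indices in complete periods stay below \<open>T\<close>, so the look-up in
          the data list returns the gate of that time.\<close>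
        have "r + l * K < T" if "l < T div K" for l
        proof -
          have "(l + 1) * K \<le> T div K * K"
            using that by (intro mult_right_mono) auto
          also have "\<dots> \<le> T" by simp
          finally show ?thesis using r by simp
        qed
        then show ?thesis
          unfolding gating_freq_def Let_def observations_def
          by (intro arg_cong2[where f = "(/)"] sum.cong) auto
      qed
      have "measure (data_law P G Y \<theta>\<^sub>0 T) {xs \<in> space (data_law P G Y \<theta>\<^sub>0 T). \<bar>gating_freq K T xs r - \<gamma> \<theta>\<^sub>0 r\<bar> > \<epsilon>}
        = measure (P \<theta>\<^sub>0) {\<omega> \<in> space (P \<theta>\<^sub>0).
           \<bar>(\<Sum>l<T div K. of_bool (G (r + l * K) \<omega>)) / real (T div K) - \<gamma> \<theta>\<^sub>0 r\<bar> > \<epsilon>}" for T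
      proof -
        let ?S = "{xs. length xs = T \<and> \<bar>gating_freq K T xs r - \<gamma> \<theta>\<^sub>0 r\<bar> > \<epsilon>}"
        have "length (observations G Y T \<omega>) = T" for \<omega>
          by (simp add: observations_def)
        then have "observations G Y T -` ?S \<inter> space (P \<theta>\<^sub>0) = {\<omega> \<in> space (P \<theta>\<^sub>0).
           \<bar>(\<Sum>l<T div K. of_bool (G (r + l * K) \<omega>)) / real (T div K) - \<gamma> \<theta>\<^sub>0 r\<bar> > \<epsilon>}"
          by (simp only: vimage_def Int_def mem_Collect_eq freq simp_thms conj_commute)
        moreover have "{xs \<in> space (data_law P G Y \<theta>\<^sub>0 T). \<bar>gating_freq K T xs r - \<gamma> \<theta>\<^sub>0 r\<bar> > \<epsilon>} = ?S"
          by (simp add: data_law_def data_space_def)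
        moreover have "measure (data_law P G Y \<theta>\<^sub>0 T) ?S = measure (P \<theta>\<^sub>0) (observations G Y T -` ?S \<inter> space (P \<theta>\<^sub>0))"
          unfolding data_law_def by (rule measure_distr[OF ded.measurable_observations[OF \<theta>\<^sub>0]]) (auto simp: data_space_def)
        ultimately show ?thesis
          by (simp only:)
      qed
      \<comment> \<open>Convergence is given in the number of complete periods, which is
        \<open>T div K\<close> here and tends to infinity with \<open>T\<close>.\<close>
      moreover have "(\<lambda>T. measure (P \<theta>\<^sub>0) {\<omega> \<in> space (P \<theta>\<^sub>0).
           \<bar>(\<Sum>l<T div K. of_bool (G (r + l * K) \<omega>)) / real (T div K) - \<gamma> \<theta>\<^sub>0 r\<bar> > \<epsilon>}) \<longlonglongrightarrow> 0"
      proof (rule filterlim_compose[OF ded.gating_frequency_converges[OF \<theta>\<^sub>0 r \<open>0 < \<epsilon>\<close>]])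
        show "filterlim (\<lambda>T. T div K) sequentially sequentially"
          unfolding filterlim_at_top
        proof
          fix Z
          show "\<forall>\<^sub>F T in sequentially. Z \<le> T div K"
            using eventually_ge_at_top[of "Z * K"]
            by eventually_elim (use K in \<open>simp add: less_eq_div_iff_mult_less_eq\<close>)
        qed
      qed
      ultimately show "(\<lambda>T. measure (data_law P G Y \<theta>\<^sub>0 T)
          {xs \<in> space (data_law P G Y \<theta>\<^sub>0 T). \<bar>gating_freq K T xs r - \<gamma> \<theta>\<^sub>0 r\<bar> > \<epsilon>}) \<longlonglongrightarrow> 0"
        by simp
    qed
    show "I\<^sub>0 = fisher K lam_ext \<theta>\<^sub>0 (\<gamma> \<theta>\<^sub>0)" by (rule I\<^sub>0_eq)
    show "pos_def I\<^sub>0" by (rule info_pos_def)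
    show "est T xs \<in> \<Theta>" if "length xs = T" for T xs
      using that by (rule est_in)
    show "bounded_in_prob (data_law P G Y \<theta>\<^sub>0) (\<lambda>T xs. sqrt (real T) *\<^sub>R (est T xs - \<theta>\<^sub>0))"
      by (rule est_root_T)
  qed
  have "local_error_law (data_law P G Y) (one_step K lam_ext est) \<theta>\<^sub>0 0
      = (\<lambda>T. distr (data_law P G Y \<theta>\<^sub>0 T) borel (\<lambda>xs. sqrt T *\<^sub>R (one_step K lam_ext est T xs - \<theta>\<^sub>0)))"
    by (rule ext) (simp add: local_error_law_def)
  \<comment> \<open>The convergence holds for every \<open>h\<close>, so the radius in the
    definition of regularity can be any positive number, here 1.\<close>
  then show ?thesis
    using one_step_weak_convergence[of 0] one_step_weak_convergence
    unfolding regular_at_def by (auto intro: exI[of _ 1])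
qed

end
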